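(* Let $n\geq 3$ and $m\in\mathbb{N}$. If the short exact sequence $$1\to B_m(\mathbb{R}P^2\setminus\{x_1,\dots,x_n\})\to B_{n,m}(\mathbb{R}P^2)\xrightarrow{\bar q} B_n(\mathbb{R}P^2)\to 1$$ splits, then $m\equiv 0 \pmod{n(n-1)}$ or $m\equiv (n-1)^2 \pmod{n(n-1)}$.
   Context: For a surface $\Sigma$, $F_k(\Sigma)$ is the ordered configuration space of $k$ distinct points of $\Sigma$, $B_k(\Sigma)=\pi_1(F_k(\Sigma)/S_k)$, and $B_{n,m}(\Sigma)=\pi_1(F_{n+m}(\Sigma)/(S_n\times S_m))$, i.e. the subgroup of $B_{n+m}(\Sigma)$ of braids whose permutation lies in $S_n\times S_m$. The homomorphism $\bar q:B_{n,m}(\mathbb{R}P^2)\to B_n(\mathbb{R}P^2)$ is induced by the map forgetting the last $m$ points (forgetting the last $m$ strands); its kernel is $B_m(\mathbb{R}P^2\setminus\{x_1,\dots,x_n\})$. "Splits" means $\bar q$ admits a homomorphic section. *)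

theory Defs
  imports "HOL-Analysis.Analysis" "HOL-Algebra.Group"
begin

definition quotient_topology :: "'a topology \<Rightarrow> ('a \<Rightarrow> 'b) \<Rightarrow> 'b topology" where
  "quotient_topology X p =
     topology (\<lambda>U. U \<subseteq> p ` topspace X \<and> openin X {x \<in> topspace X. p x \<in> U})"

definition RP2 :: "(real^3) set topology" where
  "RP2 = quotient_topology (top_of_set (sphere (0::real^3) 1)) (\<lambda>x. {x, -x})"

definition ordered_conf :: "'a topology \<Rightarrow> nat \<Rightarrow> (nat \<Rightarrow> 'a) topology" where
  "ordered_conf X k = subtopology (product_topology (\<lambda>_. X) {..<k}) {f. inj_on f {..<k}}"

definition unordered_conf :: "'a topology \<Rightarrow> nat \<Rightarrow> 'a set topology" where
  "unordered_conf X n = quotient_topology (ordered_conf X n) (\<lambda>f. f ` {..<n})"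

text \<open>Two-coloured configuration space F_{n+m}(X)/(S_n x S_m): points are pairs (A,B)
  of disjoint subsets with |A| = n, |B| = m (the first n points, the last m points).\<close>
definition coloured_conf :: "'a topology \<Rightarrow> nat \<Rightarrow> nat \<Rightarrow> ('a set \<times> 'a set) topology" where
  "coloured_conf X n m =
     quotient_topology (ordered_conf X (n + m)) (\<lambda>f. (f ` {..<n}, f ` {n..<n + m}))"

definition path_concat :: "(real \<Rightarrow> 'a) \<Rightarrow> (real \<Rightarrow> 'a) \<Rightarrow> real \<Rightarrow> 'a" where
  "path_concat p q = (\<lambda>t. if t \<le> 1/2 then p (2 * t) else q (2 * t - 1))"

definition loops :: "'a topology \<Rightarrow> 'a \<Rightarrow> (real \<Rightarrow> 'a) set" where
  "loops X x0 = {p. pathin X p \<and> p 0 = x0 \<and> p 1 = x0}"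

definition loop_homotopic :: "'a topology \<Rightarrow> 'a \<Rightarrow> (real \<Rightarrow> 'a) \<Rightarrow> (real \<Rightarrow> 'a) \<Rightarrow> bool" where
  "loop_homotopic X x0 p q \<longleftrightarrow>
     (\<exists>h. continuous_map (prod_topology (top_of_set {0..1::real}) (top_of_set {0..1::real})) X h \<and>
          (\<forall>s\<in>{0..1::real}. h (0, s) = p s \<and> h (1, s) = q s) \<and>
          (\<forall>t\<in>{0..1::real}. h (t, 0) = x0 \<and> h (t, 1) = x0))"

definition loop_rel :: "'a topology \<Rightarrow> 'a \<Rightarrow> ((real \<Rightarrow> 'a) \<times> (real \<Rightarrow> 'a)) set" where
  "loop_rel X x0 = {(p, q). p \<in> loops X x0 \<and> q \<in> loops X x0 \<and> loop_homotopic X x0 p q}"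

definition fundamental_group :: "'a topology \<Rightarrow> 'a \<Rightarrow> (real \<Rightarrow> 'a) set monoid" where
  "fundamental_group X x0 =
     \<lparr> carrier = loops X x0 // loop_rel X x0,
       mult = (\<lambda>a b. loop_rel X x0 `` {path_concat (SOME p. p \<in> a) (SOME q. q \<in> b)}),
       one = loop_rel X x0 `` {\<lambda>_. x0} \<rparr>"

definition induced_hom ::
  "'a topology \<Rightarrow> 'b topology \<Rightarrow> ('a \<Rightarrow> 'b) \<Rightarrow> 'a \<Rightarrow> (real \<Rightarrow> 'a) set \<Rightarrow> (real \<Rightarrow> 'b) set" where
  "induced_hom X Y f x0 a = loop_rel Y (f x0) `` {f \<circ> (SOME p. p \<in> a)}"

end

theory Submission
  imports Defs
begin

text \<open>Rotating \<open>k\<close> equidistant points of the equator by \<open>pi / k\<close>, possibly together with the fixed pole of the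
  rotation, gives torsion elements of \<open>B_n(RP2)\<close> for \<open>k = n\<close> and \<open>k = n - 1\<close>: their power \<open>4 * k\<close> is a
  rotation by \<open>4 * pi\<close>, which is trivial because the sphere of unit quaternions is simply connected. A section
  lifts them to torsion elements of \<open>B_{n,m}(RP2)\<close>.

  The key claim is that a power \<open>d\<close> of such a lift which fixes two further points of the configuration
  is a multiple of \<open>k\<close>. Two fixed points \<open>y1\<close>, \<open>y2\<close> provide a moving frame, in which stereographic
  projection turns the lifts of the other points into a braid in the plane. This braid is torsion, and a torsion
  braid cannot permute \<open>N \<ge> 2\<close> of its strands cyclically: in the Burau representation at \<open>t\<close> with \<open>|t| = 1\<close>, the fixed
  space of a torsion element has locally constant dimension; for an \<open>N\<close>-cycle it is a line at \<open>t = 1\<close>,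
  spanned by the constant vector, whereas at \<open>t = cis (2 * pi / N)\<close> the invariant functional of the Burau representation
  kills the constant vector, so that the fixed space must be larger.

  For \<open>k = n\<close> this shows that all cycles of the lift on the \<open>m\<close> new points have length divisible by \<open>n\<close>, except for at
  most one fixed point. For \<open>k = n - 1\<close> the pole serves as \<open>y1\<close>, and all cycles on the \<open>m\<close> new points
  have length divisible by \<open>n - 1\<close>.\<close>

section \<open>Monodromy of local systems\<close>

text \<open>The base points are arbitrary and the section is only known to be a homomorphism, so
  nothing is computed inside braid groups. All information is read off as holonomy on fibres over
  configurations, where torsion of a loop becomes finite order of a map. Points of the projective
  plane have no planar coordinates; fixing them takes an axis \<open>y1\<close> and a second
  direction \<open>y2\<close>, hence two fixed points. A fixed point determines its lift only up to
  sign, so powers get doubled. A cycle of length \<open>d\<close>, at least 2, supplies two points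
  fixed by the power \<open>d\<close>, whereas a single fixed point yields only an axis; this is
  where the exceptional point for \<open>k = n\<close> comes from. In the end \<open>m\<close> is 0
  modulo \<open>n - 1\<close>, and 0 or 1 modulo \<open>n\<close>; the residue of
  \<open>(n-1)^2\<close> is the common solution of 0 modulo \<open>n - 1\<close> and 1 modulo
  \<open>n\<close>.\<close>

text \<open>The map \<open>g x y\<close> transports the fibre over \<open>y\<close> to the fibre over \<open>x\<close>, for \<open>y\<close> in the neighbourhood
  \<open>U x\<close> of \<open>x\<close>.\<close>

locale local_system =
  fixes X :: "'x topology" and E :: "'x \<Rightarrow> 'f set" and U :: "'x \<Rightarrow> 'x set"
    and g :: "'x \<Rightarrow> 'x \<Rightarrow> 'f \<Rightarrow> 'f"
  assumes open_U: "x \<in> topspace X \<Longrightarrow> openin X (U x)"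
    and centre_U: "x \<in> topspace X \<Longrightarrow> x \<in> U x"
    and bij_g: "x \<in> topspace X \<Longrightarrow> y \<in> U x \<Longrightarrow> bij_betw (g x y) (E y) (E x)"
    and g_refl: "x \<in> topspace X \<Longrightarrow> f \<in> E x \<Longrightarrow> g x x f = f"
    and coherent: "x \<in> topspace X \<Longrightarrow> y \<in> U x \<Longrightarrow>
      \<exists>V. openin X V \<and> y \<in> V \<and> V \<subseteq> U x \<inter> U y \<and> (\<forall>w\<in>V. \<forall>f\<in>E w. g x w f = g x y (g y w f))"

lemma continuous_map_nbhd:
  assumes "continuous_map (top_of_set K) X h" "openin X V" "k \<in> K" "h k \<in> V"
  obtains T where "open T" "k \<in> T" "\<And>k'. k' \<in> K \<inter> T \<Longrightarrow> h k' \<in> V"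
proof -
  have "openin (top_of_set K) {x \<in> K. h x \<in> V}"
    using openin_continuous_map_preimage[OF assms(1,2)] by simp
  then obtain T where T: "open T" "{x \<in> K. h x \<in> V} = K \<inter> T"
    by (auto simp: openin_open)
  show ?thesis
    by (rule that[of T]) (use T assms in auto)
qed

context local_system
begin

text \<open>Parallel sections of the system pulled back along \<open>h\<close>. Constancy is
  measured at each \<open>k\<close> in the fibre over \<open>h k\<close>, so the fibres need no
  topology.\<close>

definition flat :: "'k::topological_space set \<Rightarrow> ('k \<Rightarrow> 'x) \<Rightarrow> ('k \<Rightarrow> 'f) \<Rightarrow> bool" where
  "flat K h F \<longleftrightarrow> (\<forall>k\<in>K. h k \<in> topspace X \<and> F k \<in> E (h k) \<and>
     (\<exists>T. open T \<and> k \<in> T \<and> (\<forall>k'\<in>K \<inter> T. h k' \<in> U (h k) \<and> g (h k) (h k') (F k') = F k)))"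

lemma flatD:
  assumes "flat K h F" "k \<in> K"
  shows "h k \<in> topspace X" "F k \<in> E (h k)"
  using assms by (auto simp: flat_def)

lemma flat_nbhd:
  assumes "flat K h F" "k \<in> K"
  obtains T where "open T" "k \<in> T"
    "\<And>k'. k' \<in> K \<Longrightarrow> k' \<in> T \<Longrightarrow> h k' \<in> U (h k) \<and> g (h k) (h k') (F k') = F k"
  using assms unfolding flat_def by (meson IntI)

lemma flat_subset:
  assumes "flat K h F" "K' \<subseteq> K"
  shows "flat K' h F"
  unfolding flat_def
proof (intro ballI conjI)
  fix k assume "k \<in> K'"
  then have k: "k \<in> K" using assms(2) by auto
  show "h k \<in> topspace X" "F k \<in> E (h k)" using flatD[OF assms(1) k] by auto
  obtain T where "open T" "k \<in> T"
    "\<And>k'. k' \<in> K \<Longrightarrow> k' \<in> T \<Longrightarrow> h k' \<in> U (h k) \<and> g (h k) (h k') (F k') = F k"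
    using flat_nbhd[OF assms(1) k] by metis
  then show "\<exists>T. open T \<and> k \<in> T \<and> (\<forall>k'\<in>K' \<inter> T. h k' \<in> U (h k) \<and> g (h k) (h k') (F k') = F k)"
    using assms(2) by (intro exI[of _ T]) auto
qed

lemma flat_cong:
  assumes "flat K h F" "\<And>k. k \<in> K \<Longrightarrow> h k = h' k" "\<And>k. k \<in> K \<Longrightarrow> F k = F' k"
  shows "flat K h' F'"
proof -
  have "\<exists>T. open T \<and> k \<in> T \<and> (\<forall>k'\<in>K \<inter> T. h' k' \<in> U (h' k) \<and> g (h' k) (h' k') (F' k') = F' k)"
    if k: "k \<in> K" for k
  proof -
    obtain T where "open T" "k \<in> T"
      "\<And>k'. k' \<in> K \<Longrightarrow> k' \<in> T \<Longrightarrow> h k' \<in> U (h k) \<and> g (h k) (h k') (F k') = F k"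
      using flat_nbhd[OF assms(1) k] by metis
    then show ?thesis using assms(2,3) k by (intro exI[of _ T]) auto
  qed
  then show ?thesis using assms unfolding flat_def by auto
qed

lemma flat_compose:
  assumes F: "flat K h F" and c: "continuous_on K' \<phi>" and sub: "\<phi> ` K' \<subseteq> K"
  shows "flat K' (\<lambda>k. h (\<phi> k)) (\<lambda>k. F (\<phi> k))"
  unfolding flat_def
proof (intro ballI conjI)
  fix k assume k: "k \<in> K'"
  then have k': "\<phi> k \<in> K" using sub by auto
  show "h (\<phi> k) \<in> topspace X" "F (\<phi> k) \<in> E (h (\<phi> k))" using flatD[OF F k'] by auto
  obtain T where T: "open T" "\<phi> k \<in> T"
    "\<And>k'. k' \<in> K \<Longrightarrow> k' \<in> T \<Longrightarrow> h k' \<in> U (h (\<phi> k)) \<and> g (h (\<phi> k)) (h k') (F k') = F (\<phi> k)"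
    using flat_nbhd[OF F k'] by metis
  obtain A where A: "open A" "k \<in> A" "\<forall>y\<in>K'. y \<in> A \<longrightarrow> \<phi> y \<in> T"
    using c k T(1,2) unfolding continuous_on_topological by meson
  show "\<exists>T. open T \<and> k \<in> T \<and> (\<forall>k'\<in>K' \<inter> T. h (\<phi> k') \<in> U (h (\<phi> k)) \<and> g (h (\<phi> k)) (h (\<phi> k')) (F (\<phi> k')) = F (\<phi> k))"
    using A T(3) sub by (intro exI[of _ A]) auto
qed

lemma flat_const:
  assumes "x \<in> topspace X" "f \<in> E x" "\<And>k. k \<in> K \<Longrightarrow> h k = x"
  shows "flat K h (\<lambda>_. f)"
  unfolding flat_def using assms g_refl centre_U by (auto intro!: exI[of _ UNIV])

text \<open>A relation respected by all transports has a locally constant truth value along parallel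
  sections. Three sections suffice for equations of the form \<open>u = \<psi> s t\<close>, which
  express linearity of the holonomy later.\<close>

lemma flat_invariant:
  fixes K :: "'k::topological_space set"
  assumes K: "connected K" and F: "flat K h F1" "flat K h F2" "flat K h F3"
    and Q: "\<And>x y f1 f2 f3. x \<in> topspace X \<Longrightarrow> y \<in> U x \<Longrightarrow> f1 \<in> E y \<Longrightarrow> f2 \<in> E y \<Longrightarrow> f3 \<in> E y \<Longrightarrow>
        Q x (g x y f1) (g x y f2) (g x y f3) \<longleftrightarrow> Q y f1 f2 f3"
    and a: "a \<in> K" and b: "b \<in> K" and Qa: "Q (h a) (F1 a) (F2 a) (F3 a)"
  shows "Q (h b) (F1 b) (F2 b) (F3 b)"
proof (rule connected_induction_simple[where P = "\<lambda>k. Q (h k) (F1 k) (F2 k) (F3 k)", OF K a b Qa])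
  fix k assume k: "k \<in> K"
  obtain T1 where T1: "open T1" "k \<in> T1"
    "\<And>k'. k' \<in> K \<Longrightarrow> k' \<in> T1 \<Longrightarrow> h k' \<in> U (h k) \<and> g (h k) (h k') (F1 k') = F1 k"
    using flat_nbhd[OF F(1) k] by metis
  obtain T2 where T2: "open T2" "k \<in> T2"
    "\<And>k'. k' \<in> K \<Longrightarrow> k' \<in> T2 \<Longrightarrow> h k' \<in> U (h k) \<and> g (h k) (h k') (F2 k') = F2 k"
    using flat_nbhd[OF F(2) k] by metis
  obtain T3 where T3: "open T3" "k \<in> T3"
    "\<And>k'. k' \<in> K \<Longrightarrow> k' \<in> T3 \<Longrightarrow> h k' \<in> U (h k) \<and> g (h k) (h k') (F3 k') = F3 k"
    using flat_nbhd[OF F(3) k] by metis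
  let ?T = "T1 \<inter> T2 \<inter> T3"
  have *: "Q (h k') (F1 k') (F2 k') (F3 k') \<longleftrightarrow> Q (h k) (F1 k) (F2 k) (F3 k)" if "k' \<in> K \<inter> ?T" for k'
  proof -
    have "Q (h k) (g (h k) (h k') (F1 k')) (g (h k) (h k') (F2 k')) (g (h k) (h k') (F3 k'))
       \<longleftrightarrow> Q (h k') (F1 k') (F2 k') (F3 k')"
      by (rule Q) (use that T1(3) flatD F k in auto)
    then show ?thesis using T1(3) T2(3) T3(3) that by auto
  qed
  have "openin (top_of_set K) (K \<inter> ?T)" "k \<in> K \<inter> ?T"
    using T1(1,2) T2(1,2) T3(1,2) k by (auto intro!: openin_open_Int)
  then show "\<exists>T. openin (top_of_set K) T \<and> k \<in> T \<and>
      (\<forall>x\<in>T. \<forall>y\<in>T. Q (h x) (F1 x) (F2 x) (F3 x) \<longrightarrow> Q (h y) (F1 y) (F2 y) (F3 y))"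
    using * by blast
qed

lemma flat_unique:
  fixes K :: "'k::topological_space set"
  assumes "connected K" "flat K h F" "flat K h F'" "a \<in> K" "F a = F' a" "b \<in> K"
  shows "F b = F' b"
proof (rule flat_invariant[where Q = "\<lambda>_ u v _. u = v" and ?F3.0 = F and h = h, OF assms(1,2,3,2) _ assms(4,6,5)])
  fix x y f1 f2
  assume "x \<in> topspace X" "y \<in> U x" "f1 \<in> E y" "f2 \<in> E y"
  then show "g x y f1 = g x y f2 \<longleftrightarrow> f1 = f2"
    using bij_g by (metis bij_betw_def inj_on_eq_iff)
qed

section \<open>Existence of parallel sections over paths and squares\<close>

definition extendable :: "('k::topological_space \<Rightarrow> 'x) \<Rightarrow> 'k set \<Rightarrow> bool" where
  "extendable h S \<longleftrightarrow> (\<forall>a\<in>S. \<forall>f\<in>E (h a). \<exists>F. flat S h F \<and> F a = f)"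

text \<open>Where the image stays in \<open>U (h k)\<close>, all fibres are identified with the one
  over \<open>h k\<close>, and a constant there is a section. Coherence turns constancy seen from
  \<open>k\<close> into constancy seen from every other point.\<close>

lemma extendable_local:
  fixes K :: "'k::topological_space set"
  assumes h: "continuous_map (top_of_set K) X h" and k: "k \<in> K"
  obtains T where "open T" "k \<in> T" "\<And>S. S \<subseteq> K \<inter> T \<Longrightarrow> extendable h S"
proof -
  have top: "h x \<in> topspace X" if "x \<in> K" for x
    using h that by (auto simp: continuous_map_def)
  obtain T where T: "open T" "k \<in> T" "\<And>k'. k' \<in> K \<inter> T \<Longrightarrow> h k' \<in> U (h k)"
    using continuous_map_nbhd[OF h open_U[OF top[OF k]] k centre_U[OF top[OF k]]] by metis
  have "extendable h S" if S: "S \<subseteq> K \<inter> T" for S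
    unfolding extendable_def
  proof (intro ballI)
    fix a f assume a: "a \<in> S" and f: "f \<in> E (h a)"
    define f0 where "f0 = g (h k) (h a) f"
    have bij: "bij_betw (g (h k) (h x)) (E (h x)) (E (h k))" if "x \<in> S" for x
      using bij_g top k T(3) S that by blast
    have f0: "f0 \<in> E (h k)" using bij[OF a] f by (auto simp: f0_def bij_betw_def)
    define F where "F x = inv_into (E (h x)) (g (h k) (h x)) f0" for x
    have F: "F x \<in> E (h x)" "g (h k) (h x) (F x) = f0" if "x \<in> S" for x
      using bij[OF that] f0 unfolding F_def
      by (metis bij_betw_def inv_into_into) (metis bij[OF that] bij_betw_inv_into_right f0)
    have "flat S h F" unfolding flat_def
    proof (intro ballI conjI)
      fix x assume x: "x \<in> S"
      show "h x \<in> topspace X" using x S top by auto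
      show "F x \<in> E (h x)" using F x by auto
      have "h x \<in> U (h k)" using x S T by auto
      from coherent[OF top[OF k] this] obtain V where V: "openin X V" "h x \<in> V" "V \<subseteq> U (h k) \<inter> U (h x)"
        "\<forall>w\<in>V. \<forall>f\<in>E w. g (h k) w f = g (h k) (h x) (g (h x) w f)" by metis
      obtain T' where T': "open T'" "x \<in> T'" "\<And>k'. k' \<in> K \<inter> T' \<Longrightarrow> h k' \<in> V"
        using continuous_map_nbhd[OF h V(1) _ V(2)] x S by blast
      have "h y \<in> U (h x) \<and> g (h x) (h y) (F y) = F x" if y: "y \<in> S \<inter> T'" for y
      proof
        have hV: "h y \<in> V" using T'(3) y S by auto
        then show "h y \<in> U (h x)" using V by auto
        have "g (h k) (h x) (g (h x) (h y) (F y)) = g (h k) (h x) (F x)"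
          using V(4) hV F y x by (metis IntD1)
        moreover have "g (h x) (h y) (F y) \<in> E (h x)"
          using bij_betwE[OF bij_g[of "h x" "h y"]] V hV F(1)[of y] y x S top by blast
        ultimately show "g (h x) (h y) (F y) = F x"
          using bij[OF x] F(1)[OF x] by (metis bij_betw_def inj_on_eq_iff)
      qed
      then show "\<exists>T. open T \<and> x \<in> T \<and> (\<forall>k'\<in>S \<inter> T. h k' \<in> U (h x) \<and> g (h x) (h k') (F k') = F x)"
        using T' by blast
    qed
    moreover have "F a = f"
      using F[OF a] bij[OF a] f unfolding f0_def by (metis bij_betw_def inj_on_eq_iff)
    ultimately show "\<exists>F. flat S h F \<and> F a = f" by blast
  qed
  with T show ?thesis using that by blast
qed

lemma flat_glue:
  fixes S1 S2 :: "'k::topological_space set"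
  assumes c: "closed S1" "closed S2"
    and F: "flat S1 h F1" "flat S2 h F2" and eq: "\<And>k. k \<in> S1 \<inter> S2 \<Longrightarrow> F1 k = F2 k"
  shows "flat (S1 \<union> S2) h (\<lambda>k. if k \<in> S1 then F1 k else F2 k)" (is "flat _ _ ?F")
  unfolding flat_def
proof (intro ballI conjI)
  fix k assume k: "k \<in> S1 \<union> S2"
  show "h k \<in> topspace X" "?F k \<in> E (h k)" using k flatD F by auto
  have "\<exists>T. open T \<and> k \<in> T \<and> (\<forall>k'\<in>S1 \<inter> T. h k' \<in> U (h k) \<and> g (h k) (h k') (?F k') = ?F k)"
  proof (cases "k \<in> S1")
    case True
    obtain T where "open T" "k \<in> T" "\<And>k'. k' \<in> S1 \<Longrightarrow> k' \<in> T \<Longrightarrow> h k' \<in> U (h k) \<and> g (h k) (h k') (F1 k') = F1 k"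
      using flat_nbhd[OF F(1) True] by metis
    then show ?thesis using True by (intro exI[of _ T]) auto
  next
    case False
    then show ?thesis using c by (intro exI[of _ "- S1"]) auto
  qed
  then obtain T1 where T1: "open T1" "k \<in> T1" "\<forall>k'\<in>S1 \<inter> T1. h k' \<in> U (h k) \<and> g (h k) (h k') (?F k') = ?F k"
    by blast
  have F2: "?F x = F2 x" if "x \<in> S2" for x using eq that by auto
  have "\<exists>T. open T \<and> k \<in> T \<and> (\<forall>k'\<in>S2 \<inter> T. h k' \<in> U (h k) \<and> g (h k) (h k') (?F k') = ?F k)"
  proof (cases "k \<in> S2")
    case True
    obtain T where "open T" "k \<in> T" "\<And>k'. k' \<in> S2 \<Longrightarrow> k' \<in> T \<Longrightarrow> h k' \<in> U (h k) \<and> g (h k) (h k') (F2 k') = F2 k"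
      using flat_nbhd[OF F(2) True] by metis
    then show ?thesis using True F2 by (intro exI[of _ T]) auto
  next
    case False
    then show ?thesis using c by (intro exI[of _ "- S2"]) auto
  qed
  then obtain T2 where T2: "open T2" "k \<in> T2" "\<forall>k'\<in>S2 \<inter> T2. h k' \<in> U (h k) \<and> g (h k) (h k') (?F k') = ?F k"
    by blast
  show "\<exists>T. open T \<and> k \<in> T \<and> (\<forall>k'\<in>(S1 \<union> S2) \<inter> T. h k' \<in> U (h k) \<and> g (h k) (h k') (?F k') = ?F k)"
    by (rule exI[of _ "T1 \<inter> T2"]) (use T1 T2 in blast)
qed

text \<open>A section on one piece is continued from the common point \<open>e\<close>;
  connectedness of the intersection makes the two parts agree on all of it.\<close>

lemma extendable_Un:
  fixes S1 S2 :: "'k::topological_space set"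
  assumes c: "closed S1" "closed S2" "connected (S1 \<inter> S2)" "e \<in> S1 \<inter> S2"
    and S: "extendable h S1" "extendable h S2"
  shows "extendable h (S1 \<union> S2)"
proof -
  have *: "\<exists>F. flat (A \<union> B) h F \<and> F a = f"
    if A: "closed A" "closed B" "connected (A \<inter> B)" "e \<in> A \<inter> B" "extendable h A" "extendable h B"
      and a: "a \<in> A" "f \<in> E (h a)" for A B a f
  proof -
    obtain F1 where F1: "flat A h F1" "F1 a = f" using A(5) a by (auto simp: extendable_def)
    have "F1 e \<in> E (h e)" using flatD F1 A by blast
    moreover have "e \<in> B" using A by auto
    ultimately obtain F2 where F2: "flat B h F2" "F2 e = F1 e"
      using A(6) unfolding extendable_def by blast
    have "F1 k = F2 k" if "k \<in> A \<inter> B" for k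
      by (rule flat_unique[OF A(3) flat_subset[OF F1(1)] flat_subset[OF F2(1)] A(4)]) (use F2 that in auto)
    from flat_glue[OF A(1,2) F1(1) F2(1) this] show ?thesis
      using F1(2) a by (intro exI[of _ "\<lambda>k. if k \<in> A then F1 k else F2 k"]) auto
  qed
  show ?thesis unfolding extendable_def
  proof (intro ballI)
    fix a f assume "a \<in> S1 \<union> S2" "f \<in> E (h a)"
    then show "\<exists>F. flat (S1 \<union> S2) h F \<and> F a = f"
      using *[of S1 S2 a f] *[of S2 S1 a f] assms by (auto simp: Int_commute Un_commute)
  qed
qed

text \<open>Bisection in both directions. For a fixed abscissa the inner induction finds one width
  that serves the whole vertical strip, by keeping the minimum of the widths when pieces are
  stacked.\<close>

lemma extendable_rectangle:
  fixes h :: "real \<times> real \<Rightarrow> 'x"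
  assumes h: "continuous_map euclidean X h" and "a \<le> b" "c \<le> d"
  shows "extendable h ({a..b} \<times> {c..d})"
  using \<open>a \<le> b\<close>
proof (induction a b rule: Bolzano)
  case (trans a b e)
  then have eq: "{a..e} \<times> {c..d} = {a..b} \<times> {c..d} \<union> {b..e} \<times> {c..d}" by auto
  have "{a..b} \<times> {c..d} \<inter> {b..e} \<times> {c..d} = {b} \<times> {c..d}" using trans by auto
  then show ?case unfolding eq using trans assms
    by (intro extendable_Un[where e = "(b,c)"]) (auto intro!: closed_Times connected_Times)
next
  case (local x)
  have "\<exists>e>0. \<forall>a b. a \<le> x \<and> x \<le> b \<and> b - a < e \<longrightarrow> extendable h ({a..b} \<times> {c..d})"
    using \<open>c \<le> d\<close>
  proof (induction c d rule: Bolzano)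
    case (trans c d c')
    from trans(1) obtain e1 where e1: "e1 > 0" "\<And>a b. a \<le> x \<and> x \<le> b \<and> b - a < e1 \<Longrightarrow> extendable h ({a..b} \<times> {c..d})" by metis
    from trans(2) obtain e2 where e2: "e2 > 0" "\<And>a b. a \<le> x \<and> x \<le> b \<and> b - a < e2 \<Longrightarrow> extendable h ({a..b} \<times> {d..c'})" by metis
    show ?case
    proof (intro exI[of _ "min e1 e2"] conjI allI impI)
      show "min e1 e2 > 0" using e1 e2 by auto
      fix a b assume ab: "a \<le> x \<and> x \<le> b \<and> b - a < min e1 e2"
      have eq: "{a..b} \<times> {c..c'} = {a..b} \<times> {c..d} \<union> {a..b} \<times> {d..c'}" using trans by auto
      have "{a..b} \<times> {c..d} \<inter> {a..b} \<times> {d..c'} = {a..b} \<times> {d}" using trans by auto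
      then show "extendable h ({a..b} \<times> {c..c'})" unfolding eq using trans ab e1 e2
        by (intro extendable_Un[where e = "(x,d)"]) (auto intro!: closed_Times connected_Times)
    qed
  next
    case (local y)
    obtain T where T: "open T" "(x,y) \<in> T" "\<And>S. S \<subseteq> UNIV \<inter> T \<Longrightarrow> extendable h S"
      using extendable_local[of UNIV h "(x,y)"] h by auto
    obtain r where r: "r > 0" "ball (x,y) r \<subseteq> T" using T by (meson open_contains_ball)
    have sub: "{a..b} \<times> {c..d} \<subseteq> T"
      if "a \<le> x" "x \<le> b" "b - a < r/2" "c \<le> y" "y \<le> d" "d - c < r/2" for a b c d
    proof -
      have "dist (x,y) (u,v) < r" if "u \<in> {a..b}" "v \<in> {c..d}" for u v
      proof -
        have "dist (x,y) (u,v) \<le> \<bar>x - u\<bar> + \<bar>y - v\<bar>"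
          by (simp add: dist_prod_def dist_real_def sqrt_sum_squares_le_sum_abs)
        then show ?thesis using that \<open>a \<le> x\<close> \<open>x \<le> b\<close> \<open>b - a < r/2\<close> \<open>c \<le> y\<close> \<open>y \<le> d\<close> \<open>d - c < r/2\<close> by auto
      qed
      then show ?thesis using r(2) by (auto simp: subset_iff)
    qed
    show ?case
    proof (intro exI[of _ "r/2"] conjI allI impI)
      show "r/2 > 0" using r by simp
      fix c d assume cd: "c \<le> y \<and> y \<le> d \<and> d - c < r/2"
      show "r/2 > 0" using r by simp
      fix a b assume "a \<le> x \<and> x \<le> b \<and> b - a < r/2"
      then show "extendable h ({a..b} \<times> {c..d})"
        using T(3)[of "{a..b} \<times> {c..d}"] sub[of a b c d] cd by simp
    qed
  qed
  then show ?case by blast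
qed

lemma flat_path_square:
  assumes h: "continuous_map (prod_topology (top_of_set {0..1::real}) (top_of_set {0..1::real})) X h"
    and f: "f \<in> E (h (0, 0))"
  obtains F where "flat ({0..1} \<times> {0..1}) h F" "F (0,0) = f"
proof -
  \<comment> \<open>Clamping the coordinates extends \<open>h\<close> from the square to the plane,
    where the rectangle induction takes place.\<close>
  define cl where "cl x = max 0 (min 1 x)" for x :: real
  define h' where "h' = h \<circ> (\<lambda>z. (cl (fst z), cl (snd z)))"
  have "continuous_map euclidean (prod_topology (top_of_set {0..1::real}) (top_of_set {0..1::real})) (\<lambda>z. (cl (fst z), cl (snd z)))"
    unfolding continuous_map_pairwise
    by (auto simp: continuous_map_in_subtopology o_def cl_def intro!: continuous_intros)
  then have "continuous_map euclidean X h'"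
    unfolding h'_def using h by (rule continuous_map_compose)
  from extendable_rectangle[OF this, of 0 1 0 1] have "extendable h' ({0..1} \<times> {0..1})" by simp
  moreover have eq: "h' k = h k" if "k \<in> {0..1} \<times> {0..1}" for k
    using that by (auto simp: h'_def cl_def max_def min_def)
  ultimately obtain F where F: "flat ({0..1} \<times> {0..1}) h' F" "F (0,0) = f"
    using f unfolding extendable_def by (metis atLeastAtMost_iff eq mem_Sigma_iff order_refl zero_le_one)
  have "flat ({0..1} \<times> {0..1}) h F" by (rule flat_cong[OF F(1)]) (use eq in auto)
  then show ?thesis using F(2) by (rule that)
qed

lemma flat_path:
  assumes p: "pathin X p" and f: "f \<in> E (p 0)"
  obtains F where "flat {0..1} p F" "F 0 = f"
proof -
  have "continuous_map (prod_topology (top_of_set {0..1::real}) (top_of_set {0..1::real})) X (p \<circ> snd)"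
    using p unfolding pathin_def by (intro continuous_map_compose[OF continuous_map_snd]) auto
  then obtain F :: "real \<times> real \<Rightarrow> 'f"
    where F: "flat ({0..1} \<times> {0..1}) (p \<circ> snd) F" "F (0,0) = f"
    using flat_path_square[of "p \<circ> snd" f] f by auto
  have "flat {0..1} (\<lambda>k. (p \<circ> snd) (0::real, k)) (\<lambda>k. F (0, k))"
    by (rule flat_compose[OF F(1)]) (auto intro!: continuous_intros)
  then have "flat {0..1} p (\<lambda>k. F (0, k))" by (rule flat_cong) auto
  then show ?thesis using F(2) by (rule that)
qed

text \<open>The choice is harmless, since a parallel section is determined by its initial
  value.\<close>

definition hol :: "(real \<Rightarrow> 'x) \<Rightarrow> 'f \<Rightarrow> 'f" where
  "hol p f = (SOME F. flat {0..1} p F \<and> F 0 = f) 1"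

lemma hol_eq:
  assumes "flat {0..1} p F"
  shows "hol p (F 0) = F 1"
proof -
  define G where "G = (SOME G. flat {0..1} p G \<and> G 0 = F 0)"
  have "flat {0..1} p G \<and> G 0 = F 0" unfolding G_def by (rule someI[of _ F]) (use assms in auto)
  then have "G 1 = F 1"
    using flat_unique[of "{0..1::real}" p G F 0 1] assms by auto
  then show ?thesis by (simp add: hol_def G_def)
qed

lemma hol_in:
  assumes p: "pathin X p" and f: "f \<in> E (p 0)"
  shows "hol p f \<in> E (p 1)"
proof -
  obtain F where F: "flat {0..1} p F" "F 0 = f" using flat_path[OF assms] .
  then show ?thesis using hol_eq[OF F(1)] flatD[OF F(1), of 1] by auto
qed

lemma hol_invariant:
  assumes p: "pathin X p" and f: "f1 \<in> E (p 0)" "f2 \<in> E (p 0)" "f3 \<in> E (p 0)"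
    and Q: "\<And>x y f1 f2 f3. x \<in> topspace X \<Longrightarrow> y \<in> U x \<Longrightarrow> f1 \<in> E y \<Longrightarrow> f2 \<in> E y \<Longrightarrow> f3 \<in> E y \<Longrightarrow>
        Q x (g x y f1) (g x y f2) (g x y f3) \<longleftrightarrow> Q y f1 f2 f3"
    and Q0: "Q (p 0) f1 f2 f3"
  shows "Q (p 1) (hol p f1) (hol p f2) (hol p f3)"
proof -
  obtain F1 where F1: "flat {0..1} p F1" "F1 0 = f1" using flat_path[OF p f(1)] .
  obtain F2 where F2: "flat {0..1} p F2" "F2 0 = f2" using flat_path[OF p f(2)] .
  obtain F3 where F3: "flat {0..1} p F3" "F3 0 = f3" using flat_path[OF p f(3)] .
  have "Q (p 1) (F1 1) (F2 1) (F3 1)"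
    by (rule flat_invariant[where K = "{0..1::real}" and a = 0 and h = p, OF _ F1(1) F2(1) F3(1)])
      (use Q Q0 F1 F2 F3 in auto)
  then show ?thesis using hol_eq[OF F1(1)] hol_eq[OF F2(1)] hol_eq[OF F3(1)] F1 F2 F3 by simp
qed

lemma hol_path_concat:
  assumes p: "pathin X (path_concat p q)" and pq: "p 1 = q 0" and f: "f \<in> E (p 0)"
  shows "hol (path_concat p q) f = hol q (hol p f)"
proof -
  have "f \<in> E (path_concat p q 0)" using f by (simp add: path_concat_def)
  then obtain F where F: "flat {0..1} (path_concat p q) F" "F 0 = f" using flat_path[OF p] by metis
  have "flat {0..1} (\<lambda>t. path_concat p q (t/2)) (\<lambda>t. F (t/2))"
    by (rule flat_compose[OF F(1)]) (auto intro!: continuous_intros)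
  then have 1: "flat {0..1} p (\<lambda>t. F (t/2))"
    by (rule flat_cong) (auto simp: path_concat_def)
  have "flat {0..1} (\<lambda>t. path_concat p q ((1+t)/2)) (\<lambda>t. F ((1+t)/2))"
    by (rule flat_compose[OF F(1)]) (auto intro!: continuous_intros)
  moreover have "path_concat p q ((1+t)/2) = q t" if "t \<in> {0..1}" for t
  proof -
    have "2 * ((1+t)/2) - 1 = t" "(1+t)/2 \<le> 1/2 \<longleftrightarrow> t \<le> 0" by (simp_all add: field_simps)
    then show ?thesis using that pq by (cases "t = 0") (auto simp: path_concat_def)
  qed
  ultimately have 2: "flat {0..1} q (\<lambda>t. F ((1+t)/2))"
    by (rule flat_cong) auto
  show ?thesis using hol_eq[OF 1] hol_eq[OF 2] hol_eq[OF F(1)] F(2) by simp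
qed

lemma hol_homotopic:
  assumes h: "loop_homotopic X x p q" and p: "p 0 = x" and f: "f \<in> E x"
  shows "hol p f = hol q f"
proof -
  obtain h where h: "continuous_map (prod_topology (top_of_set {0..1::real}) (top_of_set {0..1::real})) X h"
    "\<And>s. s \<in> {0..1} \<Longrightarrow> h (0,s) = p s \<and> h (1,s) = q s"
    "\<And>t. t \<in> {0..1} \<Longrightarrow> h (t,0) = x \<and> h (t,1) = x"
    using h unfolding loop_homotopic_def by blast
  have x: "x \<in> topspace X" using continuous_map_image_subset_topspace[OF h(1)] h(3)[of 0] by force
  have "f \<in> E (h (0,0))" using h(3)[of 0] f by auto
  then obtain F where F: "flat ({0..1} \<times> {0..1}) h F" "F (0,0) = f" using flat_path_square[OF h(1)] by metis
  have "flat {0..1} (\<lambda>t. h (0,t)) (\<lambda>t. F (0,t))"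
    by (rule flat_compose[OF F(1)]) (auto intro!: continuous_intros)
  then have 1: "flat {0..1} p (\<lambda>t. F (0,t))" by (rule flat_cong) (use h in auto)
  have "flat {0..1} (\<lambda>t. h (1,t)) (\<lambda>t. F (1,t))"
    by (rule flat_compose[OF F(1)]) (auto intro!: continuous_intros)
  then have 2: "flat {0..1} q (\<lambda>t. F (1,t))" by (rule flat_cong) (use h in auto)
  \<comment> \<open>Along the two sides on which the homotopy rests at \<open>x\<close>, constant
    sections are parallel, so the given one is constant by uniqueness.\<close>
  have side: "F (0,e) = F (1,e)" if e: "e = 0 \<or> e = 1" for e
  proof -
    have fl: "flat {0..1} (\<lambda>t. h (t,e)) (\<lambda>t. F (t,e))"
      by (rule flat_compose[OF F(1)]) (use e in \<open>auto intro!: continuous_intros\<close>)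
    have eq: "h (t,e) = x" if "t \<in> {0..1}" for t using h(3)[OF that] e by auto
    have "F (0,e) \<in> E x" using flatD(2)[OF fl, of 0] eq[of 0] by simp
    from flat_const[OF x this, of "{0..1}" "\<lambda>t. h (t,e)"] eq
    have c: "flat {0..1} (\<lambda>t. h (t,e)) (\<lambda>_. F (0,e))" by auto
    show ?thesis using flat_unique[OF _ fl c, of 0 1] by auto
  qed
  show ?thesis using hol_eq[OF 1] hol_eq[OF 2] side[of 0] side[of 1] F(2) by simp
qed

end

section \<open>Transport of colours along a braid\<close>

text \<open>Order from left to right, where a column is read as if its higher points stood slightly
  further left. A tie thus becomes a crossing only when the higher point ends up on the
  right.\<close>

definition before :: "(nat \<Rightarrow> complex) \<Rightarrow> nat \<Rightarrow> nat \<Rightarrow> bool" where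
  "before z i k \<longleftrightarrow> Re (z i) < Re (z k) \<or> Re (z i) = Re (z k) \<and> Im (z i) > Im (z k)"

text \<open>Composing the affine maps \<open>u \<mapsto> t * u + (1 - t) * c i\<close> over
  \<open>S\<close>, with the first strand outermost, gives
  \<open>t ^ card S * u + (1 - t) * wsum t z S c\<close>.\<close>

definition wsum :: "'a::comm_ring_1 \<Rightarrow> (nat \<Rightarrow> complex) \<Rightarrow> nat set \<Rightarrow> (nat \<Rightarrow> 'a) \<Rightarrow> 'a" where
  "wsum t z S c = (\<Sum>i\<in>S. t ^ card {k\<in>S. before z k i} * c i)"

definition crossers :: "nat \<Rightarrow> (nat \<Rightarrow> complex) \<Rightarrow> (nat \<Rightarrow> complex) \<Rightarrow> nat \<Rightarrow> nat set" where
  "crossers N z z' j = {i. i < N \<and> Re (z i) = Re (z j) \<and> Im (z i) > Im (z j) \<and> Re (z' i) > Re (z' j)}"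

text \<open>Attach to the strand \<open>i\<close> the affine map \<open>u \<mapsto> t * u + (1 - t) * c i\<close> as the holonomy around \<open>z i\<close> along
  the vertical ray coming from above. For points moving from \<open>z\<close> to a nearby \<open>z'\<close>, this ray to \<open>z j\<close> is crossed
  exactly by the points of its column that lie above \<open>z j\<close> and end up to its right; \<open>crossed\<close> says that
  \<open>c' j\<close> is the image of \<open>c j\<close> under the product of their affine maps, which is the Burau action.\<close>

definition crossed :: "'a::comm_ring_1 \<Rightarrow> nat \<Rightarrow> (nat \<Rightarrow> complex) \<Rightarrow> (nat \<Rightarrow> complex) \<Rightarrow> (nat \<Rightarrow> 'a) \<Rightarrow> (nat \<Rightarrow> 'a) \<Rightarrow> bool" where
  "crossed t N z z' c c' \<longleftrightarrow>
     (\<forall>j<N. c' j = t ^ card (crossers N z z' j) * c j + (1 - t) * wsum t z' (crossers N z z' j) c')"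

text \<open>Ties may be broken but no strict inequality is lost: this is all that a small motion of
  the points can do.\<close>

definition near :: "nat \<Rightarrow> (nat \<Rightarrow> complex) \<Rightarrow> (nat \<Rightarrow> complex) \<Rightarrow> bool" where
  "near N z z' \<longleftrightarrow> (\<forall>i<N. \<forall>j<N. (Re (z i) < Re (z j) \<longrightarrow> Re (z' i) < Re (z' j)) \<and>
      (Im (z i) < Im (z j) \<longrightarrow> Im (z' i) < Im (z' j)))"

lemma finite_crossers [simp]: "finite (crossers N z z' j)"
  by (simp add: crossers_def)

lemma before_asym: "before z i k \<Longrightarrow> \<not> before z k i"
  by (auto simp: before_def)

lemma before_trans: "before z i j \<Longrightarrow> before z j k \<Longrightarrow> before z i k"
  by (auto simp: before_def)

lemma wsum_empty [simp]: "wsum t z {} c = 0"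
  by (simp add: wsum_def)

lemma wsum_single [simp]: "wsum t z {i} c = c i"
proof -
  have "{k \<in> {i}. before z k i} = {}" by (auto simp: before_def)
  then have "card {k \<in> {i}. before z k i} = 0" by (simp only: card.empty)
  then show ?thesis unfolding wsum_def by (simp only: sum.insert finite.emptyI empty_iff not_False_eq_True sum.empty power_0 mult_1 add_0_right)
qed

lemma wsum_cong: "(\<And>i. i \<in> S \<Longrightarrow> c i = d i) \<Longrightarrow> wsum t z S c = wsum t z S d"
  by (simp add: wsum_def)

text \<open>The composition law of affine maps, for a block of strands that precedes another
  one.\<close>

lemma wsum_Un:
  assumes "finite A" "finite B" and ab: "\<And>a b. a \<in> A \<Longrightarrow> b \<in> B \<Longrightarrow> before z a b"
  shows "wsum t z (A \<union> B) c = wsum t z A c + t ^ card A * wsum t z B c"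
proof -
  have disj: "A \<inter> B = {}" using ab before_asym by blast
  have A: "{k \<in> A \<union> B. before z k i} = {k \<in> A. before z k i}" if "i \<in> A" for i
    using ab that before_asym by blast
  have "{k \<in> A \<union> B. before z k i} = A \<union> {k \<in> B. before z k i}" if "i \<in> B" for i
    using ab that by blast
  moreover have "card (A \<union> {k \<in> B. before z k i}) = card A + card {k \<in> B. before z k i}" for i
    using assms disj by (intro card_Un_disjoint) auto
  ultimately have B: "card {k \<in> A \<union> B. before z k i} = card A + card {k \<in> B. before z k i}" if "i \<in> B" for i
    using that by simp
  have "wsum t z (A \<union> B) c = (\<Sum>i\<in>A. t ^ card {k \<in> A \<union> B. before z k i} * c i)
      + (\<Sum>i\<in>B. t ^ card {k \<in> A \<union> B. before z k i} * c i)"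
    unfolding wsum_def by (rule sum.union_disjoint) (use assms disj in auto)
  also have "(\<Sum>i\<in>A. t ^ card {k \<in> A \<union> B. before z k i} * c i) = wsum t z A c"
    unfolding wsum_def by (rule sum.cong[OF refl]) (simp only: A)
  also have "(\<Sum>i\<in>B. t ^ card {k \<in> A \<union> B. before z k i} * c i) = t ^ card A * wsum t z B c"
    unfolding wsum_def sum_distrib_left by (rule sum.cong[OF refl]) (simp only: B power_add mult.assoc)
  finally show ?thesis .
qed

lemma wsum_reindex:
  assumes "inj_on \<pi> S"
  shows "wsum t (z \<circ> \<pi>) S (c \<circ> \<pi>) = wsum t z (\<pi> ` S) c"
proof -
  have "card {k \<in> S. before (z \<circ> \<pi>) k i} = card {k \<in> \<pi> ` S. before z k (\<pi> i)}" for i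
  proof -
    have "{k \<in> \<pi> ` S. before z k (\<pi> i)} = \<pi> ` {k \<in> S. before (z \<circ> \<pi>) k i}"
      by (auto simp: before_def)
    then show ?thesis using assms by (simp add: card_image inj_on_subset)
  qed
  then show ?thesis unfolding wsum_def using assms by (simp add: sum.reindex)
qed

lemma wsum_linear:
  "wsum t z S (\<lambda>i. a * c i + b * d i) = a * wsum t z S c + b * wsum t z S d"
  unfolding wsum_def by (simp add: sum_distrib_left sum.distrib[symmetric] algebra_simps)

text \<open>The lowest point of the rightmost column; peeling it off drives the inductions over sets
  of strands.\<close>

lemma ex_last:
  assumes "finite S" "S \<noteq> {}" "inj_on z S"
  obtains i where "i \<in> S" "\<And>k. k \<in> S - {i} \<Longrightarrow> before z k i"
proof -
  define M where "M = Max (Re ` z ` S)"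
  have M: "Re (z k) \<le> M" if "k \<in> S" for k using assms that by (auto simp: M_def)
  have "M \<in> Re ` z ` S" unfolding M_def by (rule Max_in) (use assms in auto)
  then have ne: "{k \<in> S. Re (z k) = M} \<noteq> {}" by auto
  define i where "i = arg_min_on (\<lambda>k. Im (z k)) {k \<in> S. Re (z k) = M}"
  have i: "i \<in> {k \<in> S. Re (z k) = M}" unfolding i_def by (rule arg_min_if_finite(1)) (use ne assms in auto)
  have im: "Im (z i) \<le> Im (z k)" if "k \<in> S" "Re (z k) = M" for k
    unfolding i_def by (rule arg_min_least) (use that assms ne in auto)
  show ?thesis
  proof (rule that)
    show "i \<in> S" using i by auto
    fix k assume k: "k \<in> S - {i}"
    then have "z k \<noteq> z i" using assms i by (auto simp: inj_on_def)
    then have "Re (z k) = M \<Longrightarrow> Im (z i) < Im (z k)" using im[of k] k i by (force simp: complex_eq_iff)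
    then show "before z k i" using i k M[of k] by (force simp: before_def)
  qed
qed

text \<open>The total holonomy around a set of strands that contains, with each strand, everything above
  it in the same column does not change; this makes the transport coherent and also provides its
  invariant functional.\<close>

lemma wsum_crossed:
  assumes z: "inj_on z {..<N}" and near: "near N z z'" and c: "crossed t N z z' c c'"
    and S: "S \<subseteq> {..<N}"
    and up: "\<And>i k. i \<in> S \<Longrightarrow> k < N \<Longrightarrow> Re (z k) = Re (z i) \<Longrightarrow> Im (z k) > Im (z i) \<Longrightarrow> k \<in> S"
  shows "wsum t z S c = wsum t z' S c'"
  using S up
proof (induction "card S" arbitrary: S)
  case 0
  then have "S = {}" using finite_subset[OF 0(2)] by auto
  then show ?case by simp
next
  case (Suc n)
  have fin: "finite S" using Suc finite_subset by blast
  moreover have "S \<noteq> {}" using Suc by auto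
  moreover have "inj_on z S" using z Suc inj_on_subset by blast
  ultimately obtain i where i: "i \<in> S" and last: "\<And>k. k \<in> S - {i} \<Longrightarrow> before z k i"
    using ex_last by metis
  define T where "T = S - {i}"
  \<comment> \<open>In \<open>z\<close> the strand \<open>i\<close> comes after all of
    \<open>A\<close> and \<open>R\<close>; in \<open>z'\<close> it stands between \<open>A\<close>
    and \<open>R\<close>. Moving it in front of \<open>R\<close> is compensated exactly by replacing
    \<open>c i\<close> with \<open>c' i\<close>.\<close>
  define R where "R = crossers N z z' i"
  define A where "A = T - R"
  have T: "wsum t z T c = wsum t z' T c'"
  proof (rule Suc.hyps(1))
    show "n = card T" using Suc i fin by (simp add: T_def)
    show "T \<subseteq> {..<N}" using Suc T_def by auto
    fix l k assume lk: "l \<in> T" "k < N" "Re (z k) = Re (z l)" "Im (z l) < Im (z k)"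
    then have "k \<in> S" using Suc(4)[of l k] T_def by auto
    moreover have "k \<noteq> i" using last[of l] lk unfolding T_def before_def by auto
    ultimately show "k \<in> T" by (simp add: T_def)
  qed
  have RT: "R \<subseteq> T" using Suc(4)[OF i] by (auto simp: R_def T_def crossers_def)
  have TA: "T = A \<union> R" "A \<inter> R = {}" using RT by (auto simp: A_def)
  have finA: "finite A" "finite R" using fin by (auto simp: A_def T_def R_def)
  have ai: "before z' a i" if "a \<in> A" for a
  proof -
    have a: "a \<in> S - {i}" "a \<notin> R" "a < N" "i < N" using that Suc(3) i by (auto simp: A_def T_def)
    from last[OF a(1)] consider "Re (z a) < Re (z i)" | "Re (z a) = Re (z i)" "Im (z a) > Im (z i)"
      by (auto simp: before_def)
    then show ?thesis
    proof cases
      case 1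
      then show ?thesis using near a by (auto simp: near_def before_def)
    next
      case 2
      then have "Im (z' a) > Im (z' i)" "\<not> Re (z' a) > Re (z' i)"
        using near a by (auto simp: near_def R_def crossers_def)
      then show ?thesis by (auto simp: before_def)
    qed
  qed
  have ir: "before z' i r" if "r \<in> R" for r
    using that by (auto simp: R_def crossers_def before_def)
  have "S = T \<union> {i}" using i by (auto simp: T_def)
  then have 1: "wsum t z S c = wsum t z T c + t ^ card T * c i"
    using wsum_Un[of T "{i}" z t c] last fin T_def by simp
  have 2: "wsum t z' T c' = wsum t z' A c' + t ^ card A * wsum t z' R c'"
    unfolding TA(1) using finA ai ir before_trans by (intro wsum_Un) metis+
  have "S = A \<union> ({i} \<union> R)" using TA \<open>S = T \<union> {i}\<close> by auto
  moreover have "wsum t z' (A \<union> ({i} \<union> R)) c' = wsum t z' A c' + t ^ card A * wsum t z' ({i} \<union> R) c'"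
    by (rule wsum_Un) (use finA ai in \<open>auto intro: before_trans[OF ai ir]\<close>)
  moreover have "wsum t z' ({i} \<union> R) c' = c' i + t * wsum t z' R c'"
    using wsum_Un[of "{i}" R z' t c'] finA ir by simp
  ultimately have 3: "wsum t z' S c' = wsum t z' A c' + t ^ card A * (c' i + t * wsum t z' R c')"
    by simp
  have "i < N" using Suc i by auto
  then have 4: "c' i = t ^ card R * c i + (1 - t) * wsum t z' R c'" using c by (auto simp: crossed_def R_def)
  have 5: "card T = card A + card R" using TA finA by (simp add: card_Un_disjoint)
  show ?case unfolding 1 T 2 3 4 5 by (simp add: algebra_simps power_add)
qed

text \<open>The strands crossed in two steps are those of the second step followed, in the order of
  \<open>z''\<close>, by those of the first. The composite for the latter is unchanged during the
  second step by \<open>wsum_crossed\<close>, so the two actions multiply.\<close>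

lemma crossed_trans:
  fixes t :: "'a::comm_ring_1"
  assumes inj: "inj_on z {..<N}" "inj_on z' {..<N}"
    and near: "near N z z'" "near N z' z''" "near N z z''"
    and c: "crossed t N z z' c c'" "crossed t N z' z'' c' c''"
  shows "crossed t N z z'' c c''"
  unfolding crossed_def
proof (intro allI impI)
  fix j assume j: "j < N"
  define R1 R2 R where R: "R1 = crossers N z z' j" "R2 = crossers N z' z'' j" "R = crossers N z z'' j"
  have nearD: "Re (a i) < Re (a k) \<Longrightarrow> Re (b i) < Re (b k)" "Im (a i) < Im (a k) \<Longrightarrow> Im (b i) < Im (b k)"
    if "near N a b" "i < N" "k < N" for a b i k
    using that by (auto simp: near_def)
  have fin: "finite R1" "finite R2" by (auto simp: R)
  have R12: "R = R2 \<union> R1"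
  proof (intro equalityI subsetI)
    fix i assume "i \<in> R"
    then have i: "i < N" "Re (z i) = Re (z j)" "Im (z i) > Im (z j)" "Re (z'' i) > Re (z'' j)"
      by (auto simp: R crossers_def)
    have "\<not> Re (z' i) < Re (z' j)" using nearD(1)[OF near(2) i(1) j] i by auto
    moreover have "Im (z' i) > Im (z' j)" using nearD(2)[OF near(1) j i(1)] i by auto
    ultimately show "i \<in> R2 \<union> R1" using i by (auto simp: R crossers_def)
  next
    fix i assume "i \<in> R2 \<union> R1"
    then show "i \<in> R"
    proof
      assume "i \<in> R1"
      then show ?thesis using nearD(1)[OF near(2) j, of i] by (auto simp: R crossers_def)
    next
      assume "i \<in> R2"
      then have i: "i < N" "Re (z' i) = Re (z' j)" "Im (z' i) > Im (z' j)" "Re (z'' i) > Re (z'' j)"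
        by (auto simp: R crossers_def)
      have re: "Re (z i) = Re (z j)"
        using nearD(1)[OF near(1) i(1) j] nearD(1)[OF near(1) j i(1)] i(2) by fastforce
      moreover have "z i \<noteq> z j" using inj(1) i j by (auto simp: inj_on_def)
      moreover have "\<not> Im (z i) < Im (z j)" using nearD(2)[OF near(1) i(1) j] i by auto
      ultimately show ?thesis using i by (auto simp: R crossers_def complex_eq_iff)
    qed
  qed
  have bef: "before z'' a b" if "a \<in> R2" "b \<in> R1" for a b
  proof -
    have "Re (z' a) < Re (z' b)" "a < N" "b < N" using that by (auto simp: R crossers_def)
    then show ?thesis using nearD(1)[OF near(2)] by (auto simp: before_def)
  qed
  have disj: "R2 \<inter> R1 = {}" using bef before_asym by blast
  have 1: "wsum t z'' R c'' = wsum t z'' R2 c'' + t ^ card R2 * wsum t z'' R1 c''"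
    unfolding R12 by (rule wsum_Un) (use bef fin in auto)
  have 2: "wsum t z' R1 c' = wsum t z'' R1 c''"
  proof (rule wsum_crossed[OF inj(2) near(2) c(2)])
    show "R1 \<subseteq> {..<N}" by (auto simp: R crossers_def)
    fix i k assume ik: "i \<in> R1" "k < N" "Re (z' k) = Re (z' i)" "Im (z' k) > Im (z' i)"
    then have i: "i < N" "Re (z i) = Re (z j)" "Im (z i) > Im (z j)" "Re (z' i) > Re (z' j)"
      by (auto simp: R crossers_def)
    have "Re (z k) = Re (z i)"
      using nearD(1)[OF near(1) i(1) ik(2)] nearD(1)[OF near(1) ik(2) i(1)] ik(3) by fastforce
    moreover have "\<not> Im (z k) < Im (z i)" using nearD(2)[OF near(1) ik(2) i(1)] ik by auto
    ultimately show "k \<in> R1" using i ik by (auto simp: R crossers_def)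
  qed
  have c1: "c' j = t ^ card R1 * c j + (1 - t) * wsum t z' R1 c'"
    using c(1) j by (auto simp: crossed_def R)
  have c2: "c'' j = t ^ card R2 * c' j + (1 - t) * wsum t z'' R2 c''"
    using c(2) j by (auto simp: crossed_def R)
  have card: "card R = card R2 + card R1" using R12 disj fin by (simp add: card_Un_disjoint)
  show "c'' j = t ^ card (crossers N z z'' j) * c j + (1 - t) * wsum t z'' (crossers N z z'' j) c''"
    unfolding R(3)[symmetric] card 1 by (subst c2, subst c1) (simp add: 2 algebra_simps power_add)
qed

text \<open>Crossers of \<open>j\<close> lie strictly above \<open>j\<close>, so the implicit
  equations for \<open>c'\<close> in \<open>crossed\<close> are solved from the top down along this
  rank.\<close>

definition height_rank :: "nat \<Rightarrow> (nat \<Rightarrow> complex) \<Rightarrow> nat \<Rightarrow> nat" where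
  "height_rank N z j = card {i. i < N \<and> Im (z i) > Im (z j)}"

lemma crossers_rank:
  assumes "i \<in> crossers N z z' j"
  shows "i < N" "height_rank N z i < height_rank N z j"
proof -
  show i: "i < N" using assms by (auto simp: crossers_def)
  show "height_rank N z i < height_rank N z j" unfolding height_rank_def
    by (rule psubset_card_mono) (use assms i in \<open>auto simp: crossers_def\<close>)
qed

lemma crossed_exists: "\<exists>c'. crossed t N z z' c c'"
proof -
  define H where "H f j = t ^ card (crossers N z z' j) * c j + (1 - t) * wsum t z' (crossers N z z' j) f" for f j
  define c' where "c' = wfrec (inv_image less_than (height_rank N z)) H"
  have "c' j = H c' j" for j
  proof -
    have "c' j = H (cut c' (inv_image less_than (height_rank N z)) j) j"
      unfolding c'_def by (rule wfrec) (simp add: wf_inv_image)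
    also have "\<dots> = H c' j" unfolding H_def
      by (intro arg_cong2[where f = "(+)"] arg_cong2[where f = "(*)"] refl wsum_cong)
        (use crossers_rank in \<open>auto simp: cut_def\<close>)
    finally show ?thesis .
  qed
  then have "crossed t N z z' c c'" unfolding crossed_def H_def by simp
  then show ?thesis by blast
qed

lemma crossed_unique:
  assumes c: "crossed t N z z' c c'" "crossed t N z z' c c''" and j: "j < N"
  shows "c' j = c'' j"
  using j
proof (induction "height_rank N z j" arbitrary: j rule: less_induct)
  case less
  have "wsum t z' (crossers N z z' j) c' = wsum t z' (crossers N z z' j) c''"
    by (rule wsum_cong) (use less crossers_rank in blast)
  then show ?case using c less.prems by (simp add: crossed_def)
qed

lemma crossed_refl: "crossed t N z z c c"
proof -
  have "crossers N z z j = {}" for j by (auto simp: crossers_def)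
  then show ?thesis by (simp add: crossed_def)
qed

lemma crossed_cong:
  assumes "crossed t N z z' c c'" "\<And>i. i < N \<Longrightarrow> c i = d i" "\<And>i. i < N \<Longrightarrow> c' i = d' i"
  shows "crossed t N z z' d d'"
proof -
  have "wsum t z' (crossers N z z' j) c' = wsum t z' (crossers N z z' j) d'" for j
    by (rule wsum_cong) (use assms crossers_rank in blast)
  then show ?thesis using assms by (simp add: crossed_def)
qed

lemma crossed_linear:
  assumes "crossed t N z z' c c'" "crossed t N z z' d d'"
  shows "crossed t N z z' (\<lambda>i. a * c i + b * d i) (\<lambda>i. a * c' i + b * d' i)"
  unfolding crossed_def wsum_linear
proof (intro allI impI)
  fix j assume "j < N"
  then have *: "c' j = t ^ card (crossers N z z' j) * c j + (1 - t) * wsum t z' (crossers N z z' j) c'"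
    "d' j = t ^ card (crossers N z z' j) * d j + (1 - t) * wsum t z' (crossers N z z' j) d'"
    using assms by (auto simp: crossed_def)
  show "a * c' j + b * d' j = t ^ card (crossers N z z' j) * (a * c j + b * d j) +
      (1 - t) * (a * wsum t z' (crossers N z z' j) c' + b * wsum t z' (crossers N z z' j) d')"
    by (subst *(1), subst *(2)) (simp only: algebra_simps)
qed

text \<open>If all colours equal \<open>a\<close>, then \<open>a\<close> is a common fixed point of
  the affine maps, hence of their composite; this is the fixed point equation.\<close>

lemma wsum_const:
  assumes "finite S" "inj_on z S"
  shows "(1 - t) * wsum t z S (\<lambda>_. a) = (1 - t ^ card S) * a"
  using assms
proof (induction "card S" arbitrary: S)
  case 0
  then show ?case by simp
next
  case (Suc n)
  then have "S \<noteq> {}" by auto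
  then obtain i where i: "i \<in> S" "\<And>k. k \<in> S - {i} \<Longrightarrow> before z k i"
    using ex_last Suc by metis
  have n: "n = card (S - {i})" using Suc i by simp
  have "S = (S - {i}) \<union> {i}" using i by auto
  then have "wsum t z S (\<lambda>_. a) = wsum t z (S - {i}) (\<lambda>_. a) + t ^ n * a"
    using wsum_Un[of "S - {i}" "{i}" z t "\<lambda>_. a"] i Suc n by simp
  then have "(1 - t) * wsum t z S (\<lambda>_. a) = (1 - t) * wsum t z (S - {i}) (\<lambda>_. a) + (1 - t) * t ^ n * a"
    by (simp add: algebra_simps)
  also have "(1 - t) * wsum t z (S - {i}) (\<lambda>_. a) = (1 - t ^ n) * a"
    using Suc(1)[OF n] Suc n inj_on_subset[OF Suc(4)] by auto
  finally show ?case by (simp add: Suc(2)[symmetric] algebra_simps)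
qed

lemma crossed_const:
  assumes "inj_on z' {..<N}"
  shows "crossed t N z z' (\<lambda>_. a) (\<lambda>_. a)"
proof -
  have "(1 - t) * wsum t z' (crossers N z z' j) (\<lambda>_. a) = (1 - t ^ card (crossers N z z' j)) * a" for j
    by (rule wsum_const) (use assms in \<open>auto simp: crossers_def inj_on_def\<close>)
  then show ?thesis by (simp add: crossed_def algebra_simps)
qed

lemma crossed_relabel:
  assumes \<pi>: "bij_betw \<pi> {..<N} {..<N}" and c: "crossed t N z z' c c'"
  shows "crossed t N (z \<circ> \<pi>) (z' \<circ> \<pi>) (c \<circ> \<pi>) (c' \<circ> \<pi>)"
  unfolding crossed_def
proof (intro allI impI)
  fix j assume j: "j < N"
  have inj: "inj_on \<pi> (crossers N (z \<circ> \<pi>) (z' \<circ> \<pi>) j)"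
    using \<pi> by (auto simp: bij_betw_def inj_on_def crossers_def)
  have eq: "\<pi> ` crossers N (z \<circ> \<pi>) (z' \<circ> \<pi>) j = crossers N z z' (\<pi> j)"
  proof (intro equalityI subsetI)
    fix i assume "i \<in> \<pi> ` crossers N (z \<circ> \<pi>) (z' \<circ> \<pi>) j"
    then show "i \<in> crossers N z z' (\<pi> j)" using \<pi> by (auto simp: crossers_def bij_betw_def)
  next
    fix i assume i: "i \<in> crossers N z z' (\<pi> j)"
    then have "i \<in> \<pi> ` {..<N}" using \<pi> by (auto simp: crossers_def bij_betw_def)
    then show "i \<in> \<pi> ` crossers N (z \<circ> \<pi>) (z' \<circ> \<pi>) j" using i by (auto simp: crossers_def)
  qed
  have "\<pi> j < N" using j \<pi> by (auto simp: bij_betw_def)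
  then show "(c' \<circ> \<pi>) j = t ^ card (crossers N (z \<circ> \<pi>) (z' \<circ> \<pi>) j) * (c \<circ> \<pi>) j +
      (1 - t) * wsum t (z' \<circ> \<pi>) (crossers N (z \<circ> \<pi>) (z' \<circ> \<pi>) j) (c' \<circ> \<pi>)"
    unfolding wsum_reindex[OF inj] eq card_image[OF inj, symmetric] using c by (simp add: crossed_def)
qed

section \<open>Torsion and the rank of the fixed space\<close>

text \<open>One holonomy treats all \<open>t = cis \<theta>\<close> at once, and continuity in
  \<theta> is what the rank argument lives on. The value 0 beyond \<open>N\<close> makes equality of
  colourings an equality of functions.\<close>

definition colourings :: "nat \<Rightarrow> (nat \<Rightarrow> real \<Rightarrow> complex) set" where
  "colourings N = {c. \<forall>i. continuous_on UNIV (c i) \<and> (N \<le> i \<longrightarrow> c i = (\<lambda>_. 0))}"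

definition unit_colour :: "nat \<Rightarrow> nat \<Rightarrow> real \<Rightarrow> complex" where
  "unit_colour j = (\<lambda>i _. if i = j then 1 else 0)"

lemma unit_colour_in: "j < N \<Longrightarrow> unit_colour j \<in> colourings N"
  by (auto simp: colourings_def unit_colour_def)

lemma sum_shift_periodic:
  fixes f :: "nat \<Rightarrow> 'a::ab_group_add"
  assumes "\<And>k. f (k + q) = f k"
  shows "(\<Sum>k'<q. f (k + k')) = (\<Sum>k'<q. f k')"
proof (induction k)
  case (Suc k)
  have "f k + (\<Sum>k'<q. f (Suc k + k')) = (\<Sum>k'<Suc q. f (k + k'))"
    by (subst sum.lessThan_Suc_shift) simp
  also have "\<dots> = (\<Sum>k'<q. f (k + k')) + f k" using assms by simp
  finally show ?case using Suc by (simp add: add.commute)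
qed simp

text \<open>The averages of the powers of \<open>T\<close> are projections depending continuously on \<open>\<theta>\<close>, so their rank
  is constant; it is 1 at \<open>\<theta> = 0\<close>, and the functional \<open>l\<close> forces rank at least 2 at \<open>\<theta> = \<phi>\<close>.\<close>

lemma no_torsion_cycle:
  fixes T :: "(nat \<Rightarrow> real \<Rightarrow> complex) \<Rightarrow> (nat \<Rightarrow> real \<Rightarrow> complex)"
  assumes N: "N > 0" and q: "q > 0"
    and T_in: "\<And>c. c \<in> colourings N \<Longrightarrow> T c \<in> colourings N"
    and T_lin: "\<And>a b c d. continuous_on UNIV a \<Longrightarrow> continuous_on UNIV b \<Longrightarrow> c \<in> colourings N \<Longrightarrow> d \<in> colourings N \<Longrightarrow>
        T (\<lambda>i \<theta>. a \<theta> * c i \<theta> + b \<theta> * d i \<theta>) = (\<lambda>i \<theta>. a \<theta> * T c i \<theta> + b \<theta> * T d i \<theta>)"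
    and T_tors: "\<And>c. c \<in> colourings N \<Longrightarrow> (T ^^ q) c = c"
    and T_const: "T (\<lambda>i _. if i < N then 1 else 0) = (\<lambda>i _. if i < N then 1 else 0)"
    and T_cycle: "\<And>c i. c \<in> colourings N \<Longrightarrow> i < N \<Longrightarrow> T c (Suc i mod N) 0 = c i 0"
    and l: "\<And>c \<theta>. c \<in> colourings N \<Longrightarrow> (\<Sum>i<N. l \<theta> i * T c i \<theta>) = (\<Sum>i<N. l \<theta> i * c i \<theta>)"
    and l0: "\<phi> \<ge> 0" "(\<Sum>i<N. l \<phi> i) = 0" "l \<phi> 0 \<noteq> 0"
  shows False
proof -
  have Tk_in: "(T ^^ k) c \<in> colourings N" if "c \<in> colourings N" for c k
    by (induction k) (use that T_in in auto)
  have zero: "(\<lambda>i \<theta>. 0) \<in> colourings N" by (auto simp: colourings_def)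
  have T0: "T (\<lambda>i \<theta>. 0) = (\<lambda>i \<theta>. 0)"
    using T_lin[of "\<lambda>_. 0" "\<lambda>_. 0", OF _ _ zero zero] by simp
  have comb_in: "(\<lambda>i \<theta>. \<Sum>j<M. a j \<theta> * d j i \<theta>) \<in> colourings N"
    if "\<And>j. j < M \<Longrightarrow> continuous_on UNIV (a j)" "\<And>j. j < M \<Longrightarrow> d j \<in> colourings N" for M :: nat and a d
    using that by (auto simp: colourings_def intro!: continuous_intros)
  have T_sum: "T (\<lambda>i \<theta>. \<Sum>j<M. a j \<theta> * d j i \<theta>) = (\<lambda>i \<theta>. \<Sum>j<M. a j \<theta> * T (d j) i \<theta>)"
    if "\<And>j. j < M \<Longrightarrow> continuous_on UNIV (a j)" "\<And>j. j < M \<Longrightarrow> d j \<in> colourings N" for M :: nat and a d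
    using that
  proof (induction M)
    case (Suc M)
    have "T (\<lambda>i \<theta>. 1 * (\<Sum>j<M. a j \<theta> * d j i \<theta>) + a M \<theta> * d M i \<theta>)
        = (\<lambda>i \<theta>. 1 * T (\<lambda>i \<theta>. \<Sum>j<M. a j \<theta> * d j i \<theta>) i \<theta> + a M \<theta> * T (d M) i \<theta>)"
      by (rule T_lin) (use Suc comb_in in auto)
    then show ?case using Suc by simp
  qed (simp add: T0)
  have Tk_sum: "(T ^^ k) (\<lambda>i \<theta>. \<Sum>j<M. a j \<theta> * d j i \<theta>) = (\<lambda>i \<theta>. \<Sum>j<M. a j \<theta> * (T ^^ k) (d j) i \<theta>)"
    if "\<And>j. j < M \<Longrightarrow> continuous_on UNIV (a j)" "\<And>j. j < M \<Longrightarrow> d j \<in> colourings N" for M :: nat and a d k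
    by (induction k) (use that T_sum Tk_in in auto)
  have expand: "c = (\<lambda>i \<theta>. \<Sum>j<N. c j \<theta> * unit_colour j i \<theta>)" if "c \<in> colourings N" for c
  proof (intro ext)
    fix i \<theta>
    have "(\<Sum>j<N. c j \<theta> * unit_colour j i \<theta>) = (\<Sum>j<N. if i = j then c j \<theta> else 0)"
      by (intro sum.cong) (auto simp: unit_colour_def)
    also have "\<dots> = c i \<theta>" using that by (auto simp: colourings_def)
    finally show "c i \<theta> = (\<Sum>j<N. c j \<theta> * unit_colour j i \<theta>)" by simp
  qed
  define M where "M k i j \<theta> = (T ^^ k) (unit_colour j) i \<theta>" for k i j \<theta>
  have apply_M: "(T ^^ k) c i \<theta> = (\<Sum>j<N. M k i j \<theta> * c j \<theta>)" if c: "c \<in> colourings N" for c k i \<theta>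
  proof -
    have "(T ^^ k) c = (T ^^ k) (\<lambda>i \<theta>. \<Sum>j<N. c j \<theta> * unit_colour j i \<theta>)"
      using expand[OF c] by simp
    also have "\<dots> = (\<lambda>i \<theta>. \<Sum>j<N. c j \<theta> * (T ^^ k) (unit_colour j) i \<theta>)"
      by (rule Tk_sum) (use c unit_colour_in in \<open>auto simp: colourings_def\<close>)
    finally show ?thesis by (simp add: M_def mult.commute)
  qed
  have M_mult: "(\<Sum>j<N. M k i j \<theta> * M k' j m \<theta>) = M (k + k') i m \<theta>" if "m < N" for k k' i m \<theta>
    using apply_M[OF Tk_in[OF unit_colour_in[OF that]], of k k' i \<theta>] by (simp add: M_def funpow_add)
  have M_per: "M (k + q) i m \<theta> = M k i m \<theta>" if "m < N" for k i m \<theta>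
    using T_tors[OF unit_colour_in[OF that]] by (simp add: M_def funpow_add)
  \<comment> \<open>As \<open>T ^^ q\<close> is the identity, this average is, for each \<theta>,
    the projection onto the fixed space of \<open>T\<close>.\<close>
  define p where "p i j \<theta> = (1 / of_nat q) * (\<Sum>k<q. M k i j \<theta>)" for i j \<theta>
  have p_row: "(\<Sum>j<N. p i j \<theta>) = 1" if "i < N" for i \<theta>
  proof -
    have one: "(\<lambda>i _. if i < N then 1 else 0) \<in> colourings N" by (auto simp: colourings_def)
    have "(T ^^ k) (\<lambda>i _. if i < N then 1 else 0) = (\<lambda>i _. if i < N then 1 else 0)" for k
      by (induction k) (auto simp: T_const)
    then have "(\<Sum>j<N. M k i j \<theta>) = 1" for k
      using apply_M[OF one, of k i \<theta>] that by simp
    then have "(\<Sum>k<q. \<Sum>j<N. M k i j \<theta>) = of_nat q" by simp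
    then show ?thesis
      using q by (simp add: p_def sum_divide_distrib[symmetric] sum.swap[of _ "{..<q}"])
  qed
  have p_M: "(\<Sum>j<N. p i j \<theta> * p j m \<theta>) = p i m \<theta>" if m: "m < N" for i m \<theta>
  proof -
    have "p i j \<theta> * p j m \<theta> = (1 / of_nat q)\<^sup>2 * (\<Sum>k<q. \<Sum>k'<q. M k i j \<theta> * M k' j m \<theta>)" for j
      by (simp add: p_def power2_eq_square sum_product[symmetric])
    then have "(\<Sum>j<N. p i j \<theta> * p j m \<theta>)
        = (1 / of_nat q)\<^sup>2 * (\<Sum>j<N. \<Sum>k<q. \<Sum>k'<q. M k i j \<theta> * M k' j m \<theta>)"
      by (simp only: sum_distrib_left)
    also have "(\<Sum>j<N. \<Sum>k<q. \<Sum>k'<q. M k i j \<theta> * M k' j m \<theta>)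
        = (\<Sum>k<q. \<Sum>k'<q. \<Sum>j<N. M k i j \<theta> * M k' j m \<theta>)"
      by (subst sum.swap, rule sum.cong[OF refl], rule sum.swap)
    also have "\<dots> = (\<Sum>k<q. \<Sum>k'<q. M (k + k') i m \<theta>)"
      using M_mult m by simp
    also have "\<dots> = (\<Sum>k<q. \<Sum>k'<q. M k' i m \<theta>)"
      by (intro sum.cong refl sum_shift_periodic M_per m)
    also have "(1 / of_nat q)\<^sup>2 * \<dots> = p i m \<theta>"
      using q by (simp add: p_def power2_eq_square)
    finally show ?thesis .
  qed
  have p_cyc: "p (Suc i mod N) m 0 = p i m 0" if "i < N" "m < N" for i m
  proof -
    have "M (1 + k) (Suc i mod N) m 0 = M k i m 0" for k
      using T_cycle[OF Tk_in[OF unit_colour_in[OF that(2)]] that(1)] by (simp add: M_def)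
    then have "(\<Sum>k<q. M (1 + k) (Suc i mod N) m 0) = (\<Sum>k<q. M k i m 0)" by simp
    then show ?thesis
      using sum_shift_periodic[of "\<lambda>k. M k (Suc i mod N) m 0" q 1] M_per that by (simp add: p_def)
  qed
  \<comment> \<open>At \<theta> = 0 the map only permutes the coordinates cyclically, so averaging
    makes all rows equal.\<close>
  have p_0: "p i m 0 = p 0 m 0" if "i < N" "m < N" for i m
    using that(1)
  proof (induction i)
    case (Suc i)
    then show ?case using p_cyc[of i m] that by simp
  qed simp
  have p_l: "(\<Sum>i<N. l \<theta> i * p i m \<theta>) = l \<theta> m" if m: "m < N" for m \<theta>
  proof -
    have "(\<Sum>i<N. l \<theta> i * M k i m \<theta>) = l \<theta> m" for k
    proof (induction k)
      case 0
      have "(\<Sum>i<N. l \<theta> i * M 0 i m \<theta>) = (\<Sum>i<N. if i = m then l \<theta> i else 0)"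
        by (intro sum.cong) (auto simp: M_def unit_colour_def)
      then show ?case using m by simp
    next
      case (Suc k)
      then show ?case using l[OF Tk_in[OF unit_colour_in[OF m]], of \<theta> k] by (simp add: M_def)
    qed
    then have "(\<Sum>k<q. \<Sum>i<N. l \<theta> i * M k i m \<theta>) = of_nat q * l \<theta> m" by simp
    moreover have "(\<Sum>i<N. l \<theta> i * p i m \<theta>) = (1 / of_nat q) * (\<Sum>k<q. \<Sum>i<N. l \<theta> i * M k i m \<theta>)"
      unfolding p_def by (subst sum.swap) (simp add: sum_distrib_left mult.left_commute)
    ultimately show ?thesis using q by simp
  qed
  \<comment> \<open>Row sums of \<open>p\<close> are 1, so the matrix with all rows equal to row 0
    is a rank one projection. Splitting it off leaves an idempotent, which vanishes exactly when
    \<open>p\<close> has rank one.\<close>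
  define D where "D i j \<theta> = p i j \<theta> - p 0 j \<theta>" for i j \<theta>
  have D_row: "(\<Sum>j<N. D i j \<theta>) = 0" if "i < N" for i \<theta>
    using p_row that N by (simp add: D_def sum_subtractf)
  have D_idem: "(\<Sum>j<N. D i j \<theta> * D j m \<theta>) = D i m \<theta>" if "i < N" "m < N" for i m \<theta>
  proof -
    have "(\<Sum>j<N. D i j \<theta> * D j m \<theta>) = (\<Sum>j<N. D i j \<theta> * p j m \<theta>) - (\<Sum>j<N. D i j \<theta>) * p 0 m \<theta>"
      by (simp add: D_def[of _ m] right_diff_distrib sum_subtractf sum_distrib_right)
    also have "(\<Sum>j<N. D i j \<theta> * p j m \<theta>) = D i m \<theta>"
      using p_M[OF that(2)] by (simp add: D_def left_diff_distrib sum_subtractf)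
    finally show ?thesis using D_row that by simp
  qed
  \<comment> \<open>This norm is submultiplicative, so an idempotent has norm 0 or at least 1. By
    continuity it stays 0 on the way from \<theta> = 0 to \<phi>.\<close>
  define \<mu> where "\<mu> \<theta> = (\<Sum>i<N. \<Sum>m<N. cmod (D i m \<theta>))" for \<theta>
  have cont: "continuous_on UNIV \<mu>"
  proof -
    have "continuous_on UNIV (M k i j)" if "j < N" for k i j
      using Tk_in[OF unit_colour_in[OF that], of k] unfolding M_def by (simp add: colourings_def)
    then show ?thesis unfolding \<mu>_def D_def p_def using q N by (auto intro!: continuous_intros)
  qed
  have \<mu>_sq: "\<mu> \<theta> \<le> \<mu> \<theta> * \<mu> \<theta>" for \<theta>
  proof -
    have row: "(\<Sum>m<N. cmod (D j m \<theta>)) \<le> \<mu> \<theta>" if "j < N" for j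
      unfolding \<mu>_def using that
      by (intro member_le_sum[of j "{..<N}" "\<lambda>j. \<Sum>m<N. cmod (D j m \<theta>)"]) (auto intro: sum_nonneg)
    have "\<mu> \<theta> = (\<Sum>i<N. \<Sum>m<N. cmod (\<Sum>j<N. D i j \<theta> * D j m \<theta>))"
      unfolding \<mu>_def by (intro sum.cong refl) (simp add: D_idem)
    also have "\<dots> \<le> (\<Sum>i<N. \<Sum>m<N. \<Sum>j<N. cmod (D i j \<theta>) * cmod (D j m \<theta>))"
      by (intro sum_mono order.trans[OF norm_sum]) (simp add: norm_mult)
    also have "\<dots> = (\<Sum>i<N. \<Sum>j<N. cmod (D i j \<theta>) * (\<Sum>m<N. cmod (D j m \<theta>)))"
      unfolding sum_distrib_left by (rule sum.cong[OF refl], rule sum.swap)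
    also have "\<dots> \<le> (\<Sum>i<N. \<Sum>j<N. cmod (D i j \<theta>) * \<mu> \<theta>)"
      by (intro sum_mono mult_left_mono row) auto
    also have "\<dots> = \<mu> \<theta> * \<mu> \<theta>"
      by (simp add: \<mu>_def sum_distrib_right)
    finally show ?thesis .
  qed
  have "D i m 0 = 0" if "i < N" "m < N" for i m
    unfolding D_def by (subst p_0[OF that]) simp
  then have "\<mu> 0 = 0" unfolding \<mu>_def by simp
  have \<mu>0: "\<mu> \<phi> = 0"
  proof (rule ccontr)
    assume "\<mu> \<phi> \<noteq> 0"
    moreover have "\<mu> \<phi> \<ge> 0" unfolding \<mu>_def by (intro sum_nonneg) auto
    ultimately have "\<mu> \<phi> > 0" by simp
    then have "\<mu> \<phi> \<ge> 1" using \<mu>_sq[of \<phi>] by (simp add: mult_le_cancel_left1)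
    then have "\<exists>x\<ge>0. x \<le> \<phi> \<and> \<mu> x = 1/2"
      using \<open>\<mu> 0 = 0\<close> l0(1) cont by (intro IVT') (auto intro: continuous_on_subset)
    then obtain x where "\<mu> x = 1/2" by blast
    then show False using \<mu>_sq[of x] by simp
  qed
  have p_eq: "p i m \<phi> = p 0 m \<phi>" if "i < N" "m < N" for i m
  proof -
    have "(\<Sum>m<N. cmod (D i m \<phi>)) = 0"
      using \<mu>0 that unfolding \<mu>_def by (subst (asm) sum_nonneg_eq_0_iff) (auto intro: sum_nonneg)
    then have "cmod (D i m \<phi>) = 0" using that by (subst (asm) sum_nonneg_eq_0_iff) auto
    then show ?thesis by (simp add: D_def)
  qed
  \<comment> \<open>With all rows of \<open>p\<close> equal, invariance under \<open>p\<close> makes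
    every coefficient of the functional a multiple of its value on the constant vector, which is
    0.\<close>
  have "l \<phi> 0 = (\<Sum>i<N. l \<phi> i * p 0 0 \<phi>)"
    unfolding p_l[OF N, of \<phi>, symmetric] by (rule sum.cong[OF refl], subst p_eq) (use N in auto)
  also have "\<dots> = 0" using l0(2) by (simp add: sum_distrib_right[symmetric])
  finally show False using l0(3) by simp
qed

section \<open>Configuration spaces of the projective plane\<close>

lemma openin_quotient_topology:
  "openin (quotient_topology X p) U \<longleftrightarrow> U \<subseteq> p ` topspace X \<and> openin X {x \<in> topspace X. p x \<in> U}"
proof -
  have "istopology (\<lambda>U. U \<subseteq> p ` topspace X \<and> openin X {x \<in> topspace X. p x \<in> U})"
    unfolding istopology_def
  proof (intro conjI allI impI)
    fix S T
    assume "S \<subseteq> p ` topspace X \<and> openin X {x \<in> topspace X. p x \<in> S}"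
      "T \<subseteq> p ` topspace X \<and> openin X {x \<in> topspace X. p x \<in> T}"
    moreover have "{x \<in> topspace X. p x \<in> S \<inter> T} = {x \<in> topspace X. p x \<in> S} \<inter> {x \<in> topspace X. p x \<in> T}"
      by auto
    ultimately show "S \<inter> T \<subseteq> p ` topspace X" "openin X {x \<in> topspace X. p x \<in> S \<inter> T}"
      by auto
  next
    fix \<K>
    assume *: "\<forall>K\<in>\<K>. K \<subseteq> p ` topspace X \<and> openin X {x \<in> topspace X. p x \<in> K}"
    then show "\<Union>\<K> \<subseteq> p ` topspace X" by auto
    have "{x \<in> topspace X. p x \<in> \<Union>\<K>} = (\<Union>K\<in>\<K>. {x \<in> topspace X. p x \<in> K})" by auto
    then show "openin X {x \<in> topspace X. p x \<in> \<Union>\<K>}" using * by auto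
  qed
  then show ?thesis by (simp add: quotient_topology_def topology_inverse')
qed

lemma topspace_quotient_topology [simp]: "topspace (quotient_topology X p) = p ` topspace X"
proof
  have "openin (quotient_topology X p) (p ` topspace X)"
    unfolding openin_quotient_topology by (auto intro: openin_subopen[THEN iffD2])
  then show "p ` topspace X \<subseteq> topspace (quotient_topology X p)" by (rule openin_subset)
  show "topspace (quotient_topology X p) \<subseteq> p ` topspace X"
    using openin_topspace[of "quotient_topology X p"] unfolding openin_quotient_topology by blast
qed

lemma continuous_map_quotient_topology: "continuous_map X (quotient_topology X p) p"
  unfolding continuous_map_def by (auto simp: openin_quotient_topology)

lemma topspace_RP2: "topspace RP2 = (\<lambda>x. {x, - x}) ` sphere 0 1"
  by (simp add: RP2_def)

lemma topspace_ordered_conf: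
  "topspace (ordered_conf X k) = {f \<in> {..<k} \<rightarrow>\<^sub>E topspace X. inj_on f {..<k}}"
  by (auto simp: ordered_conf_def)

lemma finite_sets_RP2:
  assumes "finite S" "S \<subseteq> topspace RP2"
  shows finite_lifts: "finite (\<Union>S)" and card_lifts: "card (\<Union>S) = 2 * card S"
proof -
  have two: "card a = 2" "finite a" if "a \<in> S" for a
  proof -
    from that assms obtain v :: "real^3" where v: "a = {v, -v}" "norm v = 1"
      by (auto simp: topspace_RP2)
    then have "v \<noteq> - v" by (metis equation_minus_iff eq_neg_iff_add_eq_0 norm_zero zero_neq_one scaleR_2 scaleR_eq_0_iff zero_neq_numeral)
    then show "card a = 2" "finite a" using v by auto
  qed
  show "finite (\<Union>S)" using assms two by auto
  have "disjnt a b" if ab: "a \<in> S" "b \<in> S" "a \<noteq> b" for a b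
  proof -
    have "a \<in> topspace RP2" "b \<in> topspace RP2" using ab assms by auto
    then obtain v w :: "real^3" where "a = {v, -v}" "b = {w, -w}"
      unfolding topspace_RP2 by blast
    then show ?thesis using ab(3) by (auto simp: disjnt_def)
  qed
  then have "card (\<Union>S) = sum card S"
    using two by (intro card_Union_disjoint) (auto simp: pairwise_def)
  also have "\<dots> = 2 * card S" using two by simp
  finally show "card (\<Union>S) = 2 * card S" .
qed

lemma lift_norm:
  assumes "S \<subseteq> topspace RP2" "v \<in> \<Union>S"
  shows "norm v = 1" "- v \<in> \<Union>S" "{v, -v} \<in> S"
proof -
  obtain a where a: "a \<in> S" "v \<in> a" using assms by auto
  then obtain w :: "real^3" where w: "a = {w, -w}" "norm w = 1" using assms by (auto simp: topspace_RP2)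
  show "norm v = 1" "- v \<in> \<Union>S" "{v, -v} \<in> S" using a w by (auto simp: insert_commute)
qed

lemma topspace_unordered_conf:
  assumes "A \<in> topspace (unordered_conf RP2 n)"
  shows "finite A" "card A = n" "A \<subseteq> topspace RP2"
  using assms by (auto simp: unordered_conf_def topspace_ordered_conf card_image)

lemma topspace_coloured_conf:
  assumes "x \<in> topspace (coloured_conf RP2 n m)"
  shows "finite (fst x)" "finite (snd x)" "card (fst x) = n" "card (snd x) = m"
    "fst x \<subseteq> topspace RP2" "snd x \<subseteq> topspace RP2" "fst x \<inter> snd x = {}"
proof -
  obtain f where f: "f \<in> {..<n+m} \<rightarrow>\<^sub>E topspace RP2" "inj_on f {..<n+m}"
    and x: "x = (f ` {..<n}, f ` {n..<n+m})"
    using assms by (auto simp: coloured_conf_def topspace_ordered_conf)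
  have inj: "inj_on f {..<n}" "inj_on f {n..<n+m}" using f(2) by (auto simp: inj_on_def)
  show "finite (fst x)" "finite (snd x)" by (auto simp: x)
  show "card (fst x) = n" "card (snd x) = m" using inj by (auto simp: x card_image)
  show "fst x \<subseteq> topspace RP2" "snd x \<subseteq> topspace RP2" using f(1) by (auto simp: x)
  show "fst x \<inter> snd x = {}" using f(2) by (auto simp: x inj_on_def) (metis atLeastLessThan_iff lessThan_iff not_less trans_less_add1)
qed

lemma openin_RP2_near: "openin RP2 {a \<in> topspace RP2. \<exists>w\<in>a. dist v w < e}"
proof -
  have "{x \<in> sphere 0 1. \<exists>w\<in>{x, -x}. dist v w < e} = sphere 0 1 \<inter> (ball v e \<union> ball (- v) e)"
    using dist_minus[of v] dist_minus[of "- v"] by auto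
  then have "openin (top_of_set (sphere 0 1)) {x \<in> sphere 0 1. \<exists>w\<in>{x, -x}. dist v w < e}"
    by (auto intro: openin_open_Int)
  then show ?thesis unfolding RP2_def openin_quotient_topology
    by (auto elim!: back_subst[of "openin _"])
qed

text \<open>Serves unordered and coloured configurations at once: \<pi> recovers from a class the
  set of points indexed by \<open>I\<close>, and the preimage for one \<open>v\<close> is a union
  over the index of the point that comes close.\<close>

lemma openin_quotient_conf_near:
  fixes p :: "(nat \<Rightarrow> (real^3) set) \<Rightarrow> 'b"
  assumes I: "I \<subseteq> {..<k}" and \<pi>: "\<And>f. f \<in> topspace (ordered_conf RP2 k) \<Longrightarrow> \<pi> (p f) = f ` I"
    and F: "finite F"
  shows "openin (quotient_topology (ordered_conf RP2 k) p)
     {x \<in> p ` topspace (ordered_conf RP2 k). \<forall>v\<in>F. \<exists>w\<in>\<Union>(\<pi> x). dist v w < e}"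
  using F
proof (induction F)
  case empty
  have "{x \<in> p ` topspace (ordered_conf RP2 k). \<forall>v\<in>{}. \<exists>w\<in>\<Union>(\<pi> x). dist v w < e}
      = topspace (quotient_topology (ordered_conf RP2 k) p)" by auto
  then show ?case by (simp only: openin_topspace)
next
  case (insert v F)
  have cont: "continuous_map (ordered_conf RP2 k) RP2 (\<lambda>f. f i)" if "i \<in> I" for i
    unfolding ordered_conf_def using that I
    by (intro continuous_map_from_subtopology continuous_map_product_projection) auto
  have "{f \<in> topspace (ordered_conf RP2 k). \<exists>w\<in>\<Union>(\<pi> (p f)). dist v w < e}
      = (\<Union>i\<in>I. {f \<in> topspace (ordered_conf RP2 k). f i \<in> {a \<in> topspace RP2. \<exists>w\<in>a. dist v w < e}})"
    using \<pi> I by (auto simp: topspace_ordered_conf) blast+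
  then have "openin (ordered_conf RP2 k) {f \<in> topspace (ordered_conf RP2 k). \<exists>w\<in>\<Union>(\<pi> (p f)). dist v w < e}"
    using openin_continuous_map_preimage[OF cont openin_RP2_near] by auto
  then have "openin (quotient_topology (ordered_conf RP2 k) p)
     {x \<in> p ` topspace (ordered_conf RP2 k). \<exists>w\<in>\<Union>(\<pi> x). dist v w < e}"
    unfolding openin_quotient_topology by (auto elim!: back_subst[of "openin _"])
  from openin_Int[OF this insert.IH] show ?case by (auto elim!: back_subst[of "openin _"])
qed

section \<open>Matching nearby finite sets\<close>

definition separated :: "real \<Rightarrow> 'a::metric_space set \<Rightarrow> bool" where
  "separated e V \<longleftrightarrow> (\<forall>v\<in>V. \<forall>w\<in>V. v \<noteq> w \<longrightarrow> 2 * e \<le> dist v w)"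

definition close_to :: "real \<Rightarrow> 'a::metric_space set \<Rightarrow> 'a set \<Rightarrow> bool" where
  "close_to e V V' \<longleftrightarrow> (\<forall>v\<in>V. \<exists>w\<in>V'. dist v w < e)"

definition nearest :: "real \<Rightarrow> 'a::metric_space set \<Rightarrow> 'a \<Rightarrow> 'a" where
  "nearest e V w = (THE v. v \<in> V \<and> dist v w < e)"

lemma nearest_eq:
  assumes "separated e V" "v \<in> V" "dist v w < e"
  shows "nearest e V w = v"
  unfolding nearest_def
proof (rule the_equality)
  fix u assume u: "u \<in> V \<and> dist u w < e"
  show "u = v"
  proof (rule ccontr)
    assume "u \<noteq> v"
    then have "2 * e \<le> dist u v" using assms u by (auto simp: separated_def)
    also have "dist u v \<le> dist u w + dist v w" by (rule dist_triangle2)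
    finally show False using u assms by auto
  qed
qed (use assms in auto)

text \<open>The balls around \<open>V\<close> are disjoint, so picking a point of \<open>V'\<close>
  in each is injective; equal cardinality makes it a bijection, whose inverse is
  \<open>nearest\<close>.\<close>

lemma nearest_bij:
  assumes fin: "finite V" "finite V'" "card V = card V'" and sep: "separated e V" and cl: "close_to e V V'"
  shows "bij_betw (nearest e V) V' V" and "\<And>w. w \<in> V' \<Longrightarrow> dist (nearest e V w) w < e"
proof -
  obtain \<phi> where \<phi>: "\<And>v. v \<in> V \<Longrightarrow> \<phi> v \<in> V' \<and> dist v (\<phi> v) < e"
    using cl unfolding close_to_def by metis
  have n: "nearest e V (\<phi> v) = v" if "v \<in> V" for v
    using nearest_eq[OF sep that] \<phi> that by auto
  then have inj: "inj_on \<phi> V" by (metis inj_onI)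
  have im: "\<phi> ` V = V'"
    by (rule card_subset_eq) (use \<phi> fin inj in \<open>auto simp: card_image\<close>)
  show "bij_betw (nearest e V) V' V"
    by (rule bij_betwI[where g = \<phi>]) (use n \<phi> im in auto)
  show "dist (nearest e V w) w < e" if "w \<in> V'" for w
    using that im n \<phi> by auto
qed

lemma separated_exists:
  assumes "finite V"
  shows "\<exists>e>0. separated e V"
proof -
  define D where "D = (\<lambda>(v,w). dist v w / 2) ` {(v,w) \<in> V \<times> V. v \<noteq> w}"
  have D: "finite D" "\<And>d. d \<in> D \<Longrightarrow> d > 0"
    unfolding D_def using assms by (auto intro: finite_subset[of _ "V \<times> V"])
  define e where "e = Min (insert 1 D)"
  have "e > 0" unfolding e_def using D by (subst Min_gr_iff) auto
  moreover have "2 * e \<le> dist v w" if "v \<in> V" "w \<in> V" "v \<noteq> w" for v w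
  proof -
    have "dist v w / 2 \<in> D" using that by (auto simp: D_def)
    then have "e \<le> dist v w / 2" unfolding e_def using D by (intro Min_le) auto
    then show ?thesis by simp
  qed
  ultimately show ?thesis unfolding separated_def by blast
qed

lemma separated_mono: "separated e V \<Longrightarrow> e' \<le> e \<Longrightarrow> W \<subseteq> V \<Longrightarrow> separated e' W"
  unfolding separated_def by force

definition sep_radius :: "'a::metric_space set \<Rightarrow> real" where
  "sep_radius V = (SOME e. 0 < e \<and> separated e V)"

lemma sep_radius:
  assumes "finite V"
  shows "0 < sep_radius V" "separated (sep_radius V) V"
  using someI_ex[of "\<lambda>e. 0 < e \<and> separated e V"] separated_exists[OF assms]
  unfolding sep_radius_def by auto

lemma close_to_refl: "0 < e \<Longrightarrow> close_to e V V"
  unfolding close_to_def by force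

text \<open>Finitely many strict inequalities leave a common slack, within which a further motion
  keeps every point in its ball. Coherence of the local systems below rests on it.\<close>

lemma close_to_margin:
  fixes V :: "'a::metric_space set"
  assumes "finite V" "finite V'" "0 < e'"
  obtains d where "0 < d" "d \<le> e'"
    "\<And>v w. v \<in> V \<Longrightarrow> w \<in> V' \<Longrightarrow> dist v w < e \<Longrightarrow> dist v w + d \<le> e"
proof -
  define D where "D = (\<lambda>(v,w). e - dist v w) ` {(v,w) \<in> V \<times> V'. dist v w < e}"
  have D: "finite D" "\<And>d. d \<in> D \<Longrightarrow> d > 0"
    unfolding D_def using assms by (auto intro: finite_subset[of _ "V \<times> V'"])
  define d where "d = Min (insert e' D)"
  have "dist v w + d \<le> e" if "v \<in> V" "w \<in> V'" "dist v w < e" for v w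
  proof -
    have "e - dist v w \<in> D" using that by (auto simp: D_def)
    then have "d \<le> e - dist v w" unfolding d_def using D by (intro Min_le) auto
    then show ?thesis by simp
  qed
  moreover have "d > 0" "d \<le> e'" unfolding d_def using D assms by (auto simp: Min_gr_iff)
  ultimately show ?thesis using that by blast
qed

lemma close_to_mono: "close_to e V V' \<Longrightarrow> e \<le> e' \<Longrightarrow> close_to e' V V'"
  unfolding close_to_def by force

lemma close_to_trans:
  assumes cl: "close_to e V V'" "close_to d V' V''"
    and d: "\<And>v w. v \<in> V \<Longrightarrow> w \<in> V' \<Longrightarrow> dist v w < e \<Longrightarrow> dist v w + d \<le> e"
  shows "close_to e V V''"
  unfolding close_to_def
proof
  fix v assume v: "v \<in> V"
  obtain w where w: "w \<in> V'" "dist v w < e" using cl v unfolding close_to_def by blast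
  obtain u where u: "u \<in> V''" "dist w u < d" using cl w unfolding close_to_def by blast
  have "dist v u \<le> dist v w + dist w u" by (rule dist_triangle)
  then show "\<exists>u\<in>V''. dist v u < e" using d[OF v w] u by (intro bexI[of _ u]) auto
qed

lemma nearest_trans:
  assumes fin: "finite V" "finite V'" "finite V''" and card: "card V = card V'" "card V' = card V''"
    and sep: "separated e V" "separated e' V'"
    and cl: "close_to e V V'" "close_to d V' V''" and de: "d \<le> e'"
    and d: "\<And>v w. v \<in> V \<Longrightarrow> w \<in> V' \<Longrightarrow> dist v w < e \<Longrightarrow> dist v w + d \<le> e"
    and u: "u \<in> V''"
  shows "nearest e V u = nearest e V (nearest e' V' u)"
proof -
  have sd: "separated d V'" using separated_mono[OF sep(2) de] by auto
  define w where "w = nearest d V' u"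
  have w: "w \<in> V'" "dist w u < d"
    using nearest_bij[OF fin(2,3) card(2) sd cl(2)] u bij_betwE unfolding w_def by blast+
  have nw: "nearest e' V' u = w" by (rule nearest_eq[OF sep(2)]) (use w de in auto)
  define v where "v = nearest e V w"
  have v: "v \<in> V" "dist v w < e"
    using nearest_bij[OF fin(1,2) card(1) sep(1) cl(1)] w bij_betwE unfolding v_def by blast+
  have "dist v u \<le> dist v w + dist w u" by (rule dist_triangle)
  then have "dist v u < e" using d[OF v(1) w(1) v(2)] w by auto
  from nearest_eq[OF sep(1) v(1) this] show ?thesis using nw v_def by auto
qed

subsection \<open>The lifts of the points of a configuration\<close>

definition lift_nbhd :: "nat \<Rightarrow> (real^3) set set \<Rightarrow> (real^3) set set set" where
  "lift_nbhd n A = {A' \<in> topspace (unordered_conf RP2 n). close_to (sep_radius (\<Union>A)) (\<Union>A) (\<Union>A')}"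

definition lift_map :: "(real^3) set set \<Rightarrow> (real^3) set set \<Rightarrow> real^3 \<Rightarrow> real^3" where
  "lift_map A A' = nearest (sep_radius (\<Union>A)) (\<Union>A)"

lemma openin_unordered_near:
  assumes "finite F"
  shows "openin (unordered_conf RP2 n) {A \<in> topspace (unordered_conf RP2 n). close_to e F (\<Union>A)}"
  using openin_quotient_conf_near[of "{..<n}" n "\<lambda>x. x" "\<lambda>f. f ` {..<n}" F e] assms
  by (simp add: unordered_conf_def close_to_def)

text \<open>The double cover of the points of a configuration; its holonomy along a braid is a
  signed permutation.\<close>

interpretation lifts: local_system "unordered_conf RP2 n" "\<lambda>A. \<Union>A" "lift_nbhd n" lift_map
  for n
proof
  fix A assume A: "A \<in> topspace (unordered_conf RP2 n)"
  note tA = topspace_unordered_conf[OF A]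
  have fin: "finite (\<Union>A)" using finite_lifts tA by blast
  note r = sep_radius[OF fin]
  show "openin (unordered_conf RP2 n) (lift_nbhd n A)"
    unfolding lift_nbhd_def by (rule openin_unordered_near[OF fin])
  show "A \<in> lift_nbhd n A" unfolding lift_nbhd_def using A r close_to_refl by auto
  show "lift_map A A v = v" if "v \<in> \<Union>A" for v
    unfolding lift_map_def using nearest_eq[OF r(2) that] r by auto
  fix A' assume A': "A' \<in> lift_nbhd n A"
  then have cl: "close_to (sep_radius (\<Union>A)) (\<Union>A) (\<Union>A')" and topA': "A' \<in> topspace (unordered_conf RP2 n)"
    by (auto simp: lift_nbhd_def)
  note tA' = topspace_unordered_conf[OF topA']
  have fin': "finite (\<Union>A')" using finite_lifts tA' by blast
  have card: "card (\<Union>A) = card (\<Union>A')" using card_lifts tA tA' by metis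
  note r' = sep_radius[OF fin']
  show "bij_betw (lift_map A A') (\<Union>A') (\<Union>A)"
    unfolding lift_map_def by (rule nearest_bij(1)[OF fin fin' card r(2) cl])
  obtain d where d: "0 < d" "d \<le> sep_radius (\<Union>A')"
    "\<And>v w. v \<in> \<Union>A \<Longrightarrow> w \<in> \<Union>A' \<Longrightarrow> dist v w < sep_radius (\<Union>A) \<Longrightarrow> dist v w + d \<le> sep_radius (\<Union>A)"
    using close_to_margin[OF fin fin' r'(1), of "sep_radius (\<Union>A)"] by metis
  define V where "V = {A'' \<in> topspace (unordered_conf RP2 n). close_to d (\<Union>A') (\<Union>A'')}"
  show "\<exists>V. openin (unordered_conf RP2 n) V \<and> A' \<in> V \<and> V \<subseteq> lift_nbhd n A \<inter> lift_nbhd n A' \<and>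
      (\<forall>w\<in>V. \<forall>f\<in>\<Union>w. lift_map A w f = lift_map A A' (lift_map A' w f))"
  proof (intro exI[of _ V] conjI ballI)
    show "openin (unordered_conf RP2 n) V" unfolding V_def by (rule openin_unordered_near[OF fin'])
    show "A' \<in> V" unfolding V_def using topA' d close_to_refl by auto
    show "V \<subseteq> lift_nbhd n A \<inter> lift_nbhd n A'"
      unfolding V_def lift_nbhd_def using close_to_mono[OF _ d(2)] close_to_trans[OF cl _ d(3)] by auto
    fix A'' u assume "A'' \<in> V" "u \<in> \<Union>A''"
    then have A'': "A'' \<in> topspace (unordered_conf RP2 n)" "close_to d (\<Union>A') (\<Union>A'')" and u: "u \<in> \<Union>A''"
      using V_def by auto
    note t = topspace_unordered_conf[OF A''(1)]
    have "finite (\<Union>A'')" "card (\<Union>A') = card (\<Union>A'')" using finite_lifts card_lifts t tA' by metis+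
    then show "lift_map A A'' u = lift_map A A' (lift_map A' A'' u)"
      unfolding lift_map_def
      using nearest_trans[OF fin fin' _ card _ r(2) r'(2) cl A''(2) d(2) d(3) u] by auto
  qed
qed

subsection \<open>Coordinates with respect to a moving frame\<close>

text \<open>Stereographic projection from \<open>- y1\<close>, with the real axis in the direction of the component of \<open>y2\<close>
  orthogonal to \<open>y1\<close>, whose length is the scale.\<close>

definition frame_coord :: "real^3 \<Rightarrow> real^3 \<Rightarrow> real^3 \<Rightarrow> complex" where
  "frame_coord y1 y2 v =
     Complex ((v \<bullet> (y2 - (y1 \<bullet> y2) *\<^sub>R y1)) / (1 + v \<bullet> y1)) ((v \<bullet> cross3 y1 y2) / (1 + v \<bullet> y1))"

text \<open>Pythagoras in the plane orthogonal to \<open>y1\<close>: the two vectors are orthogonal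
  to \<open>y1\<close> and to each other, with common squared length
  \<open>y2 \<bullet> y2 - (y1 \<bullet> y2)\<^sup>2\<close>. Multiplying by it instead of
  normalising keeps the identity polynomial.\<close>

lemma frame_gram:
  assumes "norm y1 = 1"
  shows "(d \<bullet> (y2 - (y1 \<bullet> y2) *\<^sub>R y1))\<^sup>2 + (d \<bullet> cross3 y1 y2)\<^sup>2
       = (y2 \<bullet> y2 - (y1 \<bullet> y2)\<^sup>2) * (d \<bullet> d - (d \<bullet> y1)\<^sup>2)"
proof -
  have y1: "y1 \<bullet> y1 = 1" using assms by (simp add: norm_eq_1)
  have "(d \<bullet> cross3 y1 y2)\<^sup>2 = (d \<bullet> d) * (cross3 y1 y2 \<bullet> cross3 y1 y2) - cross3 d (cross3 y1 y2) \<bullet> cross3 d (cross3 y1 y2)"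
    using norm_cross_dot[of d "cross3 y1 y2"]
    by (simp add: power_mult_distrib power2_norm_eq_inner algebra_simps)
  also have "cross3 y1 y2 \<bullet> cross3 y1 y2 = y2 \<bullet> y2 - (y1 \<bullet> y2)\<^sup>2"
    using norm_cross_dot[of y1 y2] y1
    by (simp add: power_mult_distrib power2_norm_eq_inner algebra_simps)
  also have "cross3 d (cross3 y1 y2) = (d \<bullet> y2) *\<^sub>R y1 - (d \<bullet> y1) *\<^sub>R y2"
    by (rule Lagrange)
  finally have "(d \<bullet> cross3 y1 y2)\<^sup>2 = (d \<bullet> d) * (y2 \<bullet> y2 - (y1 \<bullet> y2)\<^sup>2)
      - ((d \<bullet> y2)\<^sup>2 - 2 * (d \<bullet> y2) * (d \<bullet> y1) * (y1 \<bullet> y2) + (d \<bullet> y1)\<^sup>2 * (y2 \<bullet> y2))"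
    by (simp add: inner_diff_left inner_diff_right y1 inner_commute[of y2 y1] power2_eq_square algebra_simps)
  then show ?thesis
    by (simp add: inner_diff_right power2_eq_square algebra_simps)
qed

lemma unit_inner:
  assumes "norm (v::'a::real_inner) = 1" "norm w = 1"
  shows "1 + v \<bullet> w \<ge> 0" "1 + v \<bullet> w = 0 \<longleftrightarrow> v = - w"
proof -
  have *: "(norm (v + w))\<^sup>2 = 2 * (1 + v \<bullet> w)"
    using assms unfolding power2_norm_eq_inner
    by (simp add: inner_add_left inner_add_right inner_commute norm_eq_1)
  then show "1 + v \<bullet> w \<ge> 0" by (metis zero_le_mult_iff zero_le_power2 not_numeral_le_zero)
  have "v = - w \<longleftrightarrow> (norm (v + w))\<^sup>2 = 0" by (simp add: eq_neg_iff_add_eq_0)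
  then show "1 + v \<bullet> w = 0 \<longleftrightarrow> v = - w" unfolding * by auto
qed

lemma frame_coord_inj:
  assumes y: "norm y1 = 1" "norm y2 = 1" "y2 \<noteq> y1" "y2 \<noteq> - y1"
    and v: "norm v = 1" "v \<noteq> - y1" and w: "norm w = 1" "w \<noteq> - y1"
    and eq: "frame_coord y1 y2 v = frame_coord y1 y2 w"
  shows "v = w"
proof -
  define L where "L = y2 \<bullet> y2 - (y1 \<bullet> y2)\<^sup>2"
  have "1 + y1 \<bullet> y2 > 0" "1 + (- y1) \<bullet> y2 > 0"
    using unit_inner[OF y(1,2)] unit_inner[of "- y1" y2] y by (auto simp: less_le)
  then have "(1 + y1 \<bullet> y2) * (1 - y1 \<bullet> y2) > 0" by simp
  \<comment> \<open>\<open>L\<close> is the squared length of the component of \<open>y2\<close>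
    orthogonal to \<open>y1\<close>.\<close>
  then have L: "L > 0" using y(2) by (simp add: L_def norm_eq_1 power2_eq_square algebra_simps)
  define a a' where "a = 1 + v \<bullet> y1" and "a' = 1 + w \<bullet> y1"
  have a: "a > 0" "a' > 0"
    using unit_inner[OF v(1) y(1)] unit_inner[OF w(1) y(1)] v w by (auto simp: a_def a'_def less_le)
  let ?e1 = "y2 - (y1 \<bullet> y2) *\<^sub>R y1" and ?e2 = "cross3 y1 y2"
  have eqs: "(v \<bullet> ?e1) / a = (w \<bullet> ?e1) / a'" "(v \<bullet> ?e2) / a = (w \<bullet> ?e2) / a'"
    using eq by (simp_all add: frame_coord_def a_def a'_def)
  \<comment> \<open>The modulus of a stereographic coordinate determines the height
    \<open>u \<bullet> y1\<close>. Once the heights agree, equality of the coordinates is linear in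
    the points.\<close>
  have sq: "((u \<bullet> ?e1) / b)\<^sup>2 + ((u \<bullet> ?e2) / b)\<^sup>2 = L * (2 / b - 1)"
    if "norm u = 1" "b = 1 + u \<bullet> y1" "b > 0" for u b
  proof -
    have "(u \<bullet> ?e1)\<^sup>2 + (u \<bullet> ?e2)\<^sup>2 = L * (1 - (b - 1)\<^sup>2)"
      using frame_gram[OF y(1), of u y2] that by (simp add: L_def norm_eq_1)
    also have "\<dots> = L * (2 / b - 1) * b\<^sup>2" using that(3) by (simp add: power2_eq_square field_simps)
    finally show ?thesis using that(3) by (simp add: power_divide add_divide_distrib[symmetric])
  qed
  have "L * (2 / a - 1) = L * (2 / a' - 1)"
    by (simp only: sq[OF v(1) a_def a(1), symmetric] sq[OF w(1) a'_def a(2), symmetric] eqs)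
  then have "2 / a = 2 / a'" using L by simp
  then have aa: "a = a'" using a by (simp add: field_simps)
  define d where "d = v - w"
  have "d \<bullet> ?e1 = 0" "d \<bullet> ?e2 = 0" "d \<bullet> y1 = 0"
    using eqs aa a by (simp_all add: d_def inner_diff_left a_def a'_def)
  then have "L * (d \<bullet> d) = 0" using frame_gram[OF y(1), of d y2] by (simp add: L_def)
  then show ?thesis using L by (simp add: d_def)
qed

text \<open>Provides the hypothesis \<open>near\<close> between the strands over a configuration and
  over a close one, uniformly in the frame. Points at the pole \<open>- y1\<close> of the projection
  are excluded.\<close>

definition frame_ok :: "real \<Rightarrow> (real^3) set \<Rightarrow> bool" where
  "frame_ok e V \<longleftrightarrow> (\<forall>y1\<in>V. \<forall>y2\<in>V. \<forall>v\<in>V. \<forall>w\<in>V. v \<noteq> - y1 \<longrightarrow> w \<noteq> - y1 \<longrightarrow>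
     (\<forall>y1' y2' v' w'. dist y1 y1' < e \<longrightarrow> dist y2 y2' < e \<longrightarrow> dist v v' < e \<longrightarrow> dist w w' < e \<longrightarrow>
        (Re (frame_coord y1 y2 v) < Re (frame_coord y1 y2 w) \<longrightarrow> Re (frame_coord y1' y2' v') < Re (frame_coord y1' y2' w')) \<and>
        (Im (frame_coord y1 y2 v) < Im (frame_coord y1 y2 w) \<longrightarrow> Im (frame_coord y1' y2' v') < Im (frame_coord y1' y2' w'))))"

lemma continuous_less_nbhd:
  fixes F :: "(real^3) \<times> (real^3) \<times> (real^3) \<Rightarrow> real"
  assumes "isCont F (y1,y2,v)" "isCont F (y1,y2,w)" "F (y1,y2,v) < F (y1,y2,w)"
  shows "\<exists>e>0. \<forall>y1' y2' v' w'. dist y1 y1' < e \<longrightarrow> dist y2 y2' < e \<longrightarrow> dist v v' < e \<longrightarrow> dist w w' < e \<longrightarrow>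
      F (y1',y2',v') < F (y1',y2',w')"
proof -
  define r where "r = (F (y1,y2,w) - F (y1,y2,v)) / 2"
  have r: "r > 0" using assms by (simp add: r_def)
  obtain d1 where d1: "d1 > 0" "\<And>p. dist p (y1,y2,v) < d1 \<Longrightarrow> dist (F p) (F (y1,y2,v)) < r"
    using assms(1) r unfolding continuous_at_eps_delta by metis
  obtain d2 where d2: "d2 > 0" "\<And>p. dist p (y1,y2,w) < d2 \<Longrightarrow> dist (F p) (F (y1,y2,w)) < r"
    using assms(2) r unfolding continuous_at_eps_delta by metis
  define e where "e = min d1 d2 / 3"
  have tri: "dist (a,b,c) (a',b',c') \<le> dist a a' + dist b b' + dist c c'" for a b c a' b' c' :: "real^3"
  proof -
    have "dist (a,b,c) (a',b',c') \<le> dist a a' + dist (b,c) (b',c')"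
      unfolding dist_Pair_Pair by (rule sqrt_sum_squares_le_sum) auto
    also have "dist (b,c) (b',c') \<le> dist b b' + dist c c'"
      unfolding dist_Pair_Pair by (rule sqrt_sum_squares_le_sum) auto
    finally show ?thesis by simp
  qed
  have "F (y1',y2',v') < F (y1',y2',w')"
    if "dist y1 y1' < e" "dist y2 y2' < e" "dist v v' < e" "dist w w' < e" for y1' y2' v' w'
  proof -
    have "dist (y1',y2',v') (y1,y2,v) < d1" "dist (y1',y2',w') (y1,y2,w) < d2"
      using tri[of y1' y2' v' y1 y2 v] tri[of y1' y2' w' y1 y2 w] that
      by (auto simp: e_def dist_commute)
    then have "\<bar>F (y1',y2',v') - F (y1,y2,v)\<bar> < r" "\<bar>F (y1',y2',w') - F (y1,y2,w)\<bar> < r"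
      using d1(2) d2(2) by (auto simp: dist_real_def)
    moreover have "F (y1,y2,w) - F (y1,y2,v) = 2 * r" by (simp add: r_def)
    ultimately show ?thesis by linarith
  qed
  moreover have "e > 0" using d1 d2 by (simp add: e_def)
  ultimately show ?thesis by blast
qed

lemma isCont_frame_coord:
  assumes "1 + v \<bullet> y1 \<noteq> 0"
  shows "isCont (\<lambda>(y1,y2,v). Re (frame_coord y1 y2 v)) (y1,y2,v)"
    "isCont (\<lambda>(y1,y2,v). Im (frame_coord y1 y2 v)) (y1,y2,v)"
proof -
  have c: "isCont (\<lambda>p. cross3 (fst p) (fst (snd p))) (y1,y2,v)"
    by (intro continuous_cross continuous_intros)
  show "isCont (\<lambda>(y1,y2,v). Re (frame_coord y1 y2 v)) (y1,y2,v)"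
    unfolding frame_coord_def case_prod_beta complex.sel using assms by (intro continuous_intros) auto
  show "isCont (\<lambda>(y1,y2,v). Im (frame_coord y1 y2 v)) (y1,y2,v)"
    unfolding frame_coord_def case_prod_beta complex.sel using assms c by (intro continuous_intros) auto
qed

lemma frame_ok_exists:
  assumes fin: "finite V" and unit: "\<And>v. v \<in> V \<Longrightarrow> norm v = 1"
  shows "\<exists>e>0. frame_ok e V"
proof -
  define P where "P e p \<longleftrightarrow> (case p of (y1,y2,v,w) \<Rightarrow> v \<noteq> - y1 \<longrightarrow> w \<noteq> - y1 \<longrightarrow>
     (\<forall>y1' y2' v' w'. dist y1 y1' < e \<longrightarrow> dist y2 y2' < e \<longrightarrow> dist v v' < e \<longrightarrow> dist w w' < e \<longrightarrow>
        (Re (frame_coord y1 y2 v) < Re (frame_coord y1 y2 w) \<longrightarrow> Re (frame_coord y1' y2' v') < Re (frame_coord y1' y2' w')) \<and>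
        (Im (frame_coord y1 y2 v) < Im (frame_coord y1 y2 w) \<longrightarrow> Im (frame_coord y1' y2' v') < Im (frame_coord y1' y2' w'))))" for e p
  have "\<exists>e>0. P e p" if p: "p \<in> V \<times> V \<times> V \<times> V" for p
  proof -
    obtain y1 y2 v w where pe: "p = (y1,y2,v,w)" by (metis prod_cases4)
    show ?thesis
    proof (cases "v \<noteq> - y1 \<and> w \<noteq> - y1")
      case False
      then show ?thesis by (auto simp: P_def pe intro: exI[of _ 1])
    next
      case True
      then have ne: "1 + v \<bullet> y1 \<noteq> 0" "1 + w \<bullet> y1 \<noteq> 0" 
        using unit_inner(2)[of v y1] unit_inner(2)[of w y1] unit p pe by auto
      have "\<exists>e>0. \<forall>y1' y2' v' w'. dist y1 y1' < e \<longrightarrow> dist y2 y2' < e \<longrightarrow> dist v v' < e \<longrightarrow> dist w w' < e \<longrightarrow>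
          Re (frame_coord y1 y2 v) < Re (frame_coord y1 y2 w) \<longrightarrow> Re (frame_coord y1' y2' v') < Re (frame_coord y1' y2' w')"
      proof (cases "Re (frame_coord y1 y2 v) < Re (frame_coord y1 y2 w)")
        case True
        then show ?thesis
          using continuous_less_nbhd[OF isCont_frame_coord(1)[OF ne(1)] isCont_frame_coord(1)[OF ne(2)]] by auto
      qed (auto intro: exI[of _ 1])
      moreover have "\<exists>e>0. \<forall>y1' y2' v' w'. dist y1 y1' < e \<longrightarrow> dist y2 y2' < e \<longrightarrow> dist v v' < e \<longrightarrow> dist w w' < e \<longrightarrow>
          Im (frame_coord y1 y2 v) < Im (frame_coord y1 y2 w) \<longrightarrow> Im (frame_coord y1' y2' v') < Im (frame_coord y1' y2' w')"
      proof (cases "Im (frame_coord y1 y2 v) < Im (frame_coord y1 y2 w)")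
        case True
        then show ?thesis
          using continuous_less_nbhd[OF isCont_frame_coord(2)[OF ne(1)] isCont_frame_coord(2)[OF ne(2)]] by auto
      qed (auto intro: exI[of _ 1])
      ultimately obtain e1 e2 where "e1 > 0" "e2 > 0"
        and "\<And>y1' y2' v' w'. dist y1 y1' < e1 \<Longrightarrow> dist y2 y2' < e1 \<Longrightarrow> dist v v' < e1 \<Longrightarrow> dist w w' < e1 \<Longrightarrow>
          Re (frame_coord y1 y2 v) < Re (frame_coord y1 y2 w) \<Longrightarrow> Re (frame_coord y1' y2' v') < Re (frame_coord y1' y2' w')"
        and "\<And>y1' y2' v' w'. dist y1 y1' < e2 \<Longrightarrow> dist y2 y2' < e2 \<Longrightarrow> dist v v' < e2 \<Longrightarrow> dist w w' < e2 \<Longrightarrow>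
          Im (frame_coord y1 y2 v) < Im (frame_coord y1 y2 w) \<Longrightarrow> Im (frame_coord y1' y2' v') < Im (frame_coord y1' y2' w')"
        by blast
      then show ?thesis by (intro exI[of _ "min e1 e2"]) (auto simp: P_def pe)
    qed
  qed
  then obtain \<epsilon> where \<epsilon>: "\<And>p. p \<in> V \<times> V \<times> V \<times> V \<Longrightarrow> \<epsilon> p > 0 \<and> P (\<epsilon> p) p" by metis
  define e where "e = Min (insert 1 (\<epsilon> ` (V \<times> V \<times> V \<times> V)))"
  have "e > 0" unfolding e_def using fin \<epsilon> by (subst Min_gr_iff) auto
  have Pe: "P e p" if p: "p \<in> V \<times> V \<times> V \<times> V" for p
  proof -
    have "e \<le> \<epsilon> p" unfolding e_def using fin p by (intro Min_le) auto
    then show ?thesis using \<epsilon>[OF p] unfolding P_def by (auto split: prod.splits)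
  qed
  have "frame_ok e V" unfolding frame_ok_def
  proof (intro ballI)
    fix y1 y2 v w assume "y1 \<in> V" "y2 \<in> V" "v \<in> V" "w \<in> V"
    then have "P e (y1,y2,v,w)" using Pe by simp
    then show "v \<noteq> - y1 \<longrightarrow> w \<noteq> - y1 \<longrightarrow>
     (\<forall>y1' y2' v' w'. dist y1 y1' < e \<longrightarrow> dist y2 y2' < e \<longrightarrow> dist v v' < e \<longrightarrow> dist w w' < e \<longrightarrow>
        (Re (frame_coord y1 y2 v) < Re (frame_coord y1 y2 w) \<longrightarrow> Re (frame_coord y1' y2' v') < Re (frame_coord y1' y2' w')) \<and>
        (Im (frame_coord y1 y2 v) < Im (frame_coord y1 y2 w) \<longrightarrow> Im (frame_coord y1' y2' v') < Im (frame_coord y1' y2' w')))"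
      unfolding P_def prod.case .
  qed
  with \<open>e > 0\<close> show ?thesis by blast
qed

lemma frame_ok_mono: "frame_ok e V \<Longrightarrow> e' \<le> e \<Longrightarrow> frame_ok e' V"
  unfolding frame_ok_def by (meson less_le_trans)

definition all_lifts :: "(real^3) set set \<times> (real^3) set set \<Rightarrow> (real^3) set" where
  "all_lifts x = \<Union>(fst x) \<union> \<Union>(snd x)"

text \<open>The bound by the radius for the first component makes the matching restrict to
  \<open>lift_map\<close> there, so that transport is compatible with forgetting the new
  points.\<close>

definition frame_radius :: "(real^3) set set \<times> (real^3) set set \<Rightarrow> real" where
  "frame_radius x = (SOME e. 0 < e \<and> e \<le> sep_radius (\<Union>(fst x)) \<and> separated e (all_lifts x) \<and> frame_ok e (all_lifts x))"

lemma all_lifts: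
  assumes "x \<in> topspace (coloured_conf RP2 n m)"
  shows "finite (all_lifts x)" "card (all_lifts x) = 2 * (n + m)" "finite (\<Union>(fst x))" "finite (\<Union>(snd x))"
    "card (\<Union>(fst x)) = 2 * n" "\<Union>(fst x) \<inter> \<Union>(snd x) = {}"
    "\<And>v. v \<in> all_lifts x \<Longrightarrow> norm v = 1"
    "\<And>v. v \<in> all_lifts x \<Longrightarrow> - v \<in> all_lifts x"
proof -
  note t = topspace_coloured_conf[OF assms]
  show fin: "finite (\<Union>(fst x))" "finite (\<Union>(snd x))" using finite_lifts t by blast+
  then show "finite (all_lifts x)" by (simp add: all_lifts_def)
  have eq: "all_lifts x = \<Union>(fst x \<union> snd x)" by (auto simp: all_lifts_def)
  show "card (\<Union>(fst x)) = 2 * n" using card_lifts t by metis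
  have "card (\<Union>(fst x \<union> snd x)) = 2 * card (fst x \<union> snd x)" by (rule card_lifts) (use t in auto)
  then show "card (all_lifts x) = 2 * (n + m)" unfolding eq using t by (simp add: card_Un_disjoint)
  show "norm v = 1" "- v \<in> all_lifts x" if "v \<in> all_lifts x" for v
    using lift_norm[of "fst x \<union> snd x" v] t that eq by auto
  show "\<Union>(fst x) \<inter> \<Union>(snd x) = {}"
  proof (rule ccontr)
    assume "\<Union>(fst x) \<inter> \<Union>(snd x) \<noteq> {}"
    then obtain v where "v \<in> \<Union>(fst x)" "v \<in> \<Union>(snd x)" by blast
    then have "{v, -v} \<in> fst x \<inter> snd x" using lift_norm(3) t by blast
    then show False using t by auto
  qed
qed

lemma frame_radius:
  assumes "x \<in> topspace (coloured_conf RP2 n m)"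
  shows "0 < frame_radius x" "frame_radius x \<le> sep_radius (\<Union>(fst x))"
    "separated (frame_radius x) (all_lifts x)" "frame_ok (frame_radius x) (all_lifts x)"
proof -
  note a = all_lifts[OF assms]
  obtain e1 where e1: "e1 > 0" "frame_ok e1 (all_lifts x)" using frame_ok_exists[OF a(1) a(7)] by auto
  obtain e2 where e2: "e2 > 0" "separated e2 (all_lifts x)" using separated_exists[OF a(1)] by auto
  let ?e = "min (min e1 e2) (sep_radius (\<Union>(fst x)))"
  have "0 < ?e \<and> ?e \<le> sep_radius (\<Union>(fst x)) \<and> separated ?e (all_lifts x) \<and> frame_ok ?e (all_lifts x)"
    using e1 e2 sep_radius[OF a(3)] by (auto intro: separated_mono[OF e2(2)] frame_ok_mono[OF e1(2)])
  from someI[of "\<lambda>e. 0 < e \<and> e \<le> sep_radius (\<Union>(fst x)) \<and> separated e (all_lifts x) \<and> frame_ok e (all_lifts x)", OF this]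
  show "0 < frame_radius x" "frame_radius x \<le> sep_radius (\<Union>(fst x))"
    "separated (frame_radius x) (all_lifts x)" "frame_ok (frame_radius x) (all_lifts x)"
    unfolding frame_radius_def by auto
qed

subsection \<open>Coloured configurations\<close>

definition crossed_all :: "nat \<Rightarrow> (nat \<Rightarrow> complex) \<Rightarrow> (nat \<Rightarrow> complex) \<Rightarrow> (nat \<Rightarrow> real \<Rightarrow> complex) \<Rightarrow> (nat \<Rightarrow> real \<Rightarrow> complex) \<Rightarrow> bool" where
  "crossed_all N z z' c c' \<longleftrightarrow> (\<forall>\<theta>. crossed (cis \<theta>) N z z' (\<lambda>i. c i \<theta>) (\<lambda>i. c' i \<theta>))"

text \<open>Transport runs from the nearby fibre to the centre, opposite to \<open>crossed\<close>.
  In this direction the equation is solved without recursion, because \<open>cis \<theta>\<close> is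
  invertible and only \<open>c'\<close> enters the sum.\<close>

definition pull_colour :: "nat \<Rightarrow> (nat \<Rightarrow> complex) \<Rightarrow> (nat \<Rightarrow> complex) \<Rightarrow> (nat \<Rightarrow> real \<Rightarrow> complex) \<Rightarrow> nat \<Rightarrow> real \<Rightarrow> complex" where
  "pull_colour N z z' c' = (\<lambda>j \<theta>. if j < N then
     (c' j \<theta> - (1 - cis \<theta>) * wsum (cis \<theta>) z' (crossers N z z' j) (\<lambda>i. c' i \<theta>)) / cis \<theta> ^ card (crossers N z z' j) else 0)"

lemma continuous_cis: "continuous_on S cis"
  by (auto simp: cis_conv_exp intro!: continuous_intros)

lemma continuous_wsum:
  assumes "\<And>i. i \<in> R \<Longrightarrow> continuous_on UNIV (c i)"
  shows "continuous_on UNIV (\<lambda>\<theta>. wsum (cis \<theta>) z R (\<lambda>i. c i \<theta>))"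
  unfolding wsum_def by (intro continuous_intros continuous_cis assms)

lemma continuous_on_if_const:
  "(P \<Longrightarrow> continuous_on S f) \<Longrightarrow> (\<not> P \<Longrightarrow> continuous_on S g) \<Longrightarrow> continuous_on S (\<lambda>x. if P then f x else g x)"
  by (cases P) auto

lemma pull_colour_in: "c' \<in> colourings N \<Longrightarrow> pull_colour N z z' c' \<in> colourings N"
  unfolding colourings_def pull_colour_def
  by (auto intro!: continuous_on_if_const continuous_intros continuous_cis continuous_wsum)

lemma crossed_pull: "crossed_all N z z' (pull_colour N z z' c') c'"
  by (simp add: crossed_all_def crossed_def pull_colour_def)

lemma pull_colour_eq:
  assumes "c \<in> colourings N" "crossed_all N z z' c c'"
  shows "pull_colour N z z' c' = c"
proof (intro ext)
  fix j \<theta>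
  show "pull_colour N z z' c' j \<theta> = c j \<theta>"
  proof (cases "j < N")
    case True
    then have "c' j \<theta> = cis \<theta> ^ card (crossers N z z' j) * c j \<theta> +
        (1 - cis \<theta>) * wsum (cis \<theta>) z' (crossers N z z' j) (\<lambda>i. c' i \<theta>)"
      using assms(2) by (simp add: crossed_all_def crossed_def)
    then show ?thesis using True by (simp add: pull_colour_def field_simps)
  next
    case False
    then show ?thesis using assms(1) by (simp add: pull_colour_def colourings_def)
  qed
qed

lemma crossed_all_unique:
  assumes "crossed_all N z z' c c'" "crossed_all N z z' c c''" "c' \<in> colourings N" "c'' \<in> colourings N"
  shows "c' = c''"
proof (intro ext)
  fix i \<theta>
  show "c' i \<theta> = c'' i \<theta>"
    using assms crossed_unique[of "cis \<theta>" N z z' "\<lambda>i. c i \<theta>" "\<lambda>i. c' i \<theta>" "\<lambda>i. c'' i \<theta>" i]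
    by (cases "i < N") (auto simp: crossed_all_def colourings_def)
qed

lemma crossed_all_exists:
  assumes c: "c \<in> colourings N"
  obtains c' where "c' \<in> colourings N" "crossed_all N z z' c c'"
proof -
  have "\<forall>\<theta>. \<exists>d. crossed (cis \<theta>) N z z' (\<lambda>i. c i \<theta>) d" by (intro allI crossed_exists)
  then obtain d where d: "\<And>\<theta>. crossed (cis \<theta>) N z z' (\<lambda>i. c i \<theta>) (d \<theta>)" by (auto dest!: choice)
  have d_eq: "d \<theta> j = cis \<theta> ^ card (crossers N z z' j) * c j \<theta> +
      (1 - cis \<theta>) * wsum (cis \<theta>) z' (crossers N z z' j) (d \<theta>)" if "j < N" for j \<theta>
    using d[of \<theta>] that by (simp add: crossed_def)
  \<comment> \<open>Continuity in \<theta> passes down from the crossers, which lie higher.\<close>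
  have cont: "continuous_on UNIV (\<lambda>\<theta>. d \<theta> j)" if "j < N" for j
    using that
  proof (induction "height_rank N z j" arbitrary: j rule: less_induct)
    case less
    have "continuous_on UNIV (\<lambda>\<theta>. wsum (cis \<theta>) z' (crossers N z z' j) (\<lambda>i. d \<theta> i))"
      by (rule continuous_wsum[where c = "\<lambda>i \<theta>. d \<theta> i"]) (use less crossers_rank in blast)
    moreover have "continuous_on UNIV (c j)" using c by (simp add: colourings_def)
    ultimately have "continuous_on UNIV (\<lambda>\<theta>. cis \<theta> ^ card (crossers N z z' j) * c j \<theta> +
      (1 - cis \<theta>) * wsum (cis \<theta>) z' (crossers N z z' j) (d \<theta>))"
      by (intro continuous_intros continuous_cis)
    then show ?case using d_eq[OF less.prems] by (simp only:)
  qed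
  define c' where "c' j \<theta> = (if j < N then d \<theta> j else 0)" for j \<theta>
  have "c' \<in> colourings N" 
    using cont by (auto simp: colourings_def c'_def[abs_def] intro!: continuous_on_if_const)
  moreover have "crossed_all N z z' c c'"
    unfolding crossed_all_def by (intro allI crossed_cong[OF d]) (auto simp: c'_def)
  ultimately show ?thesis by (rule that)
qed

lemma crossed_all_trans:
  assumes "inj_on z {..<N}" "inj_on z' {..<N}" "near N z z'" "near N z' z''" "near N z z''"
    "crossed_all N z z' c c'" "crossed_all N z' z'' c' c''"
  shows "crossed_all N z z'' c c''"
  using assms crossed_trans unfolding crossed_all_def by blast

text \<open>A state consists of lifts \<open>y1\<close>, \<open>y2\<close> to the sphere of two points of the configuration, lifts \<open>f i\<close> of the
  \<open>N\<close> strands, and colours of the strands; a colour is a function of \<open>\<theta>\<close>, where \<open>t = cis \<theta>\<close>.\<close>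

definition frame_states :: "nat \<Rightarrow> (real^3) set set \<times> (real^3) set set \<Rightarrow>
    ((real^3) \<times> (real^3) \<times> (nat \<Rightarrow> real^3) \<times> (nat \<Rightarrow> real \<Rightarrow> complex)) set" where
  "frame_states N x = {(y1, y2, f, c). y1 \<in> all_lifts x \<and> y2 \<in> all_lifts x \<and> y2 \<noteq> y1 \<and> y2 \<noteq> - y1 \<and>
     inj_on f {..<N} \<and> (\<forall>i<N. f i \<in> all_lifts x \<and> f i \<noteq> - y1) \<and> (\<forall>i\<ge>N. f i = 0) \<and> c \<in> colourings N}"

text \<open>Closeness is required for both components separately, so that the matching respects old
  and new points.\<close>

definition frame_nbhd :: "nat \<Rightarrow> nat \<Rightarrow> (real^3) set set \<times> (real^3) set set \<Rightarrow> ((real^3) set set \<times> (real^3) set set) set" where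
  "frame_nbhd n m x = {x' \<in> topspace (coloured_conf RP2 n m).
     close_to (frame_radius x) (\<Union>(fst x)) (\<Union>(fst x')) \<and> close_to (frame_radius x) (\<Union>(snd x)) (\<Union>(snd x'))}"

definition strands :: "real^3 \<Rightarrow> real^3 \<Rightarrow> (nat \<Rightarrow> real^3) \<Rightarrow> nat \<Rightarrow> complex" where
  "strands y1 y2 f = (\<lambda>i. frame_coord y1 y2 (f i))"

definition near_lift :: "(real^3) set set \<times> (real^3) set set \<Rightarrow> real^3 \<Rightarrow> real^3" where
  "near_lift x = nearest (frame_radius x) (all_lifts x)"

definition near_lifts :: "nat \<Rightarrow> (real^3) set set \<times> (real^3) set set \<Rightarrow> (nat \<Rightarrow> real^3) \<Rightarrow> nat \<Rightarrow> real^3" where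
  "near_lifts N x f = (\<lambda>i. if i < N then near_lift x (f i) else 0)"

fun frame_map :: "nat \<Rightarrow> (real^3) set set \<times> (real^3) set set \<Rightarrow> (real^3) set set \<times> (real^3) set set \<Rightarrow>
    (real^3) \<times> (real^3) \<times> (nat \<Rightarrow> real^3) \<times> (nat \<Rightarrow> real \<Rightarrow> complex) \<Rightarrow>
    (real^3) \<times> (real^3) \<times> (nat \<Rightarrow> real^3) \<times> (nat \<Rightarrow> real \<Rightarrow> complex)" where
  "frame_map N x x' (y1, y2, f, c) = (near_lift x y1, near_lift x y2, near_lifts N x f,
     pull_colour N (strands (near_lift x y1) (near_lift x y2) (near_lifts N x f)) (strands y1 y2 f) c)"

lemma openin_coloured_near:
  assumes "finite F" "finite G"
  shows "openin (coloured_conf RP2 n m)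
    {x \<in> topspace (coloured_conf RP2 n m). close_to e F (\<Union>(fst x)) \<and> close_to e G (\<Union>(snd x))}"
proof -
  have 1: "openin (coloured_conf RP2 n m) {x \<in> topspace (coloured_conf RP2 n m). close_to e F (\<Union>(fst x))}"
    using openin_quotient_conf_near[of "{..<n}" "n+m" fst "\<lambda>f. (f ` {..<n}, f ` {n..<n + m})" F e] assms
    by (simp add: coloured_conf_def close_to_def)
  have "{n..<n+m} \<subseteq> {..<n+m}" by auto
  then have 2: "openin (coloured_conf RP2 n m) {x \<in> topspace (coloured_conf RP2 n m). close_to e G (\<Union>(snd x))}"
    using openin_quotient_conf_near[of "{n..<n+m}" "n+m" snd "\<lambda>f. (f ` {..<n}, f ` {n..<n + m})" G e] assms
    by (simp add: coloured_conf_def close_to_def)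
  from openin_Int[OF 1 2] show ?thesis by (auto elim!: back_subst[of "openin _"])
qed

lemma close_to_Un: "close_to e A A' \<Longrightarrow> close_to e B B' \<Longrightarrow> close_to e (A \<union> B) (A' \<union> B')"
  unfolding close_to_def by blast

context
  fixes n m :: nat and x x'
  assumes x: "x \<in> topspace (coloured_conf RP2 n m)" and x': "x' \<in> frame_nbhd n m x"
begin

lemma frame_nbhd_top: "x' \<in> topspace (coloured_conf RP2 n m)"
  using x' by (simp add: frame_nbhd_def)

lemma frame_nbhd_close: "close_to (frame_radius x) (all_lifts x) (all_lifts x')"
  using x' close_to_Un unfolding frame_nbhd_def all_lifts_def by blast

lemma near_lift_bij: "bij_betw (near_lift x) (all_lifts x') (all_lifts x)"
  and near_lift_dist: "v \<in> all_lifts x' \<Longrightarrow> dist (near_lift x v) v < frame_radius x"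
  using nearest_bij[OF all_lifts(1)[OF x] all_lifts(1)[OF frame_nbhd_top] _ frame_radius(3)[OF x] frame_nbhd_close]
    all_lifts(2)[OF x] all_lifts(2)[OF frame_nbhd_top] unfolding near_lift_def by auto

lemma near_lift_in: "v \<in> all_lifts x' \<Longrightarrow> near_lift x v \<in> all_lifts x"
  using near_lift_bij bij_betwE by blast

lemma near_lift_inj: "v \<in> all_lifts x' \<Longrightarrow> w \<in> all_lifts x' \<Longrightarrow> near_lift x v = near_lift x w \<longleftrightarrow> v = w"
  using near_lift_bij unfolding bij_betw_def by (meson inj_on_eq_iff)

text \<open>Antipodes of close points are close. Transport therefore commutes with the antipodal map
  and descends to points of the projective plane.\<close>

lemma near_lift_minus:
  assumes "v \<in> all_lifts x'"
  shows "near_lift x (- v) = - near_lift x v"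
  unfolding near_lift_def
proof (rule nearest_eq[OF frame_radius(3)[OF x]])
  show "- nearest (frame_radius x) (all_lifts x) v \<in> all_lifts x"
    using near_lift_in[OF assms] all_lifts(8)[OF x] unfolding near_lift_def by blast
  show "dist (- nearest (frame_radius x) (all_lifts x) v) (- v) < frame_radius x"
    using near_lift_dist[OF assms] unfolding near_lift_def by (simp add: dist_norm norm_minus_commute)
qed

lemma near_lift_fst:
  assumes v: "v \<in> \<Union>(fst x')"
  shows "near_lift x v \<in> \<Union>(fst x)" "near_lift x v = lift_map (fst x) (fst x') v"
proof -
  have cl: "close_to (frame_radius x) (\<Union>(fst x)) (\<Union>(fst x'))" using x' by (simp add: frame_nbhd_def)
  have sep: "separated (frame_radius x) (\<Union>(fst x))"
    using separated_mono[OF frame_radius(3)[OF x]] by (auto simp: all_lifts_def)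
  let ?w = "nearest (frame_radius x) (\<Union>(fst x)) v"
  have w: "?w \<in> \<Union>(fst x)" "dist ?w v < frame_radius x"
    using nearest_bij[OF all_lifts(3)[OF x] all_lifts(3)[OF frame_nbhd_top] _ sep cl] v
      all_lifts(5)[OF x] all_lifts(5)[OF frame_nbhd_top] bij_betwE by (metis, metis)
  have "near_lift x v = ?w" unfolding near_lift_def
    by (rule nearest_eq[OF frame_radius(3)[OF x]]) (use w in \<open>auto simp: all_lifts_def\<close>)
  moreover have "lift_map (fst x) (fst x') v = ?w" unfolding lift_map_def
    by (rule nearest_eq[OF sep_radius(2)[OF all_lifts(3)[OF x]]]) (use w frame_radius(2)[OF x] in auto)
  ultimately show "near_lift x v \<in> \<Union>(fst x)" "near_lift x v = lift_map (fst x) (fst x') v" using w by auto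
qed

lemma near_lift_fst_iff:
  assumes v: "v \<in> all_lifts x'"
  shows "near_lift x v \<in> \<Union>(fst x) \<longleftrightarrow> v \<in> \<Union>(fst x')"
proof
  assume *: "near_lift x v \<in> \<Union>(fst x)"
  have cl: "close_to (frame_radius x) (\<Union>(fst x)) (\<Union>(fst x'))" using x' by (simp add: frame_nbhd_def)
  then obtain w where w: "w \<in> \<Union>(fst x')" "dist (near_lift x v) w < frame_radius x"
    using * unfolding close_to_def by blast
  have wa: "w \<in> all_lifts x'" using w by (auto simp: all_lifts_def)
  have "nearest (frame_radius x) (all_lifts x) w = near_lift x v"
    by (rule nearest_eq[OF frame_radius(3)[OF x] near_lift_in[OF v] w(2)])
  then have "w = v" using near_lift_inj[OF wa v] by (simp add: near_lift_def)
  then show "v \<in> \<Union>(fst x')" using w by simp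
qed (rule near_lift_fst(1))

lemma frame_states_coord:
  assumes "(y1, y2, f, c) \<in> frame_states N x'"
  shows "inj_on (strands y1 y2 f) {..<N}"
proof (rule inj_onI)
  fix i j assume ij: "i \<in> {..<N}" "j \<in> {..<N}" "strands y1 y2 f i = strands y1 y2 f j"
  note u = all_lifts(7)[OF frame_nbhd_top]
  have "f i = f j"
    by (rule frame_coord_inj[of y1 y2]) (use assms ij u in \<open>auto simp: frame_states_def strands_def\<close>)
  then show "i = j" using assms ij by (auto simp: frame_states_def inj_on_def)
qed

lemma frame_states_near:
  assumes "(y1, y2, f, c) \<in> frame_states N x'"
  shows "near N (strands (near_lift x y1) (near_lift x y2) (near_lifts N x f)) (strands y1 y2 f)"
  unfolding near_def
proof (intro allI impI)
  fix i j assume ij: "i < N" "j < N"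
  have s: "y1 \<in> all_lifts x'" "y2 \<in> all_lifts x'" "f i \<in> all_lifts x'" "f j \<in> all_lifts x'" "f i \<noteq> - y1" "f j \<noteq> - y1"
    using assms ij by (auto simp: frame_states_def)
  have "near_lift x (f i) \<noteq> - near_lift x y1" "near_lift x (f j) \<noteq> - near_lift x y1"
    using near_lift_minus[OF s(1)] near_lift_inj s all_lifts(8)[OF frame_nbhd_top s(1)] by metis+
  then show "(Re (strands (near_lift x y1) (near_lift x y2) (near_lifts N x f) i)
        < Re (strands (near_lift x y1) (near_lift x y2) (near_lifts N x f) j) \<longrightarrow>
      Re (strands y1 y2 f i) < Re (strands y1 y2 f j)) \<and>
      (Im (strands (near_lift x y1) (near_lift x y2) (near_lifts N x f) i)
        < Im (strands (near_lift x y1) (near_lift x y2) (near_lifts N x f) j) \<longrightarrow>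
      Im (strands y1 y2 f i) < Im (strands y1 y2 f j))"
    using frame_radius(4)[OF x] near_lift_in[OF s(1)] near_lift_in[OF s(2)] near_lift_in[OF s(3)] near_lift_in[OF s(4)]
      near_lift_dist[OF s(1)] near_lift_dist[OF s(2)] near_lift_dist[OF s(3)] near_lift_dist[OF s(4)] ij
    unfolding frame_ok_def strands_def near_lifts_def by simp
qed

lemma frame_map_in:
  assumes s: "(y1, y2, f, c) \<in> frame_states N x'"
  shows "frame_map N x x' (y1, y2, f, c) \<in> frame_states N x"
proof -
  note m = near_lift_in near_lift_inj near_lift_minus[symmetric] all_lifts(8)[OF frame_nbhd_top]
  have "inj_on (near_lifts N x f) {..<N}"
    using s m(2) unfolding frame_states_def near_lifts_def inj_on_def by auto
  then show ?thesis using s pull_colour_in unfolding frame_states_def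
    by (auto simp: m near_lifts_def)
qed

lemma frame_map_bij: "bij_betw (frame_map N x x') (frame_states N x') (frame_states N x)"
  unfolding bij_betw_def
proof (intro conjI)
  show "inj_on (frame_map N x x') (frame_states N x')"
  proof (rule inj_onI)
    fix s t assume st: "s \<in> frame_states N x'" "t \<in> frame_states N x'" "frame_map N x x' s = frame_map N x x' t"
    obtain y1 y2 f c where s: "s = (y1, y2, f, c)" by (metis prod_cases4)
    obtain z1 z2 g d where t: "t = (z1, z2, g, d)" by (metis prod_cases4)
    have m: "y1 \<in> all_lifts x'" "y2 \<in> all_lifts x'" "z1 \<in> all_lifts x'" "z2 \<in> all_lifts x'"
      "\<And>i. i < N \<Longrightarrow> f i \<in> all_lifts x' \<and> g i \<in> all_lifts x'" "\<And>i. i \<ge> N \<Longrightarrow> f i = 0 \<and> g i = 0"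
      "c \<in> colourings N" "d \<in> colourings N"
      using st s t by (auto simp: frame_states_def)
    have y: "y1 = z1" "y2 = z2" using st(3) m near_lift_inj unfolding s t by auto
    have "f i = g i" for i
    proof (cases "i < N")
      case True
      have "near_lifts N x f i = near_lifts N x g i" using st(3) unfolding s t by simp
      then show ?thesis using True m(5)[OF True] near_lift_inj by (simp add: near_lifts_def)
    qed (use m in auto)
    then have fg: "f = g" by auto
    let ?z = "strands (near_lift x y1) (near_lift x y2) (near_lifts N x f)"
    have "pull_colour N ?z (strands y1 y2 f) c = pull_colour N ?z (strands y1 y2 f) d"
      using st(3) unfolding s t y fg by simp
    then have "c = d" using crossed_all_unique[OF crossed_pull[of N ?z "strands y1 y2 f" c] _ m(7,8)]
      crossed_pull[of N ?z "strands y1 y2 f" d] by simp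
    then show "s = t" using s t y fg by simp
  qed
  show "frame_map N x x' ` frame_states N x' = frame_states N x"
  proof (intro equalityI subsetI)
    fix s assume "s \<in> frame_map N x x' ` frame_states N x'"
    then show "s \<in> frame_states N x" using frame_map_in by (auto simp del: frame_map.simps)
  next
    fix s assume st: "s \<in> frame_states N x"
    obtain y1 y2 f c where s: "s = (y1, y2, f, c)" by (metis prod_cases4)
    define k where "k = inv_into (all_lifts x') (near_lift x)"
    have k: "k v \<in> all_lifts x'" "near_lift x (k v) = v" if "v \<in> all_lifts x" for v
      using near_lift_bij that unfolding k_def
      by (auto simp: bij_betw_def inv_into_into f_inv_into_f)
    have m: "y1 \<in> all_lifts x" "y2 \<in> all_lifts x" "y2 \<noteq> y1" "y2 \<noteq> - y1" "inj_on f {..<N}"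
      "\<And>i. i < N \<Longrightarrow> f i \<in> all_lifts x \<and> f i \<noteq> - y1" "\<And>i. i \<ge> N \<Longrightarrow> f i = 0" "c \<in> colourings N"
      using st s by (auto simp: frame_states_def)
    define f' where "f' i = (if i < N then k (f i) else 0)" for i
    have ff': "near_lifts N x f' = f" using k m by (auto simp: near_lifts_def f'_def)
    \<comment> \<open>Surjectivity on colours needs the crossing equations solved forward, from the
      centre to the nearby configuration.\<close>
    obtain c' where c': "c' \<in> colourings N" "crossed_all N (strands y1 y2 f) (strands (k y1) (k y2) f') c c'"
      using crossed_all_exists[OF m(8)] by metis
    have ne: "k v \<noteq> - k w" if "v \<in> all_lifts x" "w \<in> all_lifts x" "v \<noteq> - w" for v w
      using near_lift_minus[OF k(1)[OF that(2)]] k that by metis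
    have "(k y1, k y2, f', c') \<in> frame_states N x'"
      unfolding frame_states_def mem_Collect_eq prod.case
    proof (intro conjI allI impI)
      show "k y2 \<noteq> k y1" using k m by metis
      show "k y2 \<noteq> - k y1" using ne m by metis
      show "inj_on f' {..<N}" using m(5,6) k unfolding inj_on_def f'_def by (metis lessThan_iff)
      show "f' i \<in> all_lifts x'" "f' i \<noteq> - k y1" if "i < N" for i using m k ne that by (auto simp: f'_def)
    qed (use k m c' in \<open>auto simp: f'_def\<close>)
    moreover have "frame_map N x x' (k y1, k y2, f', c') = s"
      using pull_colour_eq[OF m(8) c'(2)] by (simp add: s k m ff')
    ultimately show "s \<in> frame_map N x x' ` frame_states N x'" by force
  qed
qed

end

lemma frame_nbhd_coherent:
  assumes x: "x \<in> topspace (coloured_conf RP2 n m)" and x': "x' \<in> frame_nbhd n m x"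
  obtains V where "openin (coloured_conf RP2 n m) V" "x' \<in> V" "V \<subseteq> frame_nbhd n m x \<inter> frame_nbhd n m x'"
    "\<And>x'' u. x'' \<in> V \<Longrightarrow> u \<in> all_lifts x'' \<Longrightarrow> near_lift x u = near_lift x (near_lift x' u)"
proof -
  note r = frame_radius[OF x]
  note tx' = frame_nbhd_top[OF x x']
  note r' = frame_radius[OF tx']
  note cl = frame_nbhd_close[OF x x']
  have cl2: "close_to (frame_radius x) (\<Union>(fst x)) (\<Union>(fst x'))" "close_to (frame_radius x) (\<Union>(snd x)) (\<Union>(snd x'))"
    using x' by (auto simp: frame_nbhd_def)
  note fin = all_lifts(1)[OF x] and fin' = all_lifts(1)[OF tx']
  obtain d where d: "0 < d" "d \<le> frame_radius x'"
    "\<And>v w. v \<in> all_lifts x \<Longrightarrow> w \<in> all_lifts x' \<Longrightarrow> dist v w < frame_radius x \<Longrightarrow> dist v w + d \<le> frame_radius x"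
    using close_to_margin[OF fin fin' r'(1), of "frame_radius x"] by metis
  define V where "V = {x'' \<in> topspace (coloured_conf RP2 n m).
     close_to d (\<Union>(fst x')) (\<Union>(fst x'')) \<and> close_to d (\<Union>(snd x')) (\<Union>(snd x''))}"
  have sub: "x'' \<in> frame_nbhd n m x \<inter> frame_nbhd n m x'" if "x'' \<in> V" for x''
  proof -
    have c: "close_to d (\<Union>(fst x')) (\<Union>(fst x''))" "close_to d (\<Union>(snd x')) (\<Union>(snd x''))"
      "x'' \<in> topspace (coloured_conf RP2 n m)" using that V_def by auto
    show ?thesis unfolding frame_nbhd_def
      using c close_to_mono[OF _ d(2)] close_to_trans[OF cl2(1) c(1)] close_to_trans[OF cl2(2) c(2)] d(3)
      by (auto simp: all_lifts_def)
  qed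
  show ?thesis
  proof (rule that)
    show "openin (coloured_conf RP2 n m) V"
      unfolding V_def by (rule openin_coloured_near) (use all_lifts[OF tx'] in auto)
    show "x' \<in> V" unfolding V_def using tx' d close_to_refl by auto
    show "V \<subseteq> frame_nbhd n m x \<inter> frame_nbhd n m x'" using sub by blast
    fix x'' u assume V: "x'' \<in> V" and u: "u \<in> all_lifts x''"
    have tx'': "x'' \<in> topspace (coloured_conf RP2 n m)" using V by (simp add: V_def)
    have cld: "close_to d (all_lifts x') (all_lifts x'')" using V close_to_Un unfolding V_def all_lifts_def by blast
    show "near_lift x u = near_lift x (near_lift x' u)"
      unfolding near_lift_def
      by (rule nearest_trans[OF fin fin' all_lifts(1)[OF tx''] _ _ r(3) r'(3) cl cld d(2) d(3) u])
        (simp_all add: all_lifts(2)[OF x] all_lifts(2)[OF tx'] all_lifts(2)[OF tx''])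
  qed
qed

lemma frame_nbhd_open:
  assumes x: "x \<in> topspace (coloured_conf RP2 n m)"
  shows "openin (coloured_conf RP2 n m) (frame_nbhd n m x)" "x \<in> frame_nbhd n m x"
  using frame_radius[OF x] x close_to_refl all_lifts[OF x]
  unfolding frame_nbhd_def by (auto intro: openin_coloured_near)

lemma near_lift_self:
  assumes "x \<in> topspace (coloured_conf RP2 n m)" "v \<in> all_lifts x"
  shows "near_lift x v = v"
  unfolding near_lift_def
  by (rule nearest_eq[OF frame_radius(3)[OF assms(1)] assms(2)]) (use frame_radius[OF assms(1)] in simp)

interpretation points: local_system "coloured_conf RP2 n m" all_lifts "frame_nbhd n m" "\<lambda>x _. near_lift x"
  for n m
proof
  fix x assume x: "x \<in> topspace (coloured_conf RP2 n m)"
  show "openin (coloured_conf RP2 n m) (frame_nbhd n m x)" "x \<in> frame_nbhd n m x"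
    using frame_nbhd_open[OF x] by auto
  show "near_lift x v = v" if "v \<in> all_lifts x" for v by (rule near_lift_self[OF x that])
  fix x' assume x': "x' \<in> frame_nbhd n m x"
  show "bij_betw (near_lift x) (all_lifts x') (all_lifts x)" by (rule near_lift_bij[OF x x'])
  show "\<exists>V. openin (coloured_conf RP2 n m) V \<and> x' \<in> V \<and> V \<subseteq> frame_nbhd n m x \<inter> frame_nbhd n m x' \<and>
      (\<forall>w\<in>V. \<forall>f\<in>all_lifts w. near_lift x f = near_lift x (near_lift x' f))"
    using frame_nbhd_coherent[OF x x'] by metis
qed

interpretation frames: local_system "coloured_conf RP2 n m" "frame_states N" "frame_nbhd n m" "frame_map N"
  for n m N
proof
  fix x assume x: "x \<in> topspace (coloured_conf RP2 n m)"
  show "openin (coloured_conf RP2 n m) (frame_nbhd n m x)" and xx: "x \<in> frame_nbhd n m x"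
    using frame_nbhd_open[OF x] by auto
  show "frame_map N x x s = s" if st: "s \<in> frame_states N x" for s
  proof -
    obtain y1 y2 f c where s: "s = (y1, y2, f, c)" by (metis prod_cases4)
    note nl = near_lift_self[OF x]
    have m: "y1 \<in> all_lifts x" "y2 \<in> all_lifts x" "near_lifts N x f = f" "c \<in> colourings N"
      using st nl by (auto simp: frame_states_def s near_lifts_def fun_eq_iff)
    have "crossed_all N (strands y1 y2 f) (strands y1 y2 f) c c"
      by (simp add: crossed_all_def crossed_refl)
    then show ?thesis using m pull_colour_eq by (simp add: s nl)
  qed
  fix x' assume x': "x' \<in> frame_nbhd n m x"
  show "bij_betw (frame_map N x x') (frame_states N x') (frame_states N x)"
    by (rule frame_map_bij[OF x x'])
  note tx' = frame_nbhd_top[OF x x']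
  obtain V where V: "openin (coloured_conf RP2 n m) V" "x' \<in> V" "V \<subseteq> frame_nbhd n m x \<inter> frame_nbhd n m x'"
    and nlV: "\<And>x'' u. x'' \<in> V \<Longrightarrow> u \<in> all_lifts x'' \<Longrightarrow> near_lift x u = near_lift x (near_lift x' u)"
    using frame_nbhd_coherent[OF x x'] by metis
  show "\<exists>V. openin (coloured_conf RP2 n m) V \<and> x' \<in> V \<and> V \<subseteq> frame_nbhd n m x \<inter> frame_nbhd n m x' \<and>
      (\<forall>w\<in>V. \<forall>f\<in>frame_states N w. frame_map N x w f = frame_map N x x' (frame_map N x' w f))"
  proof (intro exI[of _ V] conjI ballI V)
    fix x'' s assume V'': "x'' \<in> V" and st: "s \<in> frame_states N x''"
    have x'': "x'' \<in> frame_nbhd n m x" "x'' \<in> frame_nbhd n m x'" using V V'' by auto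
    note nl = nlV[OF V'']
    obtain y1 y2 f c where s: "s = (y1, y2, f, c)" by (metis prod_cases4)
    have m: "y1 \<in> all_lifts x''" "y2 \<in> all_lifts x''" "\<And>i. i < N \<Longrightarrow> f i \<in> all_lifts x''"
      using st by (auto simp: frame_states_def s)
    have nls: "near_lifts N x f = near_lifts N x (near_lifts N x' f)"
      using nl m by (auto simp: near_lifts_def)
    let ?z = "strands (near_lift x y1) (near_lift x y2) (near_lifts N x f)"
    let ?z' = "strands (near_lift x' y1) (near_lift x' y2) (near_lifts N x' f)"
    let ?z'' = "strands y1 y2 f"
    let ?c' = "pull_colour N ?z' ?z'' c"
    let ?c = "pull_colour N ?z ?z' ?c'"
    have s': "frame_map N x' x'' s \<in> frame_states N x'"
      using frame_map_in[OF tx' x''(2)] st s by blast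
    then have s': "(near_lift x' y1, near_lift x' y2, near_lifts N x' f, ?c') \<in> frame_states N x'"
      by (simp add: s)
    \<comment> \<open>Pulling the colours back in two steps also solves the crossing equations of
      the single step, and \<open>pull_colour\<close> is their only solution.\<close>
    have "crossed_all N ?z ?z'' ?c c"
    proof (rule crossed_all_trans)
      show "inj_on ?z {..<N}"
        using frame_map_in[OF x x''(1), of y1 y2 f c N] st unfolding s frame_map.simps
        by (intro frame_states_coord[OF x xx]) auto
      show "inj_on ?z' {..<N}" by (rule frame_states_coord[OF x x' s'])
      show "near N ?z ?z'" using frame_states_near[OF x x' s'] nl m nls by simp
      show "near N ?z' ?z''" using frame_states_near[OF tx' x''(2)] st s by blast
      show "near N ?z ?z''" using frame_states_near[OF x x''(1)] st s by blast
    qed (rule crossed_pull)+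
    moreover have "?c \<in> colourings N" using st by (intro pull_colour_in) (auto simp: frame_states_def s)
    ultimately have "pull_colour N ?z ?z'' c = ?c" by (intro pull_colour_eq)
    then show "frame_map N x x'' s = frame_map N x x' (frame_map N x' x'' s)"
      using nl m nls by (simp add: s)
  qed
qed

section \<open>Torsion of mixed braids\<close>

abbreviation (input) "colour_of s \<equiv> snd (snd (snd s))"

text \<open>Frame and strands of a state move as individual lifts, unaffected by the colours, so
  their holonomy is that of \<open>points\<close>.\<close>

lemma frames_flat_components:
  assumes F: "frames.flat n m N K h F"
  shows "points.flat n m K h (\<lambda>k. fst (F k))" "points.flat n m K h (\<lambda>k. fst (snd (F k)))"
    "i < N \<Longrightarrow> points.flat n m K h (\<lambda>k. fst (snd (snd (F k))) i)"
proof -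
  have *: "points.flat n m K h (\<lambda>k. sel (F k))"
    if s: "\<And>x s. s \<in> frame_states N x \<Longrightarrow> sel s \<in> all_lifts x"
      "\<And>x x' s. s \<in> frame_states N x' \<Longrightarrow> sel (frame_map N x x' s) = near_lift x (sel s)" for sel
    unfolding points.flat_def
  proof (intro ballI conjI)
    fix k assume k: "k \<in> K"
    show "h k \<in> topspace (coloured_conf RP2 n m)" "sel (F k) \<in> all_lifts (h k)"
      using frames.flatD[OF F k] s by auto
    obtain T where T: "open T" "k \<in> T" "\<And>k'. k' \<in> K \<Longrightarrow> k' \<in> T \<Longrightarrow>
        h k' \<in> frame_nbhd n m (h k) \<and> frame_map N (h k) (h k') (F k') = F k"
      using frames.flat_nbhd[OF F k] by metis
    have "near_lift (h k) (sel (F k')) = sel (F k)" if "k' \<in> K" "k' \<in> T" for k'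
      using T(3)[OF that] s(2)[OF frames.flatD(2)[OF F that(1)]] by metis
    then show "\<exists>T. open T \<and> k \<in> T \<and> (\<forall>k'\<in>K \<inter> T. h k' \<in> frame_nbhd n m (h k) \<and> near_lift (h k) (sel (F k')) = sel (F k))"
      using T by (intro exI[of _ T]) auto
  qed
  show "points.flat n m K h (\<lambda>k. fst (F k))" by (rule *) (auto simp: frame_states_def)
  show "points.flat n m K h (\<lambda>k. fst (snd (F k)))" by (rule *) (auto simp: frame_states_def)
  show "points.flat n m K h (\<lambda>k. fst (snd (snd (F k))) i)" if "i < N"
    by (rule *[where sel = "\<lambda>s. fst (snd (snd s)) i"]) (use that in \<open>auto simp: frame_states_def near_lifts_def\<close>)
qed

context
  fixes n m :: nat and \<gamma> :: "real \<Rightarrow> (real^3) set set \<times> (real^3) set set" and x0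
  assumes \<gamma>: "pathin (coloured_conf RP2 n m) \<gamma>" "\<gamma> 0 = x0" "\<gamma> 1 = x0"
begin

lemma frames_hol_components:
  assumes s: "(y1, y2, f, c) \<in> frame_states N x0"
  shows "frames.hol n m N \<gamma> (y1, y2, f, c) = (points.hol n m \<gamma> y1, points.hol n m \<gamma> y2,
     (\<lambda>i. if i < N then points.hol n m \<gamma> (f i) else 0), colour_of (frames.hol n m N \<gamma> (y1, y2, f, c)))"
proof -
  obtain F where F: "frames.flat n m N {0..1} \<gamma> F" "F 0 = (y1, y2, f, c)"
    using frames.flat_path[OF \<gamma>(1), of "(y1, y2, f, c)" N] s \<gamma>(2) by auto
  have h: "frames.hol n m N \<gamma> (y1, y2, f, c) = F 1" using frames.hol_eq[OF F(1)] F(2) by simp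
  obtain z1 z2 g d where F1: "F 1 = (z1, z2, g, d)" by (metis prod_cases4)
  have "F 1 \<in> frame_states N x0" using frames.flatD(2)[OF F(1), of 1] \<gamma>(3) by simp
  then have "\<forall>i\<ge>N. g i = 0" using F1 by (simp add: frame_states_def)
  moreover have "points.hol n m \<gamma> y1 = z1" "points.hol n m \<gamma> y2 = z2"
    "\<And>i. i < N \<Longrightarrow> points.hol n m \<gamma> (f i) = g i"
    using points.hol_eq[OF frames_flat_components(1)[OF F(1)]] points.hol_eq[OF frames_flat_components(2)[OF F(1)]]
      points.hol_eq[OF frames_flat_components(3)[OF F(1)]] F(2) F1 by auto
  ultimately show ?thesis unfolding h F1 by auto
qed

lemma frames_hol_in: "s \<in> frame_states N x0 \<Longrightarrow> frames.hol n m N \<gamma> s \<in> frame_states N x0"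
  using frames.hol_in[OF \<gamma>(1)] \<gamma> by metis

lemma frames_hol_invariant:
  assumes "s1 \<in> frame_states N x0" "s2 \<in> frame_states N x0" "s3 \<in> frame_states N x0"
    and "\<And>x y f1 f2 f3. x \<in> topspace (coloured_conf RP2 n m) \<Longrightarrow> y \<in> frame_nbhd n m x \<Longrightarrow>
        f1 \<in> frame_states N y \<Longrightarrow> f2 \<in> frame_states N y \<Longrightarrow> f3 \<in> frame_states N y \<Longrightarrow>
        Q (frame_map N x y f1) (frame_map N x y f2) (frame_map N x y f3) \<longleftrightarrow> Q f1 f2 f3"
    and "Q s1 s2 s3"
  shows "Q (frames.hol n m N \<gamma> s1) (frames.hol n m N \<gamma> s2) (frames.hol n m N \<gamma> s3)"
  using frames.hol_invariant[OF \<gamma>(1), of s1 N s2 s3 "\<lambda>_. Q"] assms \<gamma> by auto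

lemma frame_map_eq_iff:
  assumes "x \<in> topspace (coloured_conf RP2 n m)" "y \<in> frame_nbhd n m x" "s \<in> frame_states N y" "t \<in> frame_states N y"
  shows "frame_map N x y s = frame_map N x y t \<longleftrightarrow> s = t"
  using frame_map_bij[OF assms(1,2)] assms(3,4) by (metis bij_betw_def inj_on_eq_iff)

text \<open>Invariance of the equation \<open>u = \<psi> s t\<close> along three parallel sections.
  The relation \<open>C\<close> says when \<psi> is meaningful, for instance that both states have
  the same frame and strands, and is carried along.\<close>

lemma frames_hol_commute:
  assumes s: "s1 \<in> frame_states N x0" "s2 \<in> frame_states N x0" "\<psi> s1 s2 \<in> frame_states N x0"
    and c: "C s1 s2"
    and C: "\<And>x y s t. x \<in> topspace (coloured_conf RP2 n m) \<Longrightarrow> y \<in> frame_nbhd n m x \<Longrightarrow>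
       s \<in> frame_states N y \<Longrightarrow> t \<in> frame_states N y \<Longrightarrow> C (frame_map N x y s) (frame_map N x y t) \<longleftrightarrow> C s t"
    and \<psi>: "\<And>x y s t. x \<in> topspace (coloured_conf RP2 n m) \<Longrightarrow> y \<in> frame_nbhd n m x \<Longrightarrow>
       s \<in> frame_states N y \<Longrightarrow> t \<in> frame_states N y \<Longrightarrow> C s t \<Longrightarrow>
       \<psi> s t \<in> frame_states N y \<and> frame_map N x y (\<psi> s t) = \<psi> (frame_map N x y s) (frame_map N x y t)"
  shows "frames.hol n m N \<gamma> (\<psi> s1 s2) = \<psi> (frames.hol n m N \<gamma> s1) (frames.hol n m N \<gamma> s2)"
proof -
  have "C (frames.hol n m N \<gamma> s1) (frames.hol n m N \<gamma> s2) \<and>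
      frames.hol n m N \<gamma> (\<psi> s1 s2) = \<psi> (frames.hol n m N \<gamma> s1) (frames.hol n m N \<gamma> s2)"
  proof (rule frames_hol_invariant[where Q = "\<lambda>s t u. C s t \<and> u = \<psi> s t", OF s])
    fix x y f1 f2 f3
    assume xy: "x \<in> topspace (coloured_conf RP2 n m)" "y \<in> frame_nbhd n m x"
      and f: "f1 \<in> frame_states N y" "f2 \<in> frame_states N y" "f3 \<in> frame_states N y"
    show "C (frame_map N x y f1) (frame_map N x y f2) \<and> frame_map N x y f3 = \<psi> (frame_map N x y f1) (frame_map N x y f2)
      \<longleftrightarrow> C f1 f2 \<and> f3 = \<psi> f1 f2"
      using C[OF xy f(1,2)] \<psi>[OF xy f(1,2)] frame_map_eq_iff[OF xy f(3)] by metis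
  qed (use c in auto)
  then show ?thesis ..
qed

text \<open>The coefficients may depend on \<theta>, as transport acts for each \<theta> separately;
  so the holonomy is a matrix of continuous functions.\<close>

lemma frames_hol_linear:
  assumes s: "(y1, y2, f, c) \<in> frame_states N x0" "d \<in> colourings N"
    and ab: "continuous_on UNIV a" "continuous_on UNIV b"
  shows "colour_of (frames.hol n m N \<gamma> (y1, y2, f, (\<lambda>i \<theta>. a \<theta> * c i \<theta> + b \<theta> * d i \<theta>)))
    = (\<lambda>i \<theta>. a \<theta> * colour_of (frames.hol n m N \<gamma> (y1, y2, f, c)) i \<theta> + b \<theta> * colour_of (frames.hol n m N \<gamma> (y1, y2, f, d)) i \<theta>)"
proof -
  define \<psi> where "\<psi> s t = (fst s, fst (snd s), fst (snd (snd s)), (\<lambda>i \<theta>. a \<theta> * colour_of s i \<theta> + b \<theta> * colour_of t i \<theta>))"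
    for s t :: "(real^3) \<times> (real^3) \<times> (nat \<Rightarrow> real^3) \<times> (nat \<Rightarrow> real \<Rightarrow> complex)"
  define C where "C s t \<longleftrightarrow> fst s = fst t \<and> fst (snd s) = fst (snd t) \<and> fst (snd (snd s)) = fst (snd (snd t))"
    for s t :: "(real^3) \<times> (real^3) \<times> (nat \<Rightarrow> real^3) \<times> (nat \<Rightarrow> real \<Rightarrow> complex)"
  have col: "(\<lambda>i \<theta>. a \<theta> * c i \<theta> + b \<theta> * d i \<theta>) \<in> colourings N" if "c \<in> colourings N" "d \<in> colourings N" for c d
    using that ab by (auto simp: colourings_def intro!: continuous_intros)
  have "frames.hol n m N \<gamma> (\<psi> (y1, y2, f, c) (y1, y2, f, d)) = \<psi> (frames.hol n m N \<gamma> (y1, y2, f, c)) (frames.hol n m N \<gamma> (y1, y2, f, d))"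
  proof (rule frames_hol_commute[where C = C])
    show "(y1, y2, f, c) \<in> frame_states N x0" "(y1, y2, f, d) \<in> frame_states N x0"
      "\<psi> (y1, y2, f, c) (y1, y2, f, d) \<in> frame_states N x0" "C (y1, y2, f, c) (y1, y2, f, d)"
      using s col by (auto simp: frame_states_def \<psi>_def C_def)
    fix x y s t assume xy: "x \<in> topspace (coloured_conf RP2 n m)" "y \<in> frame_nbhd n m x"
      and st: "s \<in> frame_states N y" "t \<in> frame_states N y"
    obtain y1 y2 f c where s: "s = (y1, y2, f, c)" by (metis prod_cases4)
    obtain z1 z2 g d where t: "t = (z1, z2, g, d)" by (metis prod_cases4)
    have m: "y1 \<in> all_lifts y" "y2 \<in> all_lifts y" "z1 \<in> all_lifts y" "z2 \<in> all_lifts y"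
      "\<And>i. i < N \<Longrightarrow> f i \<in> all_lifts y \<and> g i \<in> all_lifts y" "\<And>i. i \<ge> N \<Longrightarrow> f i = 0 \<and> g i = 0"
      "c \<in> colourings N" "d \<in> colourings N"
      using st s t by (auto simp: frame_states_def)
    have "near_lifts N x f = near_lifts N x g \<longleftrightarrow> f = g"
    proof
      assume eq: "near_lifts N x f = near_lifts N x g"
      have "f i = g i" for i
        using fun_cong[OF eq, of i] near_lift_inj[OF xy] m(5,6)[of i] by (cases "i < N") (auto simp: near_lifts_def)
      then show "f = g" by auto
    qed auto
    then show "C (frame_map N x y s) (frame_map N x y t) \<longleftrightarrow> C s t"
      using near_lift_inj[OF xy] m by (simp add: s t C_def)
    assume "C s t"
    then have e: "z1 = y1" "z2 = y2" "g = f" by (auto simp: s t C_def)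
    show "\<psi> s t \<in> frame_states N y \<and> frame_map N x y (\<psi> s t) = \<psi> (frame_map N x y s) (frame_map N x y t)"
    proof
      show "\<psi> s t \<in> frame_states N y" using st col by (auto simp: frame_states_def \<psi>_def s t)
      show "frame_map N x y (\<psi> s t) = \<psi> (frame_map N x y s) (frame_map N x y t)"
        unfolding s t \<psi>_def e fst_conv snd_conv frame_map.simps
      proof (intro arg_cong2[where f = Pair] refl pull_colour_eq)
        let ?z = "strands (near_lift x y1) (near_lift x y2) (near_lifts N x f)" and ?z' = "strands y1 y2 f"
        show "(\<lambda>i \<theta>. a \<theta> * pull_colour N ?z ?z' c i \<theta> + b \<theta> * pull_colour N ?z ?z' d i \<theta>) \<in> colourings N"
          by (intro col pull_colour_in m)
        show "crossed_all N ?z ?z' (\<lambda>i \<theta>. a \<theta> * pull_colour N ?z ?z' c i \<theta> + b \<theta> * pull_colour N ?z ?z' d i \<theta>)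
           (\<lambda>i \<theta>. a \<theta> * c i \<theta> + b \<theta> * d i \<theta>)"
          unfolding crossed_all_def
        proof
          fix \<theta>
          have *: "crossed (cis \<theta>) N ?z ?z' (\<lambda>i. pull_colour N ?z ?z' c i \<theta>) (\<lambda>i. c i \<theta>)" for c
            using crossed_pull[of N ?z ?z' c] unfolding crossed_all_def by blast
          show "crossed (cis \<theta>) N ?z ?z' (\<lambda>i. a \<theta> * pull_colour N ?z ?z' c i \<theta> + b \<theta> * pull_colour N ?z ?z' d i \<theta>)
             (\<lambda>i. a \<theta> * c i \<theta> + b \<theta> * d i \<theta>)"
            by (rule crossed_linear[OF * *])
        qed
      qed
    qed
  qed
  from arg_cong[OF this, of "\<lambda>s. colour_of s"] show ?thesis unfolding \<psi>_def fst_conv snd_conv .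
qed

text \<open>The numbering of the strands is immaterial. After one turn of the loop they come back
  permuted, and this compares the next turn with the first.\<close>

lemma frames_hol_relabel:
  assumes s: "(y1, y2, f, c) \<in> frame_states N x0"
    and \<pi>: "bij_betw \<pi> {..<N} {..<N}" "\<And>i. i \<ge> N \<Longrightarrow> \<pi> i = i"
  shows "colour_of (frames.hol n m N \<gamma> (y1, y2, f \<circ> \<pi>, c \<circ> \<pi>)) = colour_of (frames.hol n m N \<gamma> (y1, y2, f, c)) \<circ> \<pi>"
proof -
  define \<psi> where "\<psi> s t = (fst s, fst (snd s), fst (snd (snd s)) \<circ> \<pi>, colour_of s \<circ> \<pi>)"
    for s t :: "(real^3) \<times> (real^3) \<times> (nat \<Rightarrow> real^3) \<times> (nat \<Rightarrow> real \<Rightarrow> complex)"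
  have \<pi>N: "\<pi> i < N \<longleftrightarrow> i < N" for i using \<pi> by (cases "i < N") (auto simp: bij_betw_def)
  have col: "c \<circ> \<pi> \<in> colourings N" if "c \<in> colourings N" for c
    using that \<pi>N \<pi>(2) by (auto simp: colourings_def)
  have \<psi>_in: "\<psi> (y1, y2, f, c) t \<in> frame_states N y" if "(y1, y2, f, c) \<in> frame_states N y" for y1 y2 f c y t
  proof -
    have "inj_on (f \<circ> \<pi>) {..<N}" using that \<pi> by (intro comp_inj_on) (auto simp: frame_states_def bij_betw_def)
    then show ?thesis using that col \<pi>N \<pi>(2) by (auto simp: frame_states_def \<psi>_def)
  qed
  have "frames.hol n m N \<gamma> (\<psi> (y1, y2, f, c) (y1, y2, f, c)) = \<psi> (frames.hol n m N \<gamma> (y1, y2, f, c)) (frames.hol n m N \<gamma> (y1, y2, f, c))"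
  proof (rule frames_hol_commute[where C = "\<lambda>_ _. True"])
    fix x y s t assume xy: "x \<in> topspace (coloured_conf RP2 n m)" "y \<in> frame_nbhd n m x"
      and st: "s \<in> frame_states N y"
    obtain y1 y2 f c where s: "s = (y1, y2, f, c)" by (metis prod_cases4)
    have c: "c \<in> colourings N" using st by (auto simp: frame_states_def s)
    have nl: "near_lifts N x (f \<circ> \<pi>) = near_lifts N x f \<circ> \<pi>" by (rule ext) (simp add: near_lifts_def \<pi>N)
    show "\<psi> s t \<in> frame_states N y \<and> frame_map N x y (\<psi> s t) = \<psi> (frame_map N x y s) (frame_map N x y t)"
    proof
      show "\<psi> s t \<in> frame_states N y" using st s \<psi>_in by blast
      show "frame_map N x y (\<psi> s t) = \<psi> (frame_map N x y s) (frame_map N x y t)"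
        unfolding s \<psi>_def fst_conv snd_conv frame_map.simps
      proof (intro arg_cong2[where f = Pair] refl pull_colour_eq nl)
        let ?z = "strands (near_lift x y1) (near_lift x y2) (near_lifts N x f)" and ?z' = "strands y1 y2 f"
        show "pull_colour N ?z ?z' c \<circ> \<pi> \<in> colourings N" by (intro col pull_colour_in c)
        have "crossed (cis \<theta>) N (?z \<circ> \<pi>) (?z' \<circ> \<pi>) ((\<lambda>i. pull_colour N ?z ?z' c i \<theta>) \<circ> \<pi>) ((\<lambda>i. c i \<theta>) \<circ> \<pi>)" for \<theta>
          using crossed_pull[of N ?z ?z' c] unfolding crossed_all_def by (intro crossed_relabel \<pi>) auto
        then show "crossed_all N (strands (near_lift x y1) (near_lift x y2) (near_lifts N x (f \<circ> \<pi>)))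
            (strands y1 y2 (f \<circ> \<pi>)) (pull_colour N ?z ?z' c \<circ> \<pi>) (c \<circ> \<pi>)"
          unfolding crossed_all_def nl by (simp add: strands_def comp_def)
      qed
    qed
  qed (use s \<psi>_in in auto)
  from arg_cong[OF this, of "\<lambda>s. colour_of s"] show ?thesis unfolding \<psi>_def fst_conv snd_conv .
qed

lemma frames_hol_const:
  assumes s: "(y1, y2, f, (\<lambda>i _. if i < N then 1 else 0)) \<in> frame_states N x0"
  shows "colour_of (frames.hol n m N \<gamma> (y1, y2, f, (\<lambda>i _. if i < N then 1 else 0))) = (\<lambda>i _. if i < N then 1 else 0)"
proof -
  let ?one = "(\<lambda>i _. if i < N then 1 else 0) :: nat \<Rightarrow> real \<Rightarrow> complex"
  have one: "?one \<in> colourings N" using s by (auto simp: frame_states_def)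
  define \<psi> where "\<psi> s t = (fst s, fst (snd s), fst (snd (snd s)), ?one)"
    for s t :: "(real^3) \<times> (real^3) \<times> (nat \<Rightarrow> real^3) \<times> (nat \<Rightarrow> real \<Rightarrow> complex)"
  have "frames.hol n m N \<gamma> (\<psi> (y1, y2, f, ?one) (y1, y2, f, ?one)) = \<psi> (frames.hol n m N \<gamma> (y1, y2, f, ?one)) (frames.hol n m N \<gamma> (y1, y2, f, ?one))"
  proof (rule frames_hol_commute[where C = "\<lambda>_ _. True"])
    fix x y s t assume xy: "x \<in> topspace (coloured_conf RP2 n m)" "y \<in> frame_nbhd n m x"
      and st: "s \<in> frame_states N y"
    obtain y1 y2 f c where s: "s = (y1, y2, f, c)" by (metis prod_cases4)
    show "\<psi> s t \<in> frame_states N y \<and> frame_map N x y (\<psi> s t) = \<psi> (frame_map N x y s) (frame_map N x y t)"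
    proof
      show "\<psi> s t \<in> frame_states N y" using st one by (auto simp: frame_states_def \<psi>_def s)
      show "frame_map N x y (\<psi> s t) = \<psi> (frame_map N x y s) (frame_map N x y t)"
        unfolding s \<psi>_def fst_conv snd_conv frame_map.simps
      proof (intro arg_cong2[where f = Pair] refl pull_colour_eq one)
        have inj: "inj_on (strands y1 y2 f) {..<N}" using frame_states_coord[OF xy] st s by blast
        show "crossed_all N (strands (near_lift x y1) (near_lift x y2) (near_lifts N x f)) (strands y1 y2 f) ?one ?one"
          unfolding crossed_all_def by (intro allI crossed_cong[OF crossed_const[OF inj, of _ _ 1]]) auto
      qed
    qed
  qed (use s in \<open>auto simp: \<psi>_def\<close>)
  from arg_cong[OF this, of "\<lambda>s. colour_of s"] show ?thesis unfolding \<psi>_def fst_conv snd_conv .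
qed

text \<open>At \<theta> = 0 the factor \<open>1 - t\<close> vanishes, so crossings do not alter
  colours.\<close>

lemma frames_hol_0:
  assumes s: "(y1, y2, f, c) \<in> frame_states N x0" and j: "j < N"
  shows "colour_of (frames.hol n m N \<gamma> (y1, y2, f, c)) j 0 = c j 0"
proof -
  have "colour_of (frames.hol n m N \<gamma> (y1, y2, f, c)) j 0 = colour_of (y1, y2, f, c) j 0"
    by (rule frames_hol_invariant[where Q = "\<lambda>s _ _. colour_of s j 0 = colour_of (y1, y2, f, c) j 0", OF s s s])
      (auto simp: pull_colour_def j)
  then show ?thesis by simp
qed

text \<open>The set of all strands contains everything above its members, so
  \<open>wsum_crossed\<close> applies: the holonomy around all strands is invariant.\<close>

lemma frames_hol_wsum:
  assumes s: "(y1, y2, f, c) \<in> frame_states N x0" and s': "frames.hol n m N \<gamma> (y1, y2, f, c) = (y1', y2', f', c')"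
  shows "wsum (cis \<theta>) (strands y1' y2' f') {..<N} (\<lambda>i. c' i \<theta>) = wsum (cis \<theta>) (strands y1 y2 f) {..<N} (\<lambda>i. c i \<theta>)"
proof -
  define Q where "Q s \<longleftrightarrow> (case s of (z1, z2, g, d) \<Rightarrow>
     wsum (cis \<theta>) (strands z1 z2 g) {..<N} (\<lambda>i. d i \<theta>) = wsum (cis \<theta>) (strands y1 y2 f) {..<N} (\<lambda>i. c i \<theta>))" for s
  have "Q (frames.hol n m N \<gamma> (y1, y2, f, c))"
  proof (rule frames_hol_invariant[where Q = "\<lambda>s _ _. Q s", OF s s s])
    fix x y s assume xy: "x \<in> topspace (coloured_conf RP2 n m)" "y \<in> frame_nbhd n m x"
      and st: "s \<in> frame_states N y"
    obtain z1 z2 g d where s: "s = (z1, z2, g, d)" by (metis prod_cases4)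
    let ?z = "strands (near_lift x z1) (near_lift x z2) (near_lifts N x g)" and ?z' = "strands z1 z2 g"
    have "frame_map N x y s \<in> frame_states N x" using frame_map_in[OF xy] st s by blast
    then have "inj_on ?z {..<N}"
      using frame_states_coord[OF xy(1) frame_nbhd_open(2)[OF xy(1)]] unfolding s frame_map.simps by blast
    moreover have "near N ?z ?z'" using frame_states_near[OF xy] st s by blast
    ultimately have "wsum (cis \<theta>) ?z {..<N} (\<lambda>i. pull_colour N ?z ?z' d i \<theta>) = wsum (cis \<theta>) ?z' {..<N} (\<lambda>i. d i \<theta>)"
      using crossed_pull[of N ?z ?z' d] unfolding crossed_all_def by (intro wsum_crossed) auto
    then show "Q (frame_map N x y s) \<longleftrightarrow> Q s" by (simp add: Q_def s)
  qed (simp add: Q_def)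
  then show ?thesis by (simp add: Q_def s')
qed

text \<open>The frame \<open>(y1, y2)\<close> turns the strands \<open>f\<close> into a braid in the plane, whose permutation is
  an \<open>N\<close>-cycle.\<close>

lemma no_torsion_loop:
  assumes q: "q > 0" and tors: "\<And>s. s \<in> frame_states N x0 \<Longrightarrow> (frames.hol n m N \<gamma> ^^ q) s = s"
    and N: "N \<ge> 2"
    and y: "y1 \<in> all_lifts x0" "y2 \<in> all_lifts x0" "y2 \<noteq> y1" "y2 \<noteq> - y1"
      "points.hol n m \<gamma> y1 = y1" "points.hol n m \<gamma> y2 = y2"
    and f: "inj_on f {..<N}" "\<And>i. i < N \<Longrightarrow> f i \<in> all_lifts x0 \<and> f i \<noteq> - y1"
      "\<And>i. i < N \<Longrightarrow> points.hol n m \<gamma> (f i) = f (Suc i mod N)"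
  shows False
proof -
  define \<rho> where "\<rho> i = (if i < N then Suc i mod N else i)" for i
  define \<sigma> where "\<sigma> i = (if i < N then (i + N - 1) mod N else i)" for i
  have N0: "N > 0" using N by simp
  have \<rho>N: "\<rho> i < N \<longleftrightarrow> i < N" and \<sigma>N: "\<sigma> i < N \<longleftrightarrow> i < N" for i using N0 by (auto simp: \<rho>_def \<sigma>_def)
  have inv: "\<sigma> (\<rho> i) = i" "\<rho> (\<sigma> i) = i" for i
    using N by (auto simp: \<rho>_def \<sigma>_def mod_Suc mod_if Suc_diff_Suc)
  have bij: "bij_betw \<rho> {..<N} {..<N}"
    by (rule bij_betwI[where g = \<sigma>]) (auto simp: \<rho>N \<sigma>N inv)
  have bij\<sigma>: "bij_betw \<sigma> {..<N} {..<N}"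
    by (rule bij_betwI[where g = \<rho>]) (auto simp: \<rho>N \<sigma>N inv)
  have comp: "\<sigma> \<circ> \<rho> = id" "\<rho> \<circ> \<sigma> = id" using inv by auto
  define f0 where "f0 i = (if i < N then f i else 0)" for i
  have st: "(y1, y2, f0, c) \<in> frame_states N x0" if "c \<in> colourings N" for c
    using y f that by (auto simp: frame_states_def f0_def inj_on_def)
  define H where "H = frames.hol n m N \<gamma>"
  \<comment> \<open>Renumbering by the inverse of the cycle undoes the permutation of the strands,
    so \<open>T\<close> acts on colourings of the same strands \<open>f0\<close> and can be
    iterated.\<close>
  define T where "T c = colour_of (H (y1, y2, f0, c)) \<circ> \<sigma>" for c
  have H: "H (y1, y2, f0, c) = (y1, y2, f0 \<circ> \<rho>, T c \<circ> \<rho>)" if c: "c \<in> colourings N" for c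
  proof -
    have "(\<lambda>i. if i < N then points.hol n m \<gamma> (f0 i) else 0) = f0 \<circ> \<rho>"
      using f(3) \<rho>N by (auto simp: f0_def \<rho>_def)
    moreover have "T c \<circ> \<rho> = colour_of (H (y1, y2, f0, c))"
      by (simp add: T_def comp_assoc comp)
    ultimately show ?thesis using frames_hol_components[OF st[OF c]] y by (simp add: H_def)
  qed
  have col_rel: "c \<circ> \<pi> \<in> colourings N" if "c \<in> colourings N" "\<And>i. \<pi> i < N \<longleftrightarrow> i < N" for c and \<pi> :: "nat \<Rightarrow> nat"
    using that unfolding colourings_def by (auto simp: not_less[symmetric])
  have T_in: "T c \<in> colourings N" if c: "c \<in> colourings N" for c
  proof -
    have "H (y1, y2, f0, c) \<in> frame_states N x0" unfolding H_def by (rule frames_hol_in[OF st[OF c]])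
    then have "colour_of (H (y1, y2, f0, c)) \<in> colourings N" by (auto simp: frame_states_def)
    then show ?thesis unfolding T_def by (rule col_rel[OF _ \<sigma>N])
  qed
  have \<rho>k: "(\<rho> ^^ k) i < N \<longleftrightarrow> i < N" for k i by (induction k) (auto simp: \<rho>N)
  have \<rho>bij: "bij_betw (\<rho> ^^ k) {..<N} {..<N}" for k
  proof (induction k)
    case (Suc k)
    then show ?case using bij_betw_trans[OF Suc bij] by (simp add: comp_def)
  qed (simp add: bij_betw_def)
  have \<rho>out: "(\<rho> ^^ k) i = i" if "i \<ge> N" for k i using that by (induction k) (auto simp: \<rho>_def)
  have Tk_in: "(T ^^ k) c \<in> colourings N" if "c \<in> colourings N" for k c
    by (induction k) (use that T_in in auto)
  have Hk: "(H ^^ k) (y1, y2, f0, c) = (y1, y2, f0 \<circ> (\<rho> ^^ k), (T ^^ k) c \<circ> (\<rho> ^^ k))" if c: "c \<in> colourings N" for k c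
  proof (induction k)
    case (Suc k)
    let ?c = "(T ^^ k) c" and ?\<pi> = "\<rho> ^^ k"
    have s: "(y1, y2, f0 \<circ> ?\<pi>, ?c \<circ> ?\<pi>) \<in> frame_states N x0"
    proof -
      have "inj_on (f0 \<circ> ?\<pi>) {..<N}"
        using st[OF c] \<rho>bij[of k] by (intro comp_inj_on) (auto simp: frame_states_def bij_betw_def)
      then show ?thesis using st[OF c] \<rho>k[of k] \<rho>out col_rel[OF Tk_in[OF c, of k], of ?\<pi>]
        by (auto simp: frame_states_def)
    qed
    have e: "(\<lambda>i. if i < N then points.hol n m \<gamma> ((f0 \<circ> ?\<pi>) i) else 0) = f0 \<circ> (\<rho> ^^ Suc k)"
    proof
      fix i
      show "(if i < N then points.hol n m \<gamma> ((f0 \<circ> ?\<pi>) i) else 0) = (f0 \<circ> (\<rho> ^^ Suc k)) i"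
        using f(3)[of "?\<pi> i"] \<rho>k[of k i] \<rho>N[of "?\<pi> i"] by (auto simp: f0_def \<rho>_def)
    qed
    have "colour_of (H (y1, y2, f0 \<circ> ?\<pi>, ?c \<circ> ?\<pi>)) = colour_of (H (y1, y2, f0, ?c)) \<circ> ?\<pi>"
      unfolding H_def by (rule frames_hol_relabel[OF st[OF Tk_in[OF c]] \<rho>bij \<rho>out])
    also have "\<dots> = (T ^^ Suc k) c \<circ> (\<rho> ^^ Suc k)"
      by (simp add: H[OF Tk_in[OF c]] comp_assoc)
    finally show ?case using frames_hol_components[OF s] Suc y e by (simp add: H_def comp_def)
  qed simp
  have \<rho>_pow: "(\<rho> ^^ k) i = (i + k) mod N" if "i < N" for k i
    by (induction k) (use that N0 in \<open>auto simp: \<rho>_def mod_Suc_eq\<close>)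
  \<comment> \<open>The factor \<open>q\<close> trivialises the holonomy and the factor
    \<open>N\<close> the renumbering.\<close>
  have T_tors: "(T ^^ (q * N)) c = c" if c: "c \<in> colourings N" for c
  proof -
    have "\<rho> ^^ (q * N) = id"
    proof
      fix i show "(\<rho> ^^ (q * N)) i = id i"
        using \<rho>_pow[of i "q * N"] \<rho>out[of i "q * N"] by (cases "i < N") auto
    qed
    moreover have "(H ^^ (q * N)) (y1, y2, f0, c) = (y1, y2, f0, c)"
    proof -
      have "(H ^^ (k * q)) (y1, y2, f0, c) = (y1, y2, f0, c)" for k
        by (induction k) (simp_all add: funpow_add H_def tors[OF st[OF c]])
      then show ?thesis by (metis mult.commute)
    qed
    ultimately show ?thesis using Hk[OF c, of "q * N"] by simp
  qed
  let ?z = "strands y1 y2 f0"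
  have x0: "x0 \<in> topspace (coloured_conf RP2 n m)"
    using \<gamma> by (auto simp: pathin_def continuous_map_def)
  have "(\<lambda>i _. 0) \<in> colourings N" by (auto simp: colourings_def)
  from frame_states_coord[OF x0 frame_nbhd_open(2)[OF x0] st[OF this]] have inj: "inj_on ?z {..<N}" .
  \<comment> \<open>The coefficients of the holonomy around all strands; the exponents are the ranks
    of the strands in the order \<open>before\<close>.\<close>
  define l where "l \<theta> i = cis \<theta> ^ card {k \<in> {..<N}. before ?z k i}" for \<theta> i
  have l_wsum: "(\<Sum>i<N. l \<theta> i * c i \<theta>) = wsum (cis \<theta>) ?z {..<N} (\<lambda>i. c i \<theta>)" for c and \<theta> :: real
    by (simp add: wsum_def l_def)
  \<comment> \<open>Here \<open>t ^ N = 1\<close> while \<open>t \<noteq> 1\<close>, so the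
    geometric sum of the coefficients vanishes; this is where \<open>N \<ge> 2\<close>
    enters.\<close>
  let ?\<phi> = "2 * pi / N"
  show False
  proof (rule no_torsion_cycle[of N "q * N" T l ?\<phi>])
    show "T (\<lambda>i \<theta>. a \<theta> * c i \<theta> + b \<theta> * d i \<theta>) = (\<lambda>i \<theta>. a \<theta> * T c i \<theta> + b \<theta> * T d i \<theta>)"
      if "continuous_on UNIV a" "continuous_on UNIV b" "c \<in> colourings N" "d \<in> colourings N" for a b c d
      using frames_hol_linear[OF st[OF that(3)] that(4,1,2)] by (simp add: T_def H_def comp_def)
    show "T (\<lambda>i _. if i < N then 1 else 0) = (\<lambda>i _. if i < N then 1 else 0)"
    proof -
      have "(\<lambda>i _. if i < N then 1 else 0) \<in> colourings N" by (auto simp: colourings_def)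
      from frames_hol_const[OF st[OF this]] show ?thesis
        by (simp add: T_def H_def comp_def \<sigma>N)
    qed
    show "T c (Suc i mod N) 0 = c i 0" if c: "c \<in> colourings N" and i: "i < N" for c i
    proof -
      have "T c (\<rho> i) 0 = c i 0"
        using frames_hol_0[OF st[OF c] i] by (simp add: T_def H_def inv)
      then show ?thesis using i by (simp add: \<rho>_def)
    qed
    show "(\<Sum>i<N. l \<theta> i * T c i \<theta>) = (\<Sum>i<N. l \<theta> i * c i \<theta>)" if c: "c \<in> colourings N" for c \<theta>
    proof -
      have "wsum (cis \<theta>) (strands y1 y2 (f0 \<circ> \<rho>)) {..<N} (\<lambda>i. (T c \<circ> \<rho>) i \<theta>) = wsum (cis \<theta>) ?z {..<N} (\<lambda>i. c i \<theta>)"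
        by (rule frames_hol_wsum[OF st[OF c]]) (use H[OF c] in \<open>simp add: H_def comp_def\<close>)
      moreover have "wsum (cis \<theta>) (?z \<circ> \<rho>) {..<N} ((\<lambda>i. T c i \<theta>) \<circ> \<rho>) = wsum (cis \<theta>) ?z (\<rho> ` {..<N}) (\<lambda>i. T c i \<theta>)"
        by (rule wsum_reindex) (use bij in \<open>simp add: bij_betw_def\<close>)
      ultimately show ?thesis using bij unfolding l_wsum by (simp add: bij_betw_def strands_def comp_def)
    qed
    have cisN: "cis ?\<phi> ^ N = 1"
    proof -
      have "real N * ?\<phi> = 2 * pi" using N0 by simp
      then show ?thesis using Complex.DeMoivre[of ?\<phi> N] by (simp only: cis_2pi)
    qed
    have "cis ?\<phi> \<noteq> 1"
    proof
      assume "cis ?\<phi> = 1"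
      then have "cos ?\<phi> = 1" by (metis cis.sel(1) one_complex.sel(1))
      moreover have "cos ?\<phi> < cos 0"
        by (rule cos_monotone_0_pi) (use N in \<open>auto simp: field_simps\<close>)
      ultimately show False by simp
    qed
    moreover have "(1 - cis ?\<phi>) * wsum (cis ?\<phi>) ?z {..<N} (\<lambda>_. 1) = 0"
      using wsum_const[OF _ inj, of "cis ?\<phi>" 1] cisN by simp
    ultimately have "wsum (cis ?\<phi>) ?z {..<N} (\<lambda>_. 1) = 0" by simp
    then show "(\<Sum>i<N. l ?\<phi> i) = 0" by (simp add: wsum_def l_def)
    show "l ?\<phi> 0 \<noteq> 0" by (simp add: l_def)
  qed (use N0 q T_in T_tors in auto)
qed

end

section \<open>Fundamental groups\<close>

lemma loopsD:
  assumes "p \<in> loops X x"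
  shows "pathin X p" "p 0 = x" "p 1 = x" "x \<in> topspace X"
  using assms by (auto simp: loops_def pathin_def continuous_map_def)

lemma path_concat_in_loops:
  assumes "p \<in> loops X x" "q \<in> loops X x"
  shows "path_concat p q \<in> loops X x"
proof -
  have "continuous_map (top_of_set {0..1}) X (path_concat p q)"
    unfolding path_concat_def
  proof (rule continuous_map_cases_le)
    show "continuous_map (top_of_set {0..1}) euclideanreal (\<lambda>t. t)"
      "continuous_map (top_of_set {0..1}) euclideanreal (\<lambda>t. 1/2)" by auto
    have "continuous_map (subtopology (top_of_set {0..1::real}) {x \<in> topspace (top_of_set {0..1}). x \<le> 1/2}) X (p \<circ> (\<lambda>t. 2 * t))"
      by (rule continuous_map_compose[OF _ loopsD(1)[OF assms(1), unfolded pathin_def]])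
        (auto simp: subtopology_subtopology intro!: continuous_intros)
    then show "continuous_map (subtopology (top_of_set {0..1::real}) {x \<in> topspace (top_of_set {0..1}). x \<le> 1/2}) X (\<lambda>t. p (2 * t))"
      by (simp add: comp_def)
    have "continuous_map (subtopology (top_of_set {0..1::real}) {x \<in> topspace (top_of_set {0..1}). 1/2 \<le> x}) X (q \<circ> (\<lambda>t. 2 * t - 1))"
      by (rule continuous_map_compose[OF _ loopsD(1)[OF assms(2), unfolded pathin_def]])
        (auto simp: subtopology_subtopology intro!: continuous_intros)
    then show "continuous_map (subtopology (top_of_set {0..1::real}) {x \<in> topspace (top_of_set {0..1}). 1/2 \<le> x}) X (\<lambda>t. q (2 * t - 1))"
      by (simp add: comp_def)
    show "p (2 * t) = q (2 * t - 1)" if "t = 1/2" for t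
      unfolding that using loopsD[OF assms(1)] loopsD[OF assms(2)] by simp
  qed
  then show ?thesis using loopsD assms by (auto simp: loops_def pathin_def path_concat_def)
qed

lemma const_in_loops: "x \<in> topspace X \<Longrightarrow> (\<lambda>_. x) \<in> loops X x"
  by (simp add: loops_def pathin_def)

lemma path_concat_const: "path_concat (\<lambda>_. x) (\<lambda>_. x) = (\<lambda>_. x)"
  by (simp add: path_concat_def)

lemma unit_square_topology:
  "prod_topology (top_of_set {0..1::real}) (top_of_set {0..1::real}) = top_of_set ({0..1} \<times> {0..1})"
  by (simp add: subtopology_Times[symmetric] euclidean_product_topology)

lemma loop_homotopic_refl:
  assumes "p \<in> loops X x"
  shows "loop_homotopic X x p p"
proof -
  have "continuous_map (prod_topology (top_of_set {0..1::real}) (top_of_set {0..1::real})) X (p \<circ> snd)"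
    using loopsD(1)[OF assms] unfolding pathin_def by (intro continuous_map_compose[OF continuous_map_snd]) auto
  then show ?thesis unfolding loop_homotopic_def using loopsD[OF assms] by (intro exI[of _ "p \<circ> snd"]) auto
qed

lemma loop_homotopic_sym:
  assumes "loop_homotopic X x p q"
  shows "loop_homotopic X x q p"
proof -
  let ?I = "top_of_set {0..1::real}"
  obtain h where h: "continuous_map (prod_topology ?I ?I) X h"
    "\<And>s. s \<in> {0..1} \<Longrightarrow> h (0,s) = p s \<and> h (1,s) = q s"
    "\<And>t. t \<in> {0..1} \<Longrightarrow> h (t,0) = x \<and> h (t,1) = x"
    using assms unfolding loop_homotopic_def by blast
  have "continuous_map (prod_topology ?I ?I) (prod_topology ?I ?I) (\<lambda>z. (1 - fst z, snd z))"
    unfolding unit_square_topology by (auto intro!: continuous_intros)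
  from continuous_map_compose[OF this h(1)] have "continuous_map (prod_topology ?I ?I) X (\<lambda>z. h (1 - fst z, snd z))"
    by (simp add: comp_def)
  then show ?thesis unfolding loop_homotopic_def using h(2,3)
    by (intro exI[of _ "\<lambda>z. h (1 - fst z, snd z)"]) auto
qed

text \<open>Pasting along the curve \<open>k z = 0\<close> covers both transitivity of homotopy and
  its compatibility with concatenation.\<close>

lemma continuous_map_square_case:
  fixes k :: "real \<times> real \<Rightarrow> real"
  assumes h1: "continuous_map (prod_topology (top_of_set {0..1::real}) (top_of_set {0..1::real})) X h1"
    and h2: "continuous_map (prod_topology (top_of_set {0..1::real}) (top_of_set {0..1::real})) X h2"
    and k: "continuous_on UNIV k"
    and \<phi>: "continuous_on UNIV \<phi>" "\<And>z. z \<in> {0..1} \<times> {0..1} \<Longrightarrow> k z \<le> 0 \<Longrightarrow> \<phi> z \<in> {0..1} \<times> {0..1}"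
    and \<psi>: "continuous_on UNIV \<psi>" "\<And>z. z \<in> {0..1} \<times> {0..1} \<Longrightarrow> 0 \<le> k z \<Longrightarrow> \<psi> z \<in> {0..1} \<times> {0..1}"
    and eq: "\<And>z. z \<in> {0..1} \<times> {0..1} \<Longrightarrow> k z = 0 \<Longrightarrow> h1 (\<phi> z) = h2 (\<psi> z)"
  shows "continuous_map (prod_topology (top_of_set {0..1::real}) (top_of_set {0..1::real})) X
      (\<lambda>z. if k z \<le> 0 then h1 (\<phi> z) else h2 (\<psi> z))"
proof -
  have I: "prod_topology (top_of_set {0..1::real}) (top_of_set {0..1::real}) = top_of_set ({0..1} \<times> {0..1})"
    by (rule unit_square_topology)
  show ?thesis unfolding I
  proof (rule continuous_map_cases_le)
    show "continuous_map (top_of_set ({0..1} \<times> {0..1})) euclideanreal k"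
      "continuous_map (top_of_set ({0..1} \<times> {0..1})) euclideanreal (\<lambda>_. 0)"
      using k by (auto intro: continuous_on_subset)
    have "continuous_map (subtopology (top_of_set ({0..1} \<times> {0..1})) {z \<in> topspace (top_of_set ({0..1} \<times> {0..1})). k z \<le> 0}) X (h1 \<circ> \<phi>)"
      by (rule continuous_map_compose[OF _ h1[unfolded I]])
        (use \<phi> in \<open>auto simp: subtopology_subtopology intro: continuous_on_subset\<close>)
    then show "continuous_map (subtopology (top_of_set ({0..1} \<times> {0..1})) {z \<in> topspace (top_of_set ({0..1} \<times> {0..1})). k z \<le> 0}) X (\<lambda>z. h1 (\<phi> z))"
      by (simp add: comp_def)
    have "continuous_map (subtopology (top_of_set ({0..1} \<times> {0..1})) {z \<in> topspace (top_of_set ({0..1} \<times> {0..1})). 0 \<le> k z}) X (h2 \<circ> \<psi>)"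
      by (rule continuous_map_compose[OF _ h2[unfolded I]])
        (use \<psi> in \<open>auto simp: subtopology_subtopology intro: continuous_on_subset\<close>)
    then show "continuous_map (subtopology (top_of_set ({0..1} \<times> {0..1})) {z \<in> topspace (top_of_set ({0..1} \<times> {0..1})). 0 \<le> k z}) X (\<lambda>z. h2 (\<psi> z))"
      by (simp add: comp_def)
    show "h1 (\<phi> z) = h2 (\<psi> z)" if "z \<in> topspace (top_of_set ({0..1} \<times> {0..1}))" "k z = 0" for z
      using eq that by simp
  qed
qed

lemma loop_homotopic_trans:
  assumes "loop_homotopic X x p q" "loop_homotopic X x q r"
  shows "loop_homotopic X x p r"
proof -
  let ?I = "top_of_set {0..1::real}"
  obtain h where h: "continuous_map (prod_topology ?I ?I) X h"
    "\<And>s. s \<in> {0..1} \<Longrightarrow> h (0,s) = p s \<and> h (1,s) = q s"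
    "\<And>t. t \<in> {0..1} \<Longrightarrow> h (t,0) = x \<and> h (t,1) = x"
    using assms unfolding loop_homotopic_def by blast
  obtain h' where h': "continuous_map (prod_topology ?I ?I) X h'"
    "\<And>s. s \<in> {0..1} \<Longrightarrow> h' (0,s) = q s \<and> h' (1,s) = r s"
    "\<And>t. t \<in> {0..1} \<Longrightarrow> h' (t,0) = x \<and> h' (t,1) = x"
    using assms unfolding loop_homotopic_def by blast
  let ?h = "\<lambda>z. if fst z - 1/2 \<le> 0 then h (2 * fst z, snd z) else h' (2 * fst z - 1, snd z)"
  have "continuous_map (prod_topology ?I ?I) X ?h"
  proof (rule continuous_map_square_case[OF h(1) h'(1)])
    fix z :: "real \<times> real" assume z: "z \<in> {0..1} \<times> {0..1}" "fst z - 1/2 = 0"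
    then have "2 * fst z = 1" "2 * fst z - 1 = 0" "snd z \<in> {0..1}" by (auto simp: mem_Times_iff)
    then show "h (2 * fst z, snd z) = h' (2 * fst z - 1, snd z)" using h(2) h'(2) by simp
  qed (auto intro!: continuous_intros)
  then show ?thesis unfolding loop_homotopic_def using h(2,3) h'(2,3)
    by (intro exI[of _ ?h]) auto
qed

lemma loop_homotopic_concat:
  assumes "loop_homotopic X x p p'" "loop_homotopic X x q q'"
  shows "loop_homotopic X x (path_concat p q) (path_concat p' q')"
proof -
  let ?I = "top_of_set {0..1::real}"
  obtain h where h: "continuous_map (prod_topology ?I ?I) X h"
    "\<And>s. s \<in> {0..1} \<Longrightarrow> h (0,s) = p s \<and> h (1,s) = p' s"
    "\<And>t. t \<in> {0..1} \<Longrightarrow> h (t,0) = x \<and> h (t,1) = x"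
    using assms unfolding loop_homotopic_def by blast
  obtain h' where h': "continuous_map (prod_topology ?I ?I) X h'"
    "\<And>s. s \<in> {0..1} \<Longrightarrow> h' (0,s) = q s \<and> h' (1,s) = q' s"
    "\<And>t. t \<in> {0..1} \<Longrightarrow> h' (t,0) = x \<and> h' (t,1) = x"
    using assms unfolding loop_homotopic_def by blast
  let ?h = "\<lambda>z. if snd z - 1/2 \<le> 0 then h (fst z, 2 * snd z) else h' (fst z, 2 * snd z - 1)"
  have "continuous_map (prod_topology ?I ?I) X ?h"
  proof (rule continuous_map_square_case[OF h(1) h'(1)])
    fix z :: "real \<times> real" assume z: "z \<in> {0..1} \<times> {0..1}" "snd z - 1/2 = 0"
    then have "2 * snd z = 1" "2 * snd z - 1 = 0" "fst z \<in> {0..1}" by (auto simp: mem_Times_iff)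
    then show "h (fst z, 2 * snd z) = h' (fst z, 2 * snd z - 1)" using h(3) h'(3) by simp
  qed (auto intro!: continuous_intros)
  then show ?thesis unfolding loop_homotopic_def path_concat_def using h(2,3) h'(2,3)
    by (intro exI[of _ ?h]) auto
qed

abbreviation loop_class :: "'a topology \<Rightarrow> 'a \<Rightarrow> (real \<Rightarrow> 'a) \<Rightarrow> (real \<Rightarrow> 'a) set" where
  "loop_class X x p \<equiv> loop_rel X x `` {p}"

lemma in_loop_class: "q \<in> loop_class X x p \<longleftrightarrow> p \<in> loops X x \<and> q \<in> loops X x \<and> loop_homotopic X x p q"
  by (auto simp: loop_rel_def)

lemma loop_class_self:
  assumes "p \<in> loops X x"
  shows "p \<in> loop_class X x p"
  unfolding in_loop_class using assms loop_homotopic_refl[OF assms] by simp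

lemma loop_class_eq:
  assumes "p \<in> loops X x" "q \<in> loops X x"
  shows "loop_class X x p = loop_class X x q \<longleftrightarrow> loop_homotopic X x p q"
proof
  assume "loop_class X x p = loop_class X x q"
  then show "loop_homotopic X x p q" using loop_class_self[OF assms(2)] in_loop_class by metis
next
  assume pq: "loop_homotopic X x p q"
  show "loop_class X x p = loop_class X x q"
    using assms pq loop_homotopic_trans loop_homotopic_sym unfolding set_eq_iff in_loop_class by metis
qed

lemma carrier_fundamental_group: "carrier (fundamental_group X x) = loop_class X x ` loops X x"
  by (auto simp: fundamental_group_def quotient_def)

lemma loop_class_rep:
  assumes "p \<in> loops X x"
  shows "(SOME q. q \<in> loop_class X x p) \<in> loops X x" "loop_homotopic X x p (SOME q. q \<in> loop_class X x p)"
  using someI[of "\<lambda>q. q \<in> loop_class X x p", OF loop_class_self[OF assms]] in_loop_class by metis+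

lemma mult_fundamental_group:
  assumes "p \<in> loops X x" "q \<in> loops X x"
  shows "loop_class X x p \<otimes>\<^bsub>fundamental_group X x\<^esub> loop_class X x q = loop_class X x (path_concat p q)"
proof -
  have "loop_class X x p \<otimes>\<^bsub>fundamental_group X x\<^esub> loop_class X x q
      = loop_class X x (path_concat (SOME p'. p' \<in> loop_class X x p) (SOME q'. q' \<in> loop_class X x q))"
    by (simp add: fundamental_group_def)
  also have "\<dots> = loop_class X x (path_concat p q)"
    using loop_class_rep[OF assms(1)] loop_class_rep[OF assms(2)] assms
    by (subst loop_class_eq) (auto intro: path_concat_in_loops loop_homotopic_concat loop_homotopic_sym)
  finally show ?thesis .
qed

text \<open>Powers begin with a loop \<open>e\<close> because a homomorphism sends the class of the
  constant loop to the class of some loop \<open>e\<close>. With \<open>e = p\<close> the counting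
  starts at the first power.\<close>

primrec loop_power :: "(real \<Rightarrow> 'a) \<Rightarrow> (real \<Rightarrow> 'a) \<Rightarrow> nat \<Rightarrow> real \<Rightarrow> 'a" where
  "loop_power e p 0 = e"
| "loop_power e p (Suc k) = path_concat (loop_power e p k) p"

lemma loop_power_in_loops: "e \<in> loops X x \<Longrightarrow> p \<in> loops X x \<Longrightarrow> loop_power e p k \<in> loops X x"
  by (induction k) (auto intro: path_concat_in_loops)

section \<open>Holonomy of powers and of torsion loops\<close>

context local_system
begin

lemma hol_loop_concat:
  assumes "p \<in> loops X x" "q \<in> loops X x" "f \<in> E x"
  shows "hol (path_concat p q) f = hol q (hol p f)"
  using hol_path_concat[of p q f] path_concat_in_loops[OF assms(1,2)] loopsD[OF assms(1)] loopsD[OF assms(2)] assms(3)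
  by (auto dest: loopsD(1))

lemma hol_loop_in: "p \<in> loops X x \<Longrightarrow> f \<in> E x \<Longrightarrow> hol p f \<in> E x"
  using hol_in loopsD by metis

lemma hol_loop_power:
  assumes "e \<in> loops X x" "p \<in> loops X x" "f \<in> E x"
  shows "hol (loop_power e p k) f = (hol p ^^ k) (hol e f)"
  by (induction k) (simp_all add: hol_loop_concat[OF loop_power_in_loops[OF assms(1,2)] assms(2,3)])

lemma hol_inj:
  assumes p: "p \<in> loops X x" and f: "f \<in> E x" "f' \<in> E x" "hol p f = hol p f'"
  shows "f = f'"
proof -
  obtain F where F: "flat {0..1} p F" "F 0 = f" using flat_path[of p f] loopsD[OF p] f by metis
  obtain F' where F': "flat {0..1} p F'" "F' 0 = f'" using flat_path[of p f'] loopsD[OF p] f by metis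
  have "F 1 = F' 1" using hol_eq[OF F(1)] hol_eq[OF F'(1)] F F' f(3) by simp
  then have "F 0 = F' 0" using flat_unique[OF _ F(1) F'(1), of 1 0] by auto
  then show ?thesis using F F' by simp
qed

text \<open>An injective idempotent map is the identity.\<close>

lemma hol_idempotent:
  assumes e: "e \<in> loops X x" and i: "loop_homotopic X x (path_concat e e) e" and f: "f \<in> E x"
  shows "hol e f = f"
proof -
  have "hol e (hol e f) = hol (path_concat e e) f" using hol_loop_concat[OF e e f] by simp
  also have "\<dots> = hol e f"
    by (rule hol_homotopic[OF i _ f]) (use loopsD[OF path_concat_in_loops[OF e e]] in simp)
  finally show ?thesis using hol_inj[OF e hol_loop_in[OF e f] f] by simp
qed

lemma hol_torsion:
  assumes e: "e \<in> loops X x" and i: "loop_homotopic X x (path_concat e e) e"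
    and p: "p \<in> loops X x" "loop_homotopic X x (loop_power e p K) e" and f: "f \<in> E x"
  shows "(hol p ^^ K) f = f"
proof -
  have "(hol p ^^ K) f = hol (loop_power e p K) f"
    using hol_loop_power[OF e p(1) f] hol_idempotent[OF e i f] by simp
  also have "\<dots> = hol e f"
    by (rule hol_homotopic[OF p(2) _ f]) (use loopsD[OF loop_power_in_loops[OF e p(1)]] in simp)
  finally show ?thesis using hol_idempotent[OF e i f] by simp
qed

end

text \<open>The loop \<open>e\<close> represents the image of the unit. That it is idempotent already makes its holonomy
  trivial, so the group axioms for the fundamental group are not needed.\<close>

lemma section_loops:
  assumes s: "s \<in> hom (fundamental_group X x) (fundamental_group Y y)"
    and x: "x \<in> topspace X" and p: "p \<in> loops X x"
  obtains \<gamma> e where "\<gamma> \<in> loops Y y" "\<gamma> = (SOME q. q \<in> s (loop_class X x p))" "s (loop_class X x p) = loop_class Y y \<gamma>"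
    "e \<in> loops Y y" "loop_homotopic Y y (path_concat e e) e"
    "\<And>K. loop_homotopic X x (loop_power (\<lambda>_. x) p K) (\<lambda>_. x) \<Longrightarrow> loop_homotopic Y y (loop_power e \<gamma> K) e"
proof -
  let ?G = "fundamental_group X x" and ?H = "fundamental_group Y y"
  have c: "loop_class X x q \<in> carrier ?G" if "q \<in> loops X x" for q
    using that by (simp add: carrier_fundamental_group)
  have img: "\<exists>q'. q' \<in> loops Y y \<and> s (loop_class X x q) = loop_class Y y q'" if "q \<in> loops X x" for q
    using hom_in_carrier[OF s c[OF that]] by (auto simp: carrier_fundamental_group)
  define \<gamma> where "\<gamma> = (SOME q. q \<in> s (loop_class X x p))"
  obtain q' where q': "q' \<in> loops Y y" "s (loop_class X x p) = loop_class Y y q'" using img[OF p] by blast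
  have \<gamma>: "\<gamma> \<in> loops Y y" "s (loop_class X x p) = loop_class Y y \<gamma>"
    using loop_class_rep[OF q'(1)] loop_class_eq[OF q'(1)] q'(2) unfolding \<gamma>_def by auto
  have const: "(\<lambda>_. x) \<in> loops X x" by (rule const_in_loops[OF x])
  obtain e where e: "e \<in> loops Y y" "s (loop_class X x (\<lambda>_. x)) = loop_class Y y e" using img[OF const] by blast
  have "loop_class Y y (path_concat e e) = s (loop_class X x (\<lambda>_. x)) \<otimes>\<^bsub>?H\<^esub> s (loop_class X x (\<lambda>_. x))"
    unfolding e(2) by (rule mult_fundamental_group[OF e(1) e(1), symmetric])
  also have "\<dots> = s (loop_class X x (\<lambda>_. x) \<otimes>\<^bsub>?G\<^esub> loop_class X x (\<lambda>_. x))"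
    using s c[OF const] by (simp add: hom_def)
  also have "\<dots> = loop_class Y y e" using e(2) by (simp add: mult_fundamental_group[OF const const] path_concat_const)
  finally have idem: "loop_homotopic Y y (path_concat e e) e"
    using loop_class_eq[OF path_concat_in_loops[OF e(1) e(1)] e(1)] by simp
  have pow: "s (loop_class X x (loop_power (\<lambda>_. x) p K)) = loop_class Y y (loop_power e \<gamma> K)" for K
  proof (induction K)
    case (Suc K)
    note pk = loop_power_in_loops[OF const p, of K]
    have "s (loop_class X x (loop_power (\<lambda>_. x) p (Suc K)))
        = s (loop_class X x (loop_power (\<lambda>_. x) p K) \<otimes>\<^bsub>?G\<^esub> loop_class X x p)"
      by (simp add: mult_fundamental_group[OF pk p])
    also have "\<dots> = s (loop_class X x (loop_power (\<lambda>_. x) p K)) \<otimes>\<^bsub>?H\<^esub> s (loop_class X x p)"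
      using s c[OF pk] c[OF p] by (simp add: hom_def)
    also have "\<dots> = loop_class Y y (loop_power e \<gamma> (Suc K))"
      unfolding Suc \<gamma>(2) by (simp add: mult_fundamental_group[OF loop_power_in_loops[OF e(1) \<gamma>(1)] \<gamma>(1)])
    finally show ?case .
  qed (simp add: e)
  show ?thesis
  proof (rule that[OF \<gamma>(1) \<gamma>_def \<gamma>(2) e(1) idem])
    fix K assume "loop_homotopic X x (loop_power (\<lambda>_. x) p K) (\<lambda>_. x)"
    then have "loop_class X x (loop_power (\<lambda>_. x) p K) = loop_class X x (\<lambda>_. x)"
      using loop_class_eq[OF loop_power_in_loops[OF const p] const] by simp
    then have "loop_class Y y (loop_power e \<gamma> K) = loop_class Y y e" using pow[of K] e(2) by simp
    then show "loop_homotopic Y y (loop_power e \<gamma> K) e"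
      using loop_class_eq[OF loop_power_in_loops[OF e(1) \<gamma>(1)] e(1)] by simp
  qed
qed

section \<open>Holonomy of lifts\<close>

text \<open>A continuous choice of lifts is parallel, since \<open>nearest\<close> recovers it at
  nearby times. This makes the holonomy of an explicit motion computable.\<close>

lemma lifts_hol_continuous:
  assumes p: "pathin (unordered_conf RP2 n) p" and v: "continuous_on {0..1} v"
    and vp: "\<And>t. t \<in> {0..1} \<Longrightarrow> v t \<in> \<Union>(p t)"
  shows "lifts.hol n p (v 0) = v 1"
proof (rule lifts.hol_eq)
  show "lifts.flat n {0..1} p v" unfolding lifts.flat_def
  proof (intro ballI conjI)
    fix k :: real assume k: "k \<in> {0..1}"
    then show top: "p k \<in> topspace (unordered_conf RP2 n)" using p by (auto simp: pathin_def continuous_map_def)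
    show "v k \<in> \<Union>(p k)" using vp k .
    note t = topspace_unordered_conf[OF top]
    have fin: "finite (\<Union>(p k))" using finite_lifts t by blast
    note r = sep_radius[OF fin]
    obtain T where T: "open T" "k \<in> T" "\<And>k'. k' \<in> {0..1} \<inter> T \<Longrightarrow> p k' \<in> lift_nbhd n (p k)"
      using continuous_map_nbhd[OF p[unfolded pathin_def] lifts.open_U[OF top] k lifts.centre_U[OF top]] by metis
    have "v k \<in> ball (v k) (sep_radius (\<Union>(p k)))" using r by simp
    then obtain T' where T': "open T'" "k \<in> T'" "\<forall>k'\<in>{0..1}. k' \<in> T' \<longrightarrow> v k' \<in> ball (v k) (sep_radius (\<Union>(p k)))"
      using v[unfolded continuous_on_topological, rule_format, OF k open_ball] by blast
    have "lift_map (p k) (p k') (v k') = v k" if "k' \<in> {0..1} \<inter> T'" for k'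
      unfolding lift_map_def by (rule nearest_eq[OF r(2) vp[OF k]]) (use T'(3) that in simp)
    then show "\<exists>T. open T \<and> k \<in> T \<and> (\<forall>k'\<in>{0..1} \<inter> T. p k' \<in> lift_nbhd n (p k) \<and> lift_map (p k) (p k') (v k') = v k)"
      using T T' by (intro exI[of _ "T \<inter> T'"]) auto
  qed
qed

context
  fixes n m :: nat and \<gamma> :: "real \<Rightarrow> (real^3) set set \<times> (real^3) set set" and x0
  assumes \<gamma>: "pathin (coloured_conf RP2 n m) \<gamma>" "\<gamma> 0 = x0" "\<gamma> 1 = x0"
begin

lemma points_hol_minus:
  assumes v: "v \<in> all_lifts x0"
  shows "points.hol n m \<gamma> (- v) = - points.hol n m \<gamma> v"
proof -
  have x0: "x0 \<in> topspace (coloured_conf RP2 n m)" using \<gamma> by (auto simp: pathin_def continuous_map_def)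
  have v': "- v \<in> all_lifts x0" by (rule all_lifts(8)[OF x0 v])
  show ?thesis
  proof (rule points.hol_invariant[OF \<gamma>(1), where Q = "\<lambda>_ v w _. w = - v" and ?f3.0 = v])
    fix x y v w u assume xy: "x \<in> topspace (coloured_conf RP2 n m)" "y \<in> frame_nbhd n m x"
      and vw: "v \<in> all_lifts y" "w \<in> all_lifts y"
    show "near_lift x w = - near_lift x v \<longleftrightarrow> w = - v"
      using near_lift_minus[OF xy vw(1)] near_lift_inj[OF xy vw(2) all_lifts(8)[OF frame_nbhd_top[OF xy] vw(1)]] by simp
  qed (use v v' \<gamma> in auto)
qed

lemma points_hol_fst_iff:
  assumes v: "v \<in> all_lifts x0"
  shows "points.hol n m \<gamma> v \<in> \<Union>(fst x0) \<longleftrightarrow> v \<in> \<Union>(fst x0)"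
proof -
  have "(points.hol n m \<gamma> v \<in> \<Union>(fst (\<gamma> 1))) = (v \<in> \<Union>(fst x0))"
    by (rule points.hol_invariant[OF \<gamma>(1), where Q = "\<lambda>x w _ _. (w \<in> \<Union>(fst x)) = (v \<in> \<Union>(fst x0))" and ?f3.0 = v and ?f2.0 = v])
      (use v \<gamma> near_lift_fst_iff in auto)
  then show ?thesis using \<gamma> by simp
qed

text \<open>Naturality under forgetting the new points: a parallel lift of an old point along
  \<gamma> is also parallel along the projected braid.\<close>

lemma points_hol_lifts:
  assumes p: "pathin (unordered_conf RP2 n) (fst \<circ> \<gamma>)" and v: "v \<in> \<Union>(fst x0)"
  shows "points.hol n m \<gamma> v = lifts.hol n (fst \<circ> \<gamma>) v"
proof -
  have "v \<in> all_lifts (\<gamma> 0)" using v \<gamma> by (auto simp: all_lifts_def)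
  then obtain F where F: "points.flat n m {0..1} \<gamma> F" "F 0 = v" using points.flat_path[OF \<gamma>(1)] by metis
  have F_in: "F t \<in> \<Union>(fst (\<gamma> t))" if t: "t \<in> {0..1}" for t
    by (rule points.flat_invariant[where K = "{0..1}" and a = 0 and h = \<gamma> and Q = "\<lambda>x w _ _. w \<in> \<Union>(fst x)", OF _ F(1) F(1) F(1)])
      (use near_lift_fst_iff t F v \<gamma> in auto)
  have "lifts.flat n {0..1} (fst \<circ> \<gamma>) F" unfolding lifts.flat_def
  proof (intro ballI conjI)
    fix k :: real assume k: "k \<in> {0..1}"
    then show top: "(fst \<circ> \<gamma>) k \<in> topspace (unordered_conf RP2 n)" using p by (auto simp: pathin_def continuous_map_def)
    show "F k \<in> \<Union>((fst \<circ> \<gamma>) k)" using F_in[OF k] by simp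
    have topk: "\<gamma> k \<in> topspace (coloured_conf RP2 n m)" using points.flatD[OF F(1) k] by simp
    obtain T where T: "open T" "k \<in> T" "\<And>k'. k' \<in> {0..1} \<Longrightarrow> k' \<in> T \<Longrightarrow>
        \<gamma> k' \<in> frame_nbhd n m (\<gamma> k) \<and> near_lift (\<gamma> k) (F k') = F k"
      using points.flat_nbhd[OF F(1) k] by metis
    have "(fst \<circ> \<gamma>) k' \<in> lift_nbhd n ((fst \<circ> \<gamma>) k) \<and> lift_map ((fst \<circ> \<gamma>) k) ((fst \<circ> \<gamma>) k') (F k') = F k"
      if k': "k' \<in> {0..1}" "k' \<in> T" for k'
    proof
      note n = T(3)[OF k']
      have "close_to (frame_radius (\<gamma> k)) (\<Union>(fst (\<gamma> k))) (\<Union>(fst (\<gamma> k')))" using n by (simp add: frame_nbhd_def)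
      then have "close_to (sep_radius (\<Union>(fst (\<gamma> k)))) (\<Union>(fst (\<gamma> k))) (\<Union>(fst (\<gamma> k')))"
        using close_to_mono frame_radius(2)[OF topk] by blast
      moreover have "(fst \<circ> \<gamma>) k' \<in> topspace (unordered_conf RP2 n)"
        using p k' by (auto simp: pathin_def continuous_map_def)
      ultimately show "(fst \<circ> \<gamma>) k' \<in> lift_nbhd n ((fst \<circ> \<gamma>) k)" by (simp add: lift_nbhd_def)
      show "lift_map ((fst \<circ> \<gamma>) k) ((fst \<circ> \<gamma>) k') (F k') = F k"
        using near_lift_fst(2)[OF topk conjunct1[OF n] F_in[OF k'(1)]] n by simp
    qed
    then show "\<exists>T. open T \<and> k \<in> T \<and> (\<forall>k'\<in>{0..1} \<inter> T. (fst \<circ> \<gamma>) k' \<in> lift_nbhd n ((fst \<circ> \<gamma>) k) \<and>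
        lift_map ((fst \<circ> \<gamma>) k) ((fst \<circ> \<gamma>) k') (F k') = F k)"
      using T by blast
  qed
  from lifts.hol_eq[OF this] points.hol_eq[OF F(1)] F(2) show ?thesis by simp
qed

end

section \<open>Rotations of the equatorial configuration\<close>

text \<open>The laws of concatenation are reparametrisations: they hold in the interval and are
  pushed forward along \<open>p\<close>, into any topological space.\<close>

lemma homotopic_paths_push:
  fixes p :: "real \<Rightarrow> 'a::topological_space"
  assumes p: "path p" "path_image p \<subseteq> S" and g: "homotopic_paths {0..1} g h"
  shows "homotopic_paths S (p \<circ> g) (p \<circ> h)"
  by (rule homotopic_paths_continuous_image[OF g]) (use p in \<open>auto simp: path_def path_image_def\<close>)

lemma compose_joinpaths: "p \<circ> (g +++ h) = (p \<circ> g) +++ (p \<circ> h)"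
  by (auto simp: joinpaths_def)

lemma linepath_01: "linepath 0 1 = (\<lambda>t::real. t)" "linepath a a = (\<lambda>t. a)" for a :: real
  by (auto simp: linepath_def algebra_simps)

lemma homotopic_paths_join_const:
  fixes p :: "real \<Rightarrow> 'a::topological_space"
  assumes p: "path p" "path_image p \<subseteq> S"
  shows "homotopic_paths S (p +++ (\<lambda>_. p 1)) p" and "homotopic_paths S ((\<lambda>_. p 0) +++ p) p"
    and "homotopic_paths S (p +++ reversepath p) (\<lambda>_. p 0)"
    and "homotopic_paths S (reversepath p +++ p) (\<lambda>_. p 1)"
proof -
  let ?l = "linepath 0 (1::real)"
  have l: "path ?l" "path_image ?l \<subseteq> {0..1}" by (auto simp: closed_segment_eq_real_ivl)
  note push = homotopic_paths_push[OF p]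
  have c: "p \<circ> (\<lambda>t. t) = p" "p \<circ> (\<lambda>t. a) = (\<lambda>_. p a)" for a by auto
  have r: "p \<circ> reversepath (\<lambda>t. t) = reversepath p" by (auto simp: reversepath_def)
  show "homotopic_paths S (p +++ (\<lambda>_. p 1)) p"
    using push[OF homotopic_paths_rid[OF l]] by (simp add: compose_joinpaths linepath_01 c pathfinish_def pathstart_def)
  show "homotopic_paths S ((\<lambda>_. p 0) +++ p) p"
    using push[OF homotopic_paths_lid[OF l]] by (simp add: compose_joinpaths linepath_01 c pathfinish_def pathstart_def)
  show "homotopic_paths S (p +++ reversepath p) (\<lambda>_. p 0)"
    using push[OF homotopic_paths_rinv[OF l]] by (simp add: compose_joinpaths linepath_01 c r pathfinish_def pathstart_def)
  show "homotopic_paths S (reversepath p +++ p) (\<lambda>_. p 1)"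
    using push[OF homotopic_paths_linv[OF l]] by (simp add: compose_joinpaths linepath_01 c r pathfinish_def pathstart_def)
qed

text \<open>The reversed path meets the path itself and cancels; this telescopes the powers of a
  conjugated rotation below.\<close>

lemma homotopic_paths_cancel:
  fixes a q r w :: "real \<Rightarrow> 'a::topological_space"
  assumes p: "path a" "path_image a \<subseteq> S" "path q" "path_image q \<subseteq> S" "path r" "path_image r \<subseteq> S"
      "path w" "path_image w \<subseteq> S"
    and e: "pathfinish a = pathfinish q" "pathfinish q = pathstart r" "pathfinish r = pathstart w"
  shows "homotopic_paths S ((a +++ reversepath q) +++ ((q +++ r) +++ w)) ((a +++ r) +++ w)"
proof -
  let ?Y = "reversepath q"
  have Y: "path ?Y" "path_image ?Y \<subseteq> S" "path (q +++ r)" "path_image (q +++ r) \<subseteq> S"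
    "path (a +++ ?Y)" "path_image (a +++ ?Y) \<subseteq> S"
    using p e by (auto simp: path_image_join)
  have "homotopic_paths S ((a +++ ?Y) +++ ((q +++ r) +++ w)) (((a +++ ?Y) +++ (q +++ r)) +++ w)"
    by (rule homotopic_paths_assoc) (use p e Y in auto)
  also have "homotopic_paths S \<dots> ((a +++ r) +++ w)"
  proof (rule homotopic_paths_join)
    have "homotopic_paths S ((a +++ ?Y) +++ (q +++ r)) (a +++ (?Y +++ (q +++ r)))"
      by (rule homotopic_paths_sym, rule homotopic_paths_assoc) (use p e Y in auto)
    also have "homotopic_paths S \<dots> (a +++ ((?Y +++ q) +++ r))"
      by (rule homotopic_paths_join, simp add: p, rule homotopic_paths_assoc) (use p e Y in auto)
    also have "homotopic_paths S \<dots> (a +++ ((\<lambda>_. r 0) +++ r))"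
    proof (rule homotopic_paths_join)
      have "q 1 = r 0" using e by (simp add: pathfinish_def pathstart_def)
      then show "homotopic_paths S ((?Y +++ q) +++ r) ((\<lambda>_. r 0) +++ r)"
        using homotopic_paths_join_const(4)[OF p(3,4)] p e
        by (intro homotopic_paths_join) auto
    qed (use p e in auto)
    also have "homotopic_paths S \<dots> (a +++ r)"
      by (rule homotopic_paths_join, simp add: p, rule homotopic_paths_join_const(2)) (use p e in \<open>auto simp: pathstart_def joinpaths_def\<close>)
    finally show "homotopic_paths S ((a +++ ?Y) +++ (q +++ r)) (a +++ r)" .
  qed (use p e in auto)
  finally show ?thesis .
qed

text \<open>Ordered configurations of lifts, a covering space of the unordered ones, in which
  explicit homotopies can be written down. The value 0 beyond \<open>n\<close> makes each lifted
  configuration a unique function.\<close>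

definition lifted_conf :: "nat \<Rightarrow> (nat \<Rightarrow> real^3) set" where
  "lifted_conf n = {f. (\<forall>i<n. norm (f i) = 1) \<and> (\<forall>i<n. \<forall>j<n. i \<noteq> j \<longrightarrow> f i \<noteq> f j \<and> f i \<noteq> - f j) \<and> (\<forall>i\<ge>n. f i = 0)}"

definition proj_conf :: "nat \<Rightarrow> (nat \<Rightarrow> real^3) \<Rightarrow> (real^3) set set" where
  "proj_conf n f = (\<lambda>i. {f i, - f i}) ` {..<n}"

lemma continuous_proj_conf: "continuous_map (top_of_set (lifted_conf n)) (unordered_conf RP2 n) (proj_conf n)"
proof -
  let ?r = "\<lambda>f::nat \<Rightarrow> real^3. restrict (\<lambda>i. {f i, - f i}) {..<n}"
  have "continuous_map (top_of_set (lifted_conf n)) RP2 (\<lambda>f. {f i, - f i})" if i: "i < n" for i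
  proof -
    have "continuous_map (top_of_set (lifted_conf n)) (top_of_set (sphere 0 1)) (\<lambda>f. f i)"
      using i by (auto simp: lifted_conf_def intro!: continuous_on_product_then_coordinatewise[OF continuous_on_id])
    from continuous_map_compose[OF this continuous_map_quotient_topology]
    show ?thesis by (simp add: RP2_def comp_def)
  qed
  then have "continuous_map (top_of_set (lifted_conf n)) (product_topology (\<lambda>_. RP2) {..<n}) ?r"
    by (auto simp: continuous_map_componentwise)
  moreover have "inj_on (?r f) {..<n}" if "f \<in> lifted_conf n" for f
    using that by (auto simp: lifted_conf_def inj_on_def doubleton_eq_iff)
  ultimately have "continuous_map (top_of_set (lifted_conf n)) (ordered_conf RP2 n) ?r"
    unfolding ordered_conf_def by (auto simp: continuous_map_in_subtopology)
  from continuous_map_compose[OF this continuous_map_quotient_topology]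
  have "continuous_map (top_of_set (lifted_conf n)) (unordered_conf RP2 n) ((\<lambda>f. f ` {..<n}) \<circ> ?r)"
    unfolding unordered_conf_def .
  moreover have "(\<lambda>f. f ` {..<n}) \<circ> ?r = proj_conf n" by (auto simp: proj_conf_def)
  ultimately show ?thesis by simp
qed

text \<open>Upstairs the end points may differ, as long as both lie over \<open>A\<close>;
  homotopies of paths then become homotopies of loops.\<close>

lemma homotopic_loops_proj:
  assumes h: "homotopic_paths (lifted_conf n) g g'" and "proj_conf n (pathstart g) = A" "proj_conf n (pathfinish g) = A"
  shows "loop_homotopic (unordered_conf RP2 n) A (proj_conf n \<circ> g) (proj_conf n \<circ> g')"
proof -
  obtain H :: "real \<times> real \<Rightarrow> nat \<Rightarrow> real^3" where H: "continuous_on ({0..1} \<times> {0..1}) H" "H \<in> ({0..1} \<times> {0..1}) \<rightarrow> lifted_conf n"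
    "\<forall>x\<in>{0..1}. H (0,x) = g x" "\<forall>x\<in>{0..1}. H (1,x) = g' x"
    "\<forall>t\<in>{0..1}. pathstart (H \<circ> Pair t) = pathstart g \<and> pathfinish (H \<circ> Pair t) = pathfinish g"
    using h unfolding homotopic_paths by blast
  have "continuous_map (prod_topology (top_of_set {0..1::real}) (top_of_set {0..1::real})) (top_of_set (lifted_conf n)) H"
    unfolding unit_square_topology using H(1,2) by auto
  from continuous_map_compose[OF this continuous_proj_conf]
  show ?thesis unfolding loop_homotopic_def using H(3-5) assms(2,3)
    by (intro exI[of _ "proj_conf n \<circ> H"]) (auto simp: pathstart_def pathfinish_def)
qed

lemma proj_loop:
  assumes "path g" "path_image g \<subseteq> lifted_conf n" "proj_conf n (pathstart g) = A" "proj_conf n (pathfinish g) = A"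
  shows "proj_conf n \<circ> g \<in> loops (unordered_conf RP2 n) A"
proof -
  have "continuous_map (top_of_set {0..1}) (top_of_set (lifted_conf n)) g"
    using assms by (auto simp: path_def path_image_def)
  from continuous_map_compose[OF this continuous_proj_conf]
  show ?thesis using assms by (auto simp: loops_def pathin_def pathstart_def pathfinish_def)
qed

text \<open>The effect of rotating by \<open>pi / k\<close>: each equatorial point reaches the next
  position, the last one the antipode of the first, and the pole stays. It is a deck transformation,
  as it only permutes the lines.\<close>

definition signed_shift :: "nat \<Rightarrow> (nat \<Rightarrow> real^3) \<Rightarrow> nat \<Rightarrow> real^3" where
  "signed_shift k f i = (if i + 1 < k then f (i + 1) else if i + 1 = k then - f 0 else f i)"

lemma signed_shift_in:
  assumes k: "0 < k" "k \<le> n" and f: "f \<in> lifted_conf n"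
  shows "signed_shift k f \<in> lifted_conf n"
proof -
  have "signed_shift k f i \<noteq> signed_shift k f j \<and> signed_shift k f i \<noteq> - signed_shift k f j"
    if "i < n" "j < n" "i \<noteq> j" for i j
  proof -
    define \<rho> where "\<rho> i = (if i + 1 < k then i + 1 else if i + 1 = k then 0 else i)" for i
    have "\<rho> i \<noteq> \<rho> j" "\<rho> i < n" "\<rho> j < n" using that k by (auto simp: \<rho>_def)
    then have ne: "f (\<rho> i) \<noteq> f (\<rho> j)" "f (\<rho> i) \<noteq> - f (\<rho> j)" using f by (auto simp: lifted_conf_def)
    have "signed_shift k f i = f (\<rho> i) \<or> signed_shift k f i = - f (\<rho> i)" for i
      by (auto simp: signed_shift_def \<rho>_def)
    with ne show ?thesis by (metis minus_minus)
  qed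
  then show ?thesis using k f unfolding lifted_conf_def by (auto simp: signed_shift_def)
qed

lemma continuous_signed_shift: "continuous_on S (signed_shift k)"
proof (rule continuous_on_coordinatewise_then_product)
  fix i
  have c: "continuous_on S (\<lambda>f::nat \<Rightarrow> real^3. f j)" for j
    by (rule continuous_on_product_then_coordinatewise[OF continuous_on_id])
  show "continuous_on S (\<lambda>f. signed_shift k f i)"
    unfolding signed_shift_def by (intro continuous_on_if_const continuous_intros c)
qed

lemma proj_signed_shift:
  assumes k: "0 < k" "k \<le> n"
  shows "proj_conf n (signed_shift k f) = proj_conf n f"
proof -
  define \<rho> where "\<rho> i = (if i + 1 < k then i + 1 else if i + 1 = k then 0 else i)" for i
  have eq: "{signed_shift k f i, - signed_shift k f i} = {f (\<rho> i), - f (\<rho> i)}" for i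
    by (auto simp: signed_shift_def \<rho>_def)
  have "\<rho> ` {..<n} = {..<n}"
  proof (intro equalityI subsetI)
    fix j assume "j \<in> {..<n}"
    moreover have "j = \<rho> (if j = 0 then k - 1 else if j < k then j - 1 else j)" using k by (auto simp: \<rho>_def)
    ultimately show "j \<in> \<rho> ` {..<n}" using k by (intro image_eqI[of _ _ "if j = 0 then k - 1 else if j < k then j - 1 else j"]) auto
  qed (use k in \<open>auto simp: \<rho>_def\<close>)
  then have "proj_conf n f = (\<lambda>i. {f i, - f i}) ` \<rho> ` {..<n}" by (simp add: proj_conf_def)
  then show ?thesis unfolding proj_conf_def eq by (simp add: image_image)
qed

lemma signed_shift_pow:
  assumes "j \<le> k"
  shows "(signed_shift k ^^ j) f i = (if i \<ge> k then f i else if i + j < k then f (i + j) else - f (i + j - k))"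
  using assms
proof (induction j arbitrary: i)
  case (Suc j)
  have "(signed_shift k ^^ Suc j) f i = signed_shift k ((signed_shift k ^^ j) f) i" by simp
  also have "\<dots> = (if i \<ge> k then f i else if i + Suc j < k then f (i + Suc j) else - f (i + Suc j - k))"
    unfolding signed_shift_def[of k "(signed_shift k ^^ j) f"] using Suc
    by (auto intro!: arg_cong[of _ _ f])
  finally show ?case .
qed simp

text \<open>The power \<open>k\<close> negates the moving points, so \<open>2 * k\<close> is already
  a period; the exponent \<open>4 * k\<close> is the one at which the angle reaches
  \<open>4 * pi\<close>.\<close>

lemma signed_shift_period: "signed_shift k ^^ (4 * k) = id"
proof -
  have k: "(signed_shift k ^^ k) f i = (if i \<ge> k then f i else - f i)" for f i
    using signed_shift_pow[of k k f i] by auto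
  have "(signed_shift k ^^ (k + k)) f = f" for f unfolding funpow_add comp_def by (auto simp: k)
  then have "signed_shift k ^^ (k + k) = id" by auto
  then have "signed_shift k ^^ ((k + k) + (k + k)) = id" by (simp only: funpow_add) simp
  moreover have "4 * k = (k + k) + (k + k)" by simp
  ultimately show ?thesis by (simp only:)
qed

text \<open>Conjugation of the imaginary quaternion \<open>v\<close> by the unit quaternion \<open>q\<close>.\<close>

definition quat_rot :: "real \<times> (real^3) \<Rightarrow> real^3 \<Rightarrow> real^3" where
  "quat_rot q v = ((fst q)\<^sup>2 - snd q \<bullet> snd q) *\<^sub>R v + (2 * (snd q \<bullet> v)) *\<^sub>R snd q + (2 * fst q) *\<^sub>R cross3 (snd q) v"

text \<open>The squared length comes out as \<open>(a\<^sup>2 + u \<bullet> u)\<^sup>2\<close> times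
  that of \<open>v\<close>: multiplicativity of the quaternion norm.\<close>

lemma norm_quat_rot:
  assumes "norm q = 1"
  shows "norm (quat_rot q v) = norm v"
proof -
  obtain a u where q: "q = (a, u)" by (cases q)
  have au: "a\<^sup>2 + u \<bullet> u = 1" using assms by (simp add: q norm_Pair power2_norm_eq_inner)
  have cr: "cross3 u v \<bullet> cross3 u v = (u \<bullet> u) * (v \<bullet> v) - (u \<bullet> v)\<^sup>2"
    using norm_cross_dot[of u v] by (simp add: power_mult_distrib power2_norm_eq_inner algebra_simps)
  have o: "v \<bullet> cross3 u v = 0" "u \<bullet> cross3 u v = 0" "cross3 u v \<bullet> v = 0" "cross3 u v \<bullet> u = 0"
    by (simp_all add: dot_cross_self)
  let ?b = "a\<^sup>2 - u \<bullet> u" and ?c = "2 * (u \<bullet> v)"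
  have "quat_rot q v \<bullet> quat_rot q v
      = ?b\<^sup>2 * (v \<bullet> v) + 2 * ?b * ?c * (u \<bullet> v) + ?c\<^sup>2 * (u \<bullet> u) + (2 * a)\<^sup>2 * (cross3 u v \<bullet> cross3 u v)"
    unfolding quat_rot_def q fst_conv snd_conv
    by (simp only: inner_add_left inner_add_right inner_scaleR_left inner_scaleR_right o inner_commute[of v u]
        power2_eq_square) (simp only: algebra_simps)
  also have "\<dots> = (a\<^sup>2 + u \<bullet> u)\<^sup>2 * (v \<bullet> v)"
    unfolding cr by (simp only: power2_eq_square algebra_simps)
  finally show ?thesis using au by (simp add: norm_eq_sqrt_inner)
qed

lemma quat_rot_add: "quat_rot q (v + w) = quat_rot q v + quat_rot q w"
  and quat_rot_minus: "quat_rot q (- v) = - quat_rot q v"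
  and quat_rot_0: "quat_rot q 0 = 0"
  by (simp_all add: quat_rot_def cross_add_right inner_add_right algebra_simps)

lemma quat_rot_diff: "quat_rot q (v - w) = quat_rot q v - quat_rot q w"
  using quat_rot_add[of q v "- w"] by (simp add: quat_rot_minus)

lemma quat_rot_in:
  assumes q: "norm q = 1" and f: "f \<in> lifted_conf n"
  shows "(\<lambda>i. quat_rot q (f i)) \<in> lifted_conf n"
proof -
  have "quat_rot q v \<noteq> quat_rot q w" "quat_rot q v \<noteq> - quat_rot q w" if "v \<noteq> w" "v \<noteq> - w" for v w
  proof -
    have "norm (quat_rot q (v - w)) \<noteq> 0" "norm (quat_rot q (v + w)) \<noteq> 0"
      unfolding norm_quat_rot[OF q] using that by (auto simp: eq_neg_iff_add_eq_0)
    then show "quat_rot q v \<noteq> quat_rot q w" "quat_rot q v \<noteq> - quat_rot q w"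
      unfolding quat_rot_diff quat_rot_add by (auto simp: eq_neg_iff_add_eq_0)
  qed
  then show ?thesis using f by (auto simp: lifted_conf_def norm_quat_rot[OF q] quat_rot_0)
qed

section \<open>Explicit rotations in cylindrical coordinates\<close>

locale rotation_frame =
  fixes e1 e3 :: "real^3" and n k :: nat
  assumes e1: "norm e1 = 1" and e3: "norm e3 = 1" and e13: "e1 \<bullet> e3 = 0"
    and k: "0 < k" "n = k \<or> n = Suc k"
begin

definition e2 where "e2 = cross3 e3 e1"

definition pol :: "real \<Rightarrow> real^3" where "pol \<theta> = cos \<theta> *\<^sub>R e1 + sin \<theta> *\<^sub>R e2"

definition cyl :: "real \<Rightarrow> real \<Rightarrow> real \<Rightarrow> real^3" where "cyl \<rho> \<theta> \<beta> = \<rho> *\<^sub>R pol \<theta> + \<beta> *\<^sub>R e3"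

text \<open>The spacing is \<open>pi / k\<close> and not \<open>2 * pi / k\<close> because antipodal
  points are identified. Index \<open>k\<close> is present only for \<open>n = Suc k\<close> and
  carries the pole.\<close>

definition equator :: "real \<Rightarrow> nat \<Rightarrow> real^3" where
  "equator \<theta> i = (if i < k then pol (real i * pi / real k + \<theta>) else if i < n then e3 else 0)"

lemma inner_e:
  "e1 \<bullet> e1 = 1" "e2 \<bullet> e2 = 1" "e3 \<bullet> e3 = 1" "e1 \<bullet> e2 = 0" "e2 \<bullet> e1 = 0" "e1 \<bullet> e3 = 0" "e3 \<bullet> e1 = 0"
  "e2 \<bullet> e3 = 0" "e3 \<bullet> e2 = 0"
proof -
  show "e1 \<bullet> e1 = 1" "e3 \<bullet> e3 = 1" "e1 \<bullet> e3 = 0" "e3 \<bullet> e1 = 0"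
    using e1 e3 e13 by (simp_all add: norm_eq_1 inner_commute)
  then show "e2 \<bullet> e2 = 1" using norm_cross_dot[of e3 e1] unfolding e2_def
    by (simp add: power2_norm_eq_inner e1 e3)
  show "e1 \<bullet> e2 = 0" "e2 \<bullet> e1 = 0" "e2 \<bullet> e3 = 0" "e3 \<bullet> e2 = 0"
    unfolding e2_def by (simp_all add: dot_cross_self)
qed

lemma cross_e3: "cross3 e3 e1 = e2" "cross3 e3 e2 = - e1" "cross3 e3 e3 = 0"
  by (simp_all add: e2_def Lagrange inner_e)

lemma inner_cyl: "cyl \<rho> \<theta> \<beta> \<bullet> e1 = \<rho> * cos \<theta>" "cyl \<rho> \<theta> \<beta> \<bullet> e2 = \<rho> * sin \<theta>" "cyl \<rho> \<theta> \<beta> \<bullet> e3 = \<beta>"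
  by (simp_all add: cyl_def pol_def inner_add_left inner_e)

lemma inner_cyl_cyl: "cyl \<rho> \<theta> \<beta> \<bullet> cyl \<rho> \<theta> \<beta> = \<rho>\<^sup>2 + \<beta>\<^sup>2"
proof -
  have "cyl \<rho> \<theta> \<beta> \<bullet> cyl \<rho> \<theta> \<beta> = \<rho> * cos \<theta> * (\<rho> * cos \<theta>) + \<rho> * sin \<theta> * (\<rho> * sin \<theta>) + \<beta> * \<beta>"
    by (subst (2) cyl_def) (simp add: pol_def inner_add_right inner_cyl algebra_simps)
  also have "\<dots> = \<rho>\<^sup>2 * ((sin \<theta>)\<^sup>2 + (cos \<theta>)\<^sup>2) + \<beta>\<^sup>2" by (simp only: power2_eq_square algebra_simps)
  finally show ?thesis by simp
qed

lemma cyl_nonzero: "cyl \<rho> \<theta> \<beta> = 0 \<longleftrightarrow> \<rho> = 0 \<and> \<beta> = 0"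
  by (metis inner_cyl_cyl inner_eq_zero_iff sum_power2_eq_zero_iff)

lemma cyl_not_parallel:
  assumes "\<rho> \<noteq> 0" "sin (\<theta> - \<theta>') \<noteq> 0 \<or> \<rho>' = 0"
  shows "cyl \<rho> \<theta> \<beta> \<noteq> l *\<^sub>R cyl \<rho>' \<theta>' \<beta>'"
proof
  assume "cyl \<rho> \<theta> \<beta> = l *\<^sub>R cyl \<rho>' \<theta>' \<beta>'"
  from arg_cong[OF this, of "\<lambda>v. v \<bullet> e1"] arg_cong[OF this, of "\<lambda>v. v \<bullet> e2"]
  have eq: "\<rho> * cos \<theta> = l * \<rho>' * cos \<theta>'" "\<rho> * sin \<theta> = l * \<rho>' * sin \<theta>'"
    by (simp_all add: inner_cyl)
  have "\<rho> * sin (\<theta> - \<theta>') = (\<rho> * sin \<theta>) * cos \<theta>' - (\<rho> * cos \<theta>) * sin \<theta>'"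
    by (simp add: sin_diff algebra_simps)
  also have "\<dots> = 0" unfolding eq by (simp add: algebra_simps)
  finally have "\<rho>' = 0" using assms by simp
  then have "cos \<theta> = 0" "sin \<theta> = 0" using eq assms by auto
  then show False using sin_cos_squared_add[of \<theta>] by simp
qed

lemma expand_e: "v = (v \<bullet> e1) *\<^sub>R e1 + (v \<bullet> e2) *\<^sub>R e2 + (v \<bullet> e3) *\<^sub>R e3"
proof -
  define d where "d = v - ((v \<bullet> e1) *\<^sub>R e1 + (v \<bullet> e2) *\<^sub>R e2 + (v \<bullet> e3) *\<^sub>R e3)"
  have "d \<bullet> e1 = 0" "d \<bullet> e2 = 0" "d \<bullet> e3 = 0"
    by (simp_all add: d_def inner_diff_left inner_add_left inner_e)
  \<comment> \<open>For \<open>y1 = e3\<close> and \<open>y2 = e1\<close>, \<open>frame_gram\<close>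
    says that \<open>d \<bullet> d\<close> is the sum of the squares of the three inner
    products.\<close>
  then have "d \<bullet> d = 0" using frame_gram[OF e3, of d e1] by (simp add: inner_e e2_def[symmetric])
  then show ?thesis by (simp add: d_def)
qed

lemma cyl_exists:
  assumes "v \<bullet> e1 \<noteq> 0 \<or> v \<bullet> e2 \<noteq> 0"
  obtains u \<rho> \<theta> \<beta> where "u = v \<or> u = - v" "u = cyl \<rho> \<theta> \<beta>" "\<rho> > 0" "0 \<le> \<theta>" "\<theta> < pi"
proof -
  have *: "\<exists>\<rho> \<theta> \<beta>. u = cyl \<rho> \<theta> \<beta> \<and> \<rho> > 0 \<and> \<theta> = Arg2pi (Complex (u \<bullet> e1) (u \<bullet> e2))"
    if "u \<bullet> e1 \<noteq> 0 \<or> u \<bullet> e2 \<noteq> 0" for u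
  proof (intro exI conjI)
    let ?z = "Complex (u \<bullet> e1) (u \<bullet> e2)"
    show "u = cyl (cmod ?z) (Arg2pi ?z) (u \<bullet> e3)"
      using expand_e[of u] cos_Arg2pi[of ?z] sin_Arg2pi[of ?z]
      by (simp add: cyl_def pol_def scaleR_add_right)
    show "cmod ?z > 0" using that by (simp add: complex_eq_iff)
  qed (rule refl)
  let ?z = "Complex (v \<bullet> e1) (v \<bullet> e2)"
  have z: "?z \<noteq> 0" using assms by (simp add: complex_eq_iff)
  show ?thesis
  proof (cases "Arg2pi ?z < pi")
    case True
    then show ?thesis using *[OF assms] that Arg2pi_ge_0 by metis
  next
    case False
    have "Complex ((- v) \<bullet> e1) ((- v) \<bullet> e2) = - ?z" by (simp add: complex_eq_iff)
    then have "Arg2pi (Complex ((- v) \<bullet> e1) ((- v) \<bullet> e2)) < pi"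
      using Arg2pi_minus[OF z] False Arg2pi_lt_2pi[of ?z] by simp
    moreover have "(- v) \<bullet> e1 \<noteq> 0 \<or> (- v) \<bullet> e2 \<noteq> 0" using assms by simp
    ultimately show ?thesis using *[of "- v"] that Arg2pi_ge_0 by metis
  qed
qed

lemma equator_cyl:
  assumes "i < n"
  shows "equator \<theta> i = cyl (if i < k then 1 else 0) (real i * pi / real k + \<theta>) (if i < k then 0 else 1)"
  using assms by (simp add: equator_def cyl_def)

text \<open>Angles differing by strictly between 0 and \<open>pi\<close> belong to different lines.
  A vector on the axis has no angle, but since \<open>n\<close> is at most \<open>k + 1\<close> the
  earlier vector of any pair has positive radius, which separates them.\<close>

lemma cyl_family_in_lifted_conf:
  assumes \<rho>: "\<And>i. i < k \<Longrightarrow> i < n \<Longrightarrow> \<rho> i > 0" "\<And>i. i < n \<Longrightarrow> \<rho> i \<noteq> 0 \<or> \<beta> i \<noteq> 0"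
    and \<theta>: "\<And>i j. i < j \<Longrightarrow> j < n \<Longrightarrow> (0 < \<theta> j - \<theta> i \<and> \<theta> j - \<theta> i < pi) \<or> \<rho> j = 0"
  shows "(\<lambda>i. if i < n then sgn (cyl (\<rho> i) (\<theta> i) (\<beta> i)) else 0) \<in> lifted_conf n"
proof -
  let ?w = "\<lambda>i. cyl (\<rho> i) (\<theta> i) (\<beta> i)"
  have ne: "?w i \<noteq> 0" if "i < n" for i using \<rho>(2)[OF that] by (simp add: cyl_nonzero)
  have *: "sgn (?w i) \<noteq> sgn (?w j) \<and> sgn (?w i) \<noteq> - sgn (?w j)" if ij: "i < j" "j < n" for i j
  proof -
    have i: "i < k" "i < n" using ij k by auto
    have "sin (\<theta> i - \<theta> j) \<noteq> 0 \<or> \<rho> j = 0"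
      using \<theta>[OF ij] sin_gt_zero[of "\<theta> j - \<theta> i"] sin_minus[of "\<theta> j - \<theta> i"] by auto
    then have np: "?w i \<noteq> l *\<^sub>R ?w j" for l using \<rho>(1)[OF i] by (intro cyl_not_parallel) auto
    have "?w i = norm (?w i) *\<^sub>R sgn (?w i)" using ne[OF i(2)] by (simp add: sgn_div_norm)
    show ?thesis
    proof (intro conjI notI)
      assume "sgn (?w i) = sgn (?w j)"
      with \<open>?w i = _\<close> have "?w i = norm (?w i) *\<^sub>R sgn (?w j)" by simp
      also have "\<dots> = (norm (?w i) * inverse (norm (?w j))) *\<^sub>R ?w j" by (simp add: sgn_div_norm)
      finally show False using np by blast
    next
      assume "sgn (?w i) = - sgn (?w j)"
      with \<open>?w i = _\<close> have "?w i = norm (?w i) *\<^sub>R (- sgn (?w j))" by simp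
      also have "\<dots> = (- (norm (?w i) * inverse (norm (?w j)))) *\<^sub>R ?w j" by (simp add: sgn_div_norm)
      finally show False using np by blast
    qed
  qed
  have "sgn (?w i) \<noteq> sgn (?w j) \<and> sgn (?w i) \<noteq> - sgn (?w j)" if "i < n" "j < n" "i \<noteq> j" for i j
    using *[of i j] *[of j i] that by (metis linorder_neqE_nat minus_minus)
  then show ?thesis unfolding lifted_conf_def using ne by (auto simp: norm_sgn)
qed

lemma equator_sgn:
  "equator \<theta> = (\<lambda>i. if i < n then sgn (cyl (if i < k then 1 else 0) (real i * pi / real k + \<theta>) (if i < k then 0 else 1)) else 0)"
proof
  fix i
  let ?w = "cyl (if i < k then 1 else 0) (real i * pi / real k + \<theta>) (if i < k then 0 else 1)"
  have "norm ?w = 1" using inner_cyl_cyl by (simp add: norm_eq_1)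
  then have "sgn ?w = ?w" by (simp add: sgn_div_norm)
  then show "equator \<theta> i = (if i < n then sgn ?w else 0)" using equator_cyl[of i \<theta>] k by (auto simp: equator_def)
qed

lemma equator_in: "equator \<theta> \<in> lifted_conf n"
proof -
  show ?thesis unfolding equator_sgn
  proof (rule cyl_family_in_lifted_conf)
    fix i j assume ij: "i < j" "j < n"
    show "(0 < (real j * pi / real k + \<theta>) - (real i * pi / real k + \<theta>) \<and> (real j * pi / real k + \<theta>) - (real i * pi / real k + \<theta>) < pi)
      \<or> (if j < k then 1 else 0) = (0::real)"
    proof (cases "j < k")
      case True
      define q where "q = (real j - real i) / real k"
      have eq: "(real j * pi / real k + \<theta>) - (real i * pi / real k + \<theta>) = q * pi"
        by (simp add: q_def diff_divide_distrib left_diff_distrib)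
      have q: "0 < q" "q < 1" unfolding q_def using ij True k by (auto simp: field_simps)
      have "q * pi < 1 * pi" by (rule mult_strict_right_mono[OF q(2)]) simp
      then show ?thesis unfolding eq using q(1) by simp
    qed auto
  qed auto
qed

lemma pol_add_pi: "pol (\<theta> + pi) = - pol \<theta>"
  by (simp add: pol_def)

lemma equator_shift: "signed_shift k (equator \<theta>) = equator (\<theta> + pi / real k)"
proof
  fix i
  consider "i + 1 < k" | "i + 1 = k" | "i \<ge> k" by linarith
  then show "signed_shift k (equator \<theta>) i = equator (\<theta> + pi / real k) i"
  proof cases
    case 1
    then have "real (i + 1) * pi / real k + \<theta> = real i * pi / real k + (\<theta> + pi / real k)"
      by (simp add: add_divide_distrib distrib_right)
    then show ?thesis using 1 unfolding signed_shift_def equator_def by (simp only: if_True) simp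
  next
    case 2
    have "real i * pi / real k + pi / real k = real (i + 1) * pi / real k"
      by (simp add: add_divide_distrib distrib_right)
    also have "\<dots> = pi" using 2 k by simp
    finally have "real i * pi / real k + (\<theta> + pi / real k) = \<theta> + pi" by simp
    then have "pol (real i * pi / real k + (\<theta> + pi / real k)) = - pol \<theta>" by (simp only: pol_add_pi)
    then show ?thesis using 2 k unfolding signed_shift_def equator_def by simp
  next
    case 3
    then show ?thesis by (simp add: signed_shift_def equator_def)
  qed
qed

lemma equator_shift_pow: "(signed_shift k ^^ j) (equator \<theta>) = equator (\<theta> + real j * pi / real k)"
proof (induction j)
  case (Suc j)
  have "\<theta> + real j * pi / real k + pi / real k = \<theta> + real (Suc j) * pi / real k"
    by (simp add: add_divide_distrib distrib_right)
  then show ?case by (simp only: funpow.simps comp_apply Suc equator_shift)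
qed simp

lemma equator_quat: "equator \<theta> = (\<lambda>i. quat_rot (cos (\<theta>/2), sin (\<theta>/2) *\<^sub>R e3) (equator 0 i))"
proof
  fix i
  define h where "h = \<theta> / 2"
  have pe: "pol a \<bullet> e3 = 0" "e3 \<bullet> pol a = 0" for a by (simp_all add: pol_def inner_add_left inner_add_right inner_e)
  have "cross3 e3 (pol a) = cos a *\<^sub>R e2 - sin a *\<^sub>R e1" for a
    by (simp add: pol_def cross_add_right cross_mult_right cross_e3)
  then have "quat_rot (cos h, sin h *\<^sub>R e3) (pol a) = ((cos h)\<^sup>2 - (sin h)\<^sup>2) *\<^sub>R pol a + (2 * sin h * cos h) *\<^sub>R (cos a *\<^sub>R e2 - sin a *\<^sub>R e1)" for a
    by (simp add: quat_rot_def inner_e pe cross_mult_left power2_eq_square mult.commute)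
  also have "\<dots> a = pol (a + 2 * h)" for a
    unfolding pol_def cos_add sin_add cos_double sin_double by (simp add: algebra_simps)
  finally have p: "quat_rot (cos h, sin h *\<^sub>R e3) (pol a) = pol (a + \<theta>)" for a by (simp add: h_def)
  have "quat_rot (cos h, sin h *\<^sub>R e3) e3 = ((cos h)\<^sup>2 + (sin h)\<^sup>2) *\<^sub>R e3"
  proof -
    have "quat_rot (cos h, sin h *\<^sub>R e3) e3 = ((cos h)\<^sup>2 - sin h * sin h) *\<^sub>R e3 + (2 * sin h * sin h) *\<^sub>R e3"
      by (simp add: quat_rot_def inner_e cross_mult_left cross_e3)
    also have "\<dots> = ((cos h)\<^sup>2 - sin h * sin h + 2 * sin h * sin h) *\<^sub>R e3" by (simp only: scaleR_add_left)
    also have "(cos h)\<^sup>2 - sin h * sin h + 2 * sin h * sin h = (cos h)\<^sup>2 + (sin h)\<^sup>2" by (simp only: power2_eq_square)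
    finally show ?thesis .
  qed
  also have "(cos h)\<^sup>2 + (sin h)\<^sup>2 = 1" by simp
  finally have "quat_rot (cos h, sin h *\<^sub>R e3) e3 = e3" by simp
  then show "equator \<theta> i = quat_rot (cos (\<theta>/2), sin (\<theta>/2) *\<^sub>R e3) (equator 0 i)"
    using p unfolding h_def[symmetric] by (simp add: equator_def quat_rot_0)
qed

lemma continuous_equator: "continuous_on S equator"
proof (rule continuous_on_coordinatewise_then_product)
  show "continuous_on S (\<lambda>\<theta>. equator \<theta> i)" for i
    unfolding equator_def pol_def by (intro continuous_on_if_const continuous_intros)
qed

definition rot_arc :: "real \<Rightarrow> real \<Rightarrow> real \<Rightarrow> nat \<Rightarrow> real^3" where
  "rot_arc a b = equator \<circ> linepath a b"

lemma rot_arc: "path (rot_arc a b)" "path_image (rot_arc a b) \<subseteq> lifted_conf n"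
  "pathstart (rot_arc a b) = equator a" "pathfinish (rot_arc a b) = equator b"
proof -
  show "path (rot_arc a b)" unfolding rot_arc_def by (intro path_continuous_image continuous_equator path_linepath)
  show "path_image (rot_arc a b) \<subseteq> lifted_conf n" "pathstart (rot_arc a b) = equator a" "pathfinish (rot_arc a b) = equator b"
    unfolding rot_arc_def using equator_in by (auto simp: path_image_def pathstart_def pathfinish_def linepath_def)
qed

lemma rot_arc_join: "homotopic_paths (lifted_conf n) (rot_arc a b +++ rot_arc b c) (rot_arc a c)"
proof -
  have "homotopic_paths UNIV (linepath a b +++ linepath b c) (linepath a c)"
    by (rule homotopic_paths_linear) auto
  from homotopic_paths_continuous_image[OF this continuous_equator]
  show ?thesis unfolding rot_arc_def compose_joinpaths[symmetric] using equator_in by auto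
qed

lemma rot_arc_full: "homotopic_paths (lifted_conf n) (rot_arc 0 (4 * pi)) (\<lambda>_. equator 0)"
proof -
  define q where "q \<theta> = (cos (\<theta>/2), sin (\<theta>/2) *\<^sub>R e3)" for \<theta> :: real
  define H where "H q = (\<lambda>i. quat_rot q (equator 0 i))" for q
  let ?S = "sphere (0::real \<times> (real^3)) 1"
  have q1: "norm (q \<theta>) = 1" for \<theta> by (simp add: q_def norm_Pair e3 power_mult_distrib)
  have cq: "continuous_on S q" for S unfolding q_def by (intro continuous_intros) auto
  have "simply_connected ?S" by (rule simply_connected_sphere) simp
  moreover have "path (q \<circ> linepath 0 (4*pi))" by (intro path_continuous_image cq) auto
  moreover have "path_image (q \<circ> linepath 0 (4*pi)) \<subseteq> ?S" using q1 by (auto simp: path_image_def)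
  \<comment> \<open>Because of the half angles, the quaternion path has reached only -1 after a
    rotation by \<open>2 * pi\<close>; it closes at \<open>4 * pi\<close>.\<close>
  moreover have qe: "q 0 = (1, 0)" "q (4 * pi) = (1, 0)"
    using sin_2npi[of 1] cos_2npi[of 1] by (auto simp: q_def)
  ultimately have hom: "homotopic_paths ?S (q \<circ> linepath 0 (4*pi)) (linepath (1,0) (1,0))"
    unfolding simply_connected_eq_contractible_path by (auto simp: pathstart_def pathfinish_def linepath_def)
  have cr: "continuous_on ?S (\<lambda>q. cross3 (snd q) v)" for v
    by (intro continuous_on_cross continuous_intros)
  have "continuous_on ?S H" unfolding H_def quat_rot_def
    by (intro continuous_on_coordinatewise_then_product continuous_intros cr)
  moreover have "H \<in> ?S \<rightarrow> lifted_conf n" unfolding H_def using quat_rot_in[OF _ equator_in] by auto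
  ultimately have "homotopic_paths (lifted_conf n) (H \<circ> (q \<circ> linepath 0 (4*pi))) (H \<circ> linepath (1,0) (1,0))"
    by (rule homotopic_paths_continuous_image[OF hom])
  moreover have "H \<circ> q = equator"
  proof
    fix \<theta> show "(H \<circ> q) \<theta> = equator \<theta>" unfolding H_def q_def comp_apply using equator_quat[of \<theta>] by simp
  qed
  moreover have "H \<circ> linepath (1,0) (1,0) = (\<lambda>_. equator 0)"
    using fun_cong[OF \<open>H \<circ> q = equator\<close>, of 0] qe(1) by (auto simp: linepath_def zero_prod_def)
  ultimately show ?thesis unfolding rot_arc_def by (simp add: comp_assoc[symmetric])
qed

text \<open>The lift of a loop at \<open>x\<close> ends at the shift of \<open>x\<close>, so each
  further factor is the lift moved by one more power of the deck transformation.\<close>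

primrec lifted_power :: "(nat \<Rightarrow> real^3) \<Rightarrow> (real \<Rightarrow> nat \<Rightarrow> real^3) \<Rightarrow> nat \<Rightarrow> real \<Rightarrow> nat \<Rightarrow> real^3" where
  "lifted_power x g 0 = (\<lambda>_. x)"
| "lifted_power x g (Suc j) = lifted_power x g j +++ ((signed_shift k ^^ j) \<circ> g)"

lemma k_le: "k \<le> n" using k by auto

lemma shift_pow_in: "f \<in> lifted_conf n \<Longrightarrow> (signed_shift k ^^ j) f \<in> lifted_conf n"
  by (induction j) (auto intro: signed_shift_in[OF k(1) k_le])

lemma continuous_shift_pow: "continuous_on S (signed_shift k ^^ j)"
proof (induction j)
  case (Suc j)
  show ?case unfolding funpow.simps comp_def
    by (rule continuous_on_compose2[OF continuous_signed_shift[of UNIV] Suc]) auto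
qed (simp add: id_def continuous_on_id)

lemma shift_pow_path:
  assumes "path g" "path_image g \<subseteq> lifted_conf n"
  shows "path ((signed_shift k ^^ j) \<circ> g)" "path_image ((signed_shift k ^^ j) \<circ> g) \<subseteq> lifted_conf n"
  using assms shift_pow_in by (auto intro!: path_continuous_image continuous_shift_pow simp: path_image_def)

lemma proj_shift_pow: "proj_conf n ((signed_shift k ^^ j) f) = proj_conf n f"
  by (induction j) (auto simp: proj_signed_shift[OF k(1) k_le])

lemma compose_reversepath: "f \<circ> reversepath g = reversepath (f \<circ> g)"
  by (auto simp: reversepath_def)

text \<open>The lifted loop is the rotation conjugated by \<open>c\<close>: it returns along the
  shifted path, hence ends at the shift of \<open>x\<close>. In a power, each return cancels against
  the next departure, leaving a rotation by \<open>j * pi / k\<close>; for \<open>j = 4 * k\<close>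
  it contracts, and \<open>c\<close> cancels its reverse.\<close>

lemma rotation_loop:
  assumes c: "path c" "path_image c \<subseteq> lifted_conf n" "pathfinish c = equator 0"
  defines "x \<equiv> pathstart c"
  defines "A \<equiv> proj_conf n x"
  obtains p where "p \<in> loops (unordered_conf RP2 n) A"
    "loop_homotopic (unordered_conf RP2 n) A (loop_power (\<lambda>_. A) p (4 * k)) (\<lambda>_. A)"
    "\<And>i. i < n \<Longrightarrow> lifts.hol n p (x i) = signed_shift k x i"
proof -
  define \<sigma> where "\<sigma> = signed_shift k"
  define g where "g = (c +++ rot_arc 0 (pi / k)) +++ reversepath (\<sigma> \<circ> c)"
  note \<sigma>c = shift_pow_path[OF c(1,2)]
  have \<sigma>1: "path (\<sigma> \<circ> c)" "path_image (\<sigma> \<circ> c) \<subseteq> lifted_conf n" using \<sigma>c[of 1] by (simp_all add: \<sigma>_def)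
  have fin\<sigma>: "pathfinish ((\<sigma> ^^ j) \<circ> c) = equator (real j * pi / real k)"
    "pathstart ((\<sigma> ^^ j) \<circ> c) = (\<sigma> ^^ j) x" for j
    using c(3) equator_shift_pow[of j 0] by (simp_all add: \<sigma>_def pathfinish_def pathstart_def x_def)
  have fin1: "pathfinish (\<sigma> \<circ> c) = equator (pi / k)" "pathstart (\<sigma> \<circ> c) = \<sigma> x" using fin\<sigma>[of 1] by simp_all
  have g: "path g" "path_image g \<subseteq> lifted_conf n" "pathstart g = x" "pathfinish g = \<sigma> x"
    unfolding g_def using c \<sigma>1 rot_arc fin1 by (auto simp: path_image_join x_def)
  have g_pow: "(\<sigma> ^^ j) \<circ> g = (((\<sigma> ^^ j) \<circ> c) +++ rot_arc (real j * pi / real k) (real (Suc j) * pi / real k)) +++ reversepath ((\<sigma> ^^ Suc j) \<circ> c)" for j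
  proof -
    have "(\<sigma> ^^ j) \<circ> rot_arc 0 (pi / k) = rot_arc (real j * pi / real k) (real (Suc j) * pi / real k)"
    proof
      fix t
      have "linepath 0 (pi / k) t + real j * pi / real k = linepath (real j * pi / real k) (real (Suc j) * pi / real k) t"
        using k by (simp add: linepath_def field_simps)
      then show "((\<sigma> ^^ j) \<circ> rot_arc 0 (pi / k)) t = rot_arc (real j * pi / real k) (real (Suc j) * pi / real k) t"
        by (simp only: rot_arc_def comp_apply \<sigma>_def equator_shift_pow)
    qed
    moreover have "(\<sigma> ^^ j) \<circ> (\<sigma> \<circ> c) = (\<sigma> ^^ Suc j) \<circ> c"
      by (simp add: comp_assoc[symmetric] funpow_Suc_right del: funpow.simps)
    ultimately show ?thesis unfolding g_def compose_joinpaths compose_reversepath by simp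
  qed
  have x_in: "x \<in> lifted_conf n" using c by (auto simp: x_def pathstart_in_path_image)
  have lp: "path (lifted_power x g j) \<and> path_image (lifted_power x g j) \<subseteq> lifted_conf n \<and>
      pathstart (lifted_power x g j) = x \<and> pathfinish (lifted_power x g j) = (\<sigma> ^^ j) x" for j
  proof (induction j)
    case 0
    then show ?case using x_in by (auto simp: path_def path_image_def pathstart_def pathfinish_def)
  next
    case (Suc j)
    have "path ((\<sigma> ^^ j) \<circ> g)" "path_image ((\<sigma> ^^ j) \<circ> g) \<subseteq> lifted_conf n"
      using shift_pow_path[OF g(1,2)] by (auto simp: \<sigma>_def)
    moreover have "pathstart ((\<sigma> ^^ j) \<circ> g) = (\<sigma> ^^ j) x" "pathfinish ((\<sigma> ^^ j) \<circ> g) = (\<sigma> ^^ Suc j) x"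
      using g by (simp_all add: pathstart_def pathfinish_def funpow_swap1)
    ultimately show ?case using Suc by (auto simp: path_image_join \<sigma>_def)
  qed
  have hom: "homotopic_paths (lifted_conf n) (lifted_power x g j)
      ((c +++ rot_arc 0 (real j * pi / real k)) +++ reversepath ((\<sigma> ^^ j) \<circ> c))" for j
  proof (induction j)
    case 0
    have a: "rot_arc 0 0 = (\<lambda>_. c 1)" using c(3) by (auto simp: rot_arc_def linepath_def pathfinish_def)
    have "homotopic_paths (lifted_conf n) ((c +++ rot_arc 0 0) +++ reversepath c) (c +++ reversepath c)"
    proof (rule homotopic_paths_join)
      show "homotopic_paths (lifted_conf n) (c +++ rot_arc 0 0) c"
        unfolding a by (rule homotopic_paths_join_const(1)[OF c(1,2)])
    qed (use c in \<open>auto simp: rot_arc(4)\<close>)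
    also have "homotopic_paths (lifted_conf n) \<dots> (\<lambda>_. c 0)"
      by (rule homotopic_paths_join_const(3)[OF c(1,2)])
    finally show ?case using homotopic_paths_sym by (simp add: x_def pathstart_def id_def[symmetric])
  next
    case (Suc j)
    let ?C = "\<lambda>j. (\<sigma> ^^ j) \<circ> c" and ?a = "\<lambda>j. real j * pi / real k"
    have C: "path (?C j)" "path_image (?C j) \<subseteq> lifted_conf n" for j using \<sigma>c[of j] by (simp_all add: \<sigma>_def)
    have "homotopic_paths (lifted_conf n) (lifted_power x g (Suc j))
       (((c +++ rot_arc 0 (?a j)) +++ reversepath (?C j)) +++ ((?C j +++ rot_arc (?a j) (?a (Suc j))) +++ reversepath (?C (Suc j))))"
      unfolding lifted_power.simps \<sigma>_def[symmetric] g_pow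
    proof (rule homotopic_paths_join[OF Suc])
      show "homotopic_paths (lifted_conf n) ((?C j +++ rot_arc (?a j) (?a (Suc j))) +++ reversepath (?C (Suc j)))
         ((?C j +++ rot_arc (?a j) (?a (Suc j))) +++ reversepath (?C (Suc j)))"
        using C[of j] C[of "Suc j"] fin\<sigma>[of j] fin\<sigma>[of "Suc j"] rot_arc
        by (simp only: homotopic_paths_refl path_join path_image_join path_reversepath path_image_reversepath
            pathstart_join pathfinish_join pathstart_reversepath) (simp add: subset_path_image_join)
      show "pathfinish (lifted_power x g j) = pathstart ((?C j +++ rot_arc (?a j) (?a (Suc j))) +++ reversepath (?C (Suc j)))"
        using lp[of j] fin\<sigma>[of j] by (simp only: pathstart_join)
    qed
    also have "homotopic_paths (lifted_conf n) \<dots> (((c +++ rot_arc 0 (?a j)) +++ rot_arc (?a j) (?a (Suc j))) +++ reversepath (?C (Suc j)))"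
    proof (rule homotopic_paths_cancel)
      show "path (c +++ rot_arc 0 (?a j))" "path_image (c +++ rot_arc 0 (?a j)) \<subseteq> lifted_conf n"
        using c rot_arc by (auto simp: path_image_join)
      show "path (reversepath (?C (Suc j)))" "path_image (reversepath (?C (Suc j))) \<subseteq> lifted_conf n"
        using C[of "Suc j"] by (simp_all only: path_reversepath path_image_reversepath)
      show "pathfinish (c +++ rot_arc 0 (?a j)) = pathfinish (?C j)" "pathfinish (?C j) = pathstart (rot_arc (?a j) (?a (Suc j)))"
        using fin\<sigma>[of j] rot_arc by (simp_all only: pathfinish_join)
      show "pathfinish (rot_arc (?a j) (?a (Suc j))) = pathstart (reversepath (?C (Suc j)))"
        using fin\<sigma>[of "Suc j"] rot_arc by (simp only: pathstart_reversepath)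
    qed (use C rot_arc in blast)+
    also have "homotopic_paths (lifted_conf n) \<dots> ((c +++ rot_arc 0 (?a (Suc j))) +++ reversepath (?C (Suc j)))"
    proof (rule homotopic_paths_join)
      have "homotopic_paths (lifted_conf n) ((c +++ rot_arc 0 (?a j)) +++ rot_arc (?a j) (?a (Suc j))) (c +++ (rot_arc 0 (?a j) +++ rot_arc (?a j) (?a (Suc j))))"
        by (rule homotopic_paths_sym, rule homotopic_paths_assoc) (use c rot_arc in auto)
      also have "homotopic_paths (lifted_conf n) \<dots> (c +++ rot_arc 0 (?a (Suc j)))"
        by (rule homotopic_paths_join[OF _ rot_arc_join]) (use c rot_arc in auto)
      finally show "homotopic_paths (lifted_conf n) ((c +++ rot_arc 0 (?a j)) +++ rot_arc (?a j) (?a (Suc j))) (c +++ rot_arc 0 (?a (Suc j)))" .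
      show "homotopic_paths (lifted_conf n) (reversepath (?C (Suc j))) (reversepath (?C (Suc j)))"
        using C[of "Suc j"] by (simp only: homotopic_paths_refl path_reversepath path_image_reversepath)
      show "pathfinish ((c +++ rot_arc 0 (?a j)) +++ rot_arc (?a j) (?a (Suc j))) = pathstart (reversepath (?C (Suc j)))"
        using fin\<sigma>[of "Suc j"] rot_arc by (simp only: pathstart_reversepath pathfinish_join)
    qed
    finally show ?case .
  qed
  have full: "homotopic_paths (lifted_conf n) (lifted_power x g (4 * k)) (\<lambda>_. x)"
  proof -
    have "\<sigma> ^^ (4 * k) = id" using signed_shift_period by (simp add: \<sigma>_def)
    moreover have "real (4 * k) * pi / real k = 4 * pi" using k by simp
    ultimately have "homotopic_paths (lifted_conf n) (lifted_power x g (4 * k)) ((c +++ rot_arc 0 (4 * pi)) +++ reversepath c)"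
      using hom[of "4 * k"] by simp
    also have "homotopic_paths (lifted_conf n) \<dots> ((c +++ (\<lambda>_. c 1)) +++ reversepath c)"
    proof (rule homotopic_paths_join)
      have "equator 0 = c 1" using c(3) by (simp add: pathfinish_def)
      then have "homotopic_paths (lifted_conf n) (rot_arc 0 (4 * pi)) (\<lambda>_. c 1)" using rot_arc_full by simp
      then show "homotopic_paths (lifted_conf n) (c +++ rot_arc 0 (4 * pi)) (c +++ (\<lambda>_. c 1))"
        by (intro homotopic_paths_join) (use c rot_arc in auto)
      have "rot_arc 0 (4 * pi) 1 = equator (4 * pi)" by (simp add: rot_arc_def linepath_def)
      moreover have "equator (4 * pi) = equator 0"
        using homotopic_paths_imp_pathfinish[OF rot_arc_full] by (simp add: rot_arc(4) pathfinish_def[of "\<lambda>_. equator 0"])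
      ultimately show "pathfinish (c +++ rot_arc 0 (4 * pi)) = pathstart (reversepath c)"
        using c(3) rot_arc(4) by simp
    qed (use c in auto)
    also have "homotopic_paths (lifted_conf n) \<dots> (c +++ reversepath c)"
      by (rule homotopic_paths_join[OF homotopic_paths_join_const(1)[OF c(1,2)]])
        (use c in \<open>auto simp: pathfinish_def joinpaths_def\<close>)
    also have "homotopic_paths (lifted_conf n) \<dots> (\<lambda>_. c 0)"
      by (rule homotopic_paths_join_const(3)[OF c(1,2)])
    finally show ?thesis by (simp add: x_def pathstart_def)
  qed
  have A\<sigma>: "proj_conf n ((\<sigma> ^^ j) x) = A" for j by (simp add: A_def \<sigma>_def proj_shift_pow)
  define p where "p = proj_conf n \<circ> g"
  have power: "proj_conf n \<circ> lifted_power x g j = loop_power (\<lambda>_. A) p j" for j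
  proof (induction j)
    case 0
    then show ?case by (auto simp: A_def)
  next
    case (Suc j)
    have "proj_conf n \<circ> ((\<sigma> ^^ j) \<circ> g) = p" by (auto simp: p_def \<sigma>_def proj_shift_pow)
    moreover have "proj_conf n \<circ> lifted_power x g (Suc j)
        = path_concat (proj_conf n \<circ> lifted_power x g j) (proj_conf n \<circ> ((\<sigma> ^^ j) \<circ> g))"
      by (rule ext) (simp add: path_concat_def joinpaths_def \<sigma>_def)
    ultimately show ?case using Suc by simp
  qed
  show ?thesis
  proof (rule that)
    show "p \<in> loops (unordered_conf RP2 n) A"
      unfolding p_def using g A\<sigma>[of 0] A\<sigma>[of 1] by (intro proj_loop) auto
    have "loop_homotopic (unordered_conf RP2 n) A (proj_conf n \<circ> lifted_power x g (4 * k)) (proj_conf n \<circ> (\<lambda>_. x))"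
      by (rule homotopic_loops_proj[OF full]) (use lp[of "4 * k"] A\<sigma>[of 0] A\<sigma>[of "4 * k"] in auto)
    moreover have "proj_conf n \<circ> (\<lambda>_::real. x) = (\<lambda>_. A)" by (auto simp: A_def)
    ultimately show "loop_homotopic (unordered_conf RP2 n) A (loop_power (\<lambda>_. A) p (4 * k)) (\<lambda>_. A)"
      unfolding power by (simp only:)
    fix i assume i: "i < n"
    have "lifts.hol n p ((\<lambda>t. g t i) 0) = (\<lambda>t. g t i) 1"
    proof (rule lifts_hol_continuous)
      show "pathin (unordered_conf RP2 n) p" using \<open>p \<in> loops (unordered_conf RP2 n) A\<close> by (rule loopsD(1))
      show "continuous_on {0..1} (\<lambda>t. g t i)"
        using g(1) unfolding path_def by (rule continuous_on_product_then_coordinatewise)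
      show "g t i \<in> \<Union>(p t)" for t using i by (auto simp: p_def proj_conf_def)
    qed
    then show "lifts.hol n p (x i) = signed_shift k x i"
      using g(3,4) by (simp add: pathstart_def pathfinish_def \<sigma>_def)
  qed
qed

end

section \<open>Sliding an arbitrary configuration to the equator\<close>

lemma generic_direction:
  fixes F :: "(real^3) set"
  assumes "finite F" "0 \<notin> F"
  obtains e where "norm e = 1" "\<And>u. u \<in> F \<Longrightarrow> e \<bullet> u \<noteq> 0"
proof -
  \<comment> \<open>The nonzero vector \<open>axis 1 1\<close> is added to guarantee
    \<open>x \<noteq> 0\<close>, even for empty \<open>F\<close>.\<close>
  have neg: "negligible {x. u \<bullet> x = 0}" if "u \<in> insert (axis 1 1) F" for u :: "real^3"
    using that assms by (intro negligible_hyperplane) auto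
  have "negligible (\<Union>u\<in>insert (axis 1 1) F. {x::real^3. u \<bullet> x = 0})"
    using assms(1) neg by (intro negligible_Union) auto
  then have "(\<Union>u\<in>insert (axis 1 1) F. {x::real^3. u \<bullet> x = 0}) \<noteq> UNIV" by (metis non_negligible_UNIV)
  then obtain x :: "real^3" where x: "\<And>u. u \<in> insert (axis 1 1) F \<Longrightarrow> u \<bullet> x \<noteq> 0" by blast
  then have "x \<noteq> 0" by (metis inner_zero_right insertI1)
  then have "norm (sgn x) = 1" "\<And>u. u \<in> F \<Longrightarrow> sgn x \<bullet> u \<noteq> 0"
    using x by (auto simp: norm_sgn sgn_div_norm inner_commute)
  then show ?thesis by (rule that)
qed

lemma cross_unit_nonzero:
  assumes "norm v = 1" "norm w = 1" "w \<noteq> v" "w \<noteq> - v"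
  shows "cross3 v w \<noteq> 0"
proof
  assume "cross3 v w = 0"
  then have "(v \<bullet> w)\<^sup>2 = 1" using norm_cross_dot[of v w] assms by simp
  then have "v \<bullet> w = 1 \<or> v \<bullet> w = -1" by (simp add: power2_eq_1_iff)
  then have "1 + w \<bullet> v = 0 \<or> 1 + w \<bullet> (- v) = 0" by (auto simp: inner_commute)
  then show False using unit_inner(2)[OF assms(2,1)] unit_inner(2)[of w "- v"] assms by auto
qed

context rotation_frame
begin

text \<open>Two vectors of equal angle lie in one plane with the axis. Contraposed: an axis whose
  triple products with pairs of lifts do not vanish separates the angles.\<close>

lemma cyl_same_angle: "e3 \<bullet> cross3 (cyl \<rho> \<theta> \<beta>) (cyl \<rho>' \<theta> \<beta>') = 0"
proof -
  have "cross3 e3 (cyl \<rho>' \<theta> \<beta>') = \<rho>' *\<^sub>R (cos \<theta> *\<^sub>R e2 - sin \<theta> *\<^sub>R e1)"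
    by (simp add: cyl_def pol_def cross_add_right cross_mult_right cross_e3)
  then have "cyl \<rho> \<theta> \<beta> \<bullet> cross3 e3 (cyl \<rho>' \<theta> \<beta>') = 0"
    by (simp add: inner_diff_right inner_cyl)
  moreover have "e3 \<bullet> cross3 v w = - (v \<bullet> cross3 e3 w)" for v w
    using cross_triple[of v w e3] cross_skew[of w e3] by (simp add: inner_commute)
  ultimately show ?thesis by simp
qed

text \<open>Interpolating the cylindrical coordinates keeps differences of angles between 0 and
  \<open>pi\<close> by convexity, so no two lines collide; \<open>sgn\<close> returns to the sphere.
  For \<open>n = Suc k\<close> the radius of the last vector shrinks to 0 and it becomes the
  pole.\<close>

lemma path_to_equator:
  assumes v: "\<And>i. i < n \<Longrightarrow> v i = cyl (R i) (T i) (B i)" "\<And>i. i < n \<Longrightarrow> norm (v i) = 1" "\<And>i. i < n \<Longrightarrow> R i > 0"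
    and T: "\<And>i. i < n \<Longrightarrow> 0 \<le> T i \<and> T i < pi" "\<And>i j. i < j \<Longrightarrow> j < n \<Longrightarrow> T i < T j"
  obtains c where "path c" "path_image c \<subseteq> lifted_conf n" "pathfinish c = equator 0"
    "pathstart c = (\<lambda>i. if i < n then v i else 0)"
proof -
  define r where "r i t = (1 - t) * R i + (if i < k then t else 0)" for i :: nat and t :: real
  define a where "a i t = (1 - t) * T i + t * (real i * pi / real k)" for i :: nat and t :: real
  define b where "b i t = (1 - t) * B i + (if i < k then 0 else t)" for i :: nat and t :: real
  define c where "c t = (\<lambda>i. if i < n then sgn (cyl (r i t) (a i t) (b i t)) else 0)" for t
  have rb: "r i t \<noteq> 0 \<or> b i t \<noteq> 0" and r0: "i < k \<Longrightarrow> r i t > 0" if "i < n" "t \<in> {0..1}" for i t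
  proof -
    show "i < k \<Longrightarrow> r i t > 0" using v(3)[OF that(1)] that(2)
      by (cases "t = 1") (auto simp: r_def intro!: add_pos_nonneg)
    then show "r i t \<noteq> 0 \<or> b i t \<noteq> 0" using v(3)[OF that(1)] that(2)
      by (cases "i < k") (auto simp: r_def b_def)
  qed
  have c_in: "c t \<in> lifted_conf n" if t: "t \<in> {0..1}" for t
    unfolding c_def
  proof (rule cyl_family_in_lifted_conf)
    fix i j assume ij: "i < j" "j < n"
    have kk: "i < k" "j \<le> k" using ij k by auto
    define q where "q = (real j - real i) / real k"
    have q: "0 < q" "q \<le> 1" "j < k \<Longrightarrow> q < 1" unfolding q_def using ij kk by (auto simp: field_simps)
    define d where "d = T j - T i"
    have d: "0 < d" "d < pi" using T ij by (auto simp: d_def) (smt (verit) T(1) less_trans)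
    have eq: "a j t - a i t = (1 - t) * d + t * (q * pi)"
      by (simp add: a_def d_def q_def algebra_simps diff_divide_distrib)
    have qpi: "0 < q * pi" "q * pi \<le> pi" "j < k \<Longrightarrow> q * pi < pi" using q by auto
    \<comment> \<open>The difference can reach \<open>pi\<close> only for \<open>t = 1\<close> and
      \<open>j = k\<close>, where the vector is the pole and has radius 0.\<close>
    show "(0 < a j t - a i t \<and> a j t - a i t < pi) \<or> r j t = 0"
    proof (cases "t = 1")
      case True
      then show ?thesis unfolding eq using qpi by (auto simp: r_def)
    next
      case False
      then have t': "0 < 1 - t" "0 \<le> t" using t by auto
      have "0 < (1 - t) * d" "0 \<le> t * (q * pi)" using t' d qpi by auto
      moreover have "(1 - t) * d < (1 - t) * pi" "t * (q * pi) \<le> t * pi"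
        using t' d qpi by (auto intro: mult_left_mono)
      moreover have "(1 - t) * pi + t * pi = pi" by (simp add: algebra_simps)
      ultimately show ?thesis unfolding eq by linarith
    qed
  qed (use rb r0 t in auto)
  have "continuous_on {0..1} c"
  proof (rule continuous_on_coordinatewise_then_product)
    fix i
    show "continuous_on {0..1} (\<lambda>t. c t i)"
    proof (cases "i < n")
      case True
      have ne: "\<forall>t\<in>{0..1}. cyl (r i t) (a i t) (b i t) \<noteq> 0"
        using rb[OF True] by (simp add: cyl_nonzero)
      have "continuous_on {0..1} (r i)" "continuous_on {0..1} (a i)" "continuous_on {0..1} (b i)"
        unfolding r_def a_def b_def by (intro continuous_on_if_const continuous_intros)+
      then have "continuous_on {0..1} (\<lambda>t. cyl (r i t) (a i t) (b i t))"
        unfolding cyl_def pol_def by (intro continuous_intros)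
      then show ?thesis using True ne by (simp add: c_def continuous_on_sgn)
    qed (simp add: c_def)
  qed
  then have "path c" by (simp add: path_def)
  moreover have "path_image c \<subseteq> lifted_conf n" using c_in by (auto simp: path_image_def)
  moreover have "pathfinish c = equator 0"
    unfolding pathfinish_def equator_sgn c_def r_def a_def b_def by auto
  moreover have "pathstart c = (\<lambda>i. if i < n then v i else 0)"
    using v by (auto simp: pathstart_def c_def r_def a_def b_def sgn_div_norm)
  ultimately show ?thesis by (rule that)
qed

end

text \<open>For a generic axis \<open>e3\<close> the lines of \<open>A\<close> have pairwise
  distinct angles in \<open>[0, pi)\<close>. Sorting by angle tells which line slides to which place
  on the equator, so any \<open>A\<close> serves as base point.\<close>

lemma torsion_loop_exists:
  assumes A: "A \<in> topspace (unordered_conf RP2 n)" and n: "2 \<le> n" and k: "0 < k" "n = k \<or> n = Suc k"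
  obtains p x where "x \<in> lifted_conf n" "proj_conf n x = A" "p \<in> loops (unordered_conf RP2 n) A"
    "loop_homotopic (unordered_conf RP2 n) A (loop_power (\<lambda>_. A) p (4 * k)) (\<lambda>_. A)"
    "\<And>i. i < n \<Longrightarrow> lifts.hol n p (x i) = signed_shift k x i"
proof -
  note tA = topspace_unordered_conf[OF A]
  have finL: "finite (\<Union>A)" using finite_lifts tA by blast
  define F where "F = (\<lambda>(v,w). cross3 v w) ` {(v,w) \<in> \<Union>A \<times> \<Union>A. cross3 v w \<noteq> 0}"
  have "finite F" unfolding F_def using finL by (auto intro: finite_subset[of _ "\<Union>A \<times> \<Union>A"])
  moreover have "0 \<notin> F" by (auto simp: F_def)
  ultimately obtain e3 where e3: "norm e3 = 1" "\<And>u. u \<in> F \<Longrightarrow> e3 \<bullet> u \<noteq> 0" using generic_direction by metis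
  have gen: "e3 \<bullet> cross3 v w \<noteq> 0" if "v \<in> a" "w \<in> b" "a \<in> A" "b \<in> A" "a \<noteq> b" for v w a b
  proof -
    have vw: "v \<in> \<Union>A" "w \<in> \<Union>A" using that by auto
    have "a \<in> topspace RP2" "b \<in> topspace RP2" using that tA(3) by auto
    then obtain v' w' where ab: "a = {v', - v'}" "b = {w', - w'}" unfolding topspace_RP2 by blast
    then have "w \<noteq> v" "w \<noteq> - v" using that by (auto simp: insert_commute)
    then have "cross3 v w \<noteq> 0" using lift_norm(1)[OF tA(3)] vw by (intro cross_unit_nonzero) auto
    then have "cross3 v w \<in> F" using vw by (auto simp: F_def)
    then show ?thesis by (rule e3(2))
  qed
  obtain e1' where e1': "e1' \<noteq> 0" "orthogonal e3 e1'"
    using orthogonal_to_vector_exists[of e3] by auto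
  define e1 where "e1 = sgn e1'"
  interpret rotation_frame e1 e3 n k
    by unfold_locales (use e1' e3 k in \<open>auto simp: e1_def norm_sgn sgn_div_norm orthogonal_def inner_commute\<close>)
  have ex: "\<exists>u \<rho> \<theta> \<beta>. u \<in> a \<and> u = cyl \<rho> \<theta> \<beta> \<and> \<rho> > 0 \<and> 0 \<le> \<theta> \<and> \<theta> < pi" if a: "a \<in> A" for a
  proof -
    obtain v where v: "a = {v, - v}" "norm v = 1" using a tA(3) by (auto simp: topspace_RP2)
    \<comment> \<open>A second line shows that the axis does not lie on \<open>a\<close>: otherwise
      their triple product with \<open>e3\<close> would vanish.\<close>
    have "A \<noteq> {a}" using tA(2) n by auto
    then obtain b where b: "b \<in> A" "b \<noteq> a" using a by blast
    then obtain w where w: "w \<in> b" using tA(3) by (auto simp: topspace_RP2)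
    have "v \<bullet> e1 \<noteq> 0 \<or> v \<bullet> e2 \<noteq> 0"
    proof (rule ccontr)
      assume "\<not> ?thesis"
      then have "v = (v \<bullet> e3) *\<^sub>R e3" using expand_e[of v] by simp
      then have "(v \<bullet> e3) *\<^sub>R e3 \<bullet> cross3 v w = 0" by (metis dot_cross_self(1))
      moreover have "v \<bullet> e3 \<noteq> 0" using \<open>v = (v \<bullet> e3) *\<^sub>R e3\<close> v(2) by (metis norm_zero scaleR_zero_left zero_neq_one)
      ultimately show False using gen[of v a w b] v a b w by auto
    qed
    then obtain u \<rho> \<theta> \<beta> where "u = v \<or> u = - v" "u = cyl \<rho> \<theta> \<beta>" "\<rho> > 0" "0 \<le> \<theta>" "\<theta> < pi" by (rule cyl_exists)
    then show ?thesis using v by blast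
  qed
  obtain V R T B where V: "\<And>a. a \<in> A \<Longrightarrow> V a \<in> a \<and> V a = cyl (R a) (T a) (B a) \<and> R a > 0 \<and> 0 \<le> T a \<and> T a < pi"
    using ex by metis
  have injT: "inj_on T A"
  proof (rule inj_onI, rule ccontr)
    fix a b assume ab: "a \<in> A" "b \<in> A" "T a = T b" "a \<noteq> b"
    then show False using gen[of "V a" a "V b" b] V cyl_same_angle by metis
  qed
  define l where "l = sorted_list_of_set (T ` A)"
  have l: "set l = T ` A" "length l = n" "sorted_wrt (<) l"
    using tA injT by (auto simp: l_def card_image)
  define \<alpha> where "\<alpha> i = inv_into A T (l ! i)" for i
  have \<alpha>: "\<alpha> i \<in> A" "T (\<alpha> i) = l ! i" if "i < n" for i
  proof -
    have "l ! i \<in> T ` A" using that l nth_mem by metis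
    then show "\<alpha> i \<in> A" "T (\<alpha> i) = l ! i" by (auto simp: \<alpha>_def inv_into_into f_inv_into_f)
  qed
  have \<alpha>_im: "\<alpha> ` {..<n} = A"
  proof (intro equalityI subsetI)
    fix a assume a: "a \<in> A"
    then have "T a \<in> set l" using l by simp
    then obtain i where i: "i < n" "l ! i = T a" using l(2) by (metis in_set_conv_nth)
    then have "\<alpha> i = a" using injT a by (simp add: \<alpha>_def)
    then show "a \<in> \<alpha> ` {..<n}" using i by auto
  qed (use \<alpha> in auto)
  obtain c where c: "path c" "path_image c \<subseteq> lifted_conf n" "pathfinish c = equator 0"
    "pathstart c = (\<lambda>i. if i < n then V (\<alpha> i) else 0)"
  proof (rule path_to_equator[of "\<lambda>i. V (\<alpha> i)" "\<lambda>i. R (\<alpha> i)" "\<lambda>i. T (\<alpha> i)" "\<lambda>i. B (\<alpha> i)"])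
    show "norm (V (\<alpha> i)) = 1" if "i < n" for i using lift_norm(1)[OF tA(3)] V \<alpha>(1)[OF that] by blast
    show "T (\<alpha> i) < T (\<alpha> j)" if "i < j" "j < n" for i j
      using \<alpha>(2)[of i] \<alpha>(2)[of j] that l(2,3) by (simp add: sorted_wrt_nth_less)
    show "0 \<le> T (\<alpha> i) \<and> T (\<alpha> i) < pi" "V (\<alpha> i) = cyl (R (\<alpha> i)) (T (\<alpha> i)) (B (\<alpha> i))" "0 < R (\<alpha> i)"
      if "i < n" for i
      using V[OF \<alpha>(1)[OF that]] by blast+
  qed
  have x: "pathstart c \<in> lifted_conf n" using c(2) pathstart_in_path_image by blast
  have "proj_conf n (pathstart c) = (\<lambda>i. {V (\<alpha> i), - V (\<alpha> i)}) ` {..<n}" by (auto simp: proj_conf_def c(4))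
  also have "\<dots> = \<alpha> ` {..<n}"
  proof (rule image_cong[OF refl])
    fix i assume "i \<in> {..<n}"
    then have a: "\<alpha> i \<in> A" using \<alpha> by simp
    have pair: "{u, - u} = b" if "b \<in> topspace RP2" "u \<in> b" for u b
      using that by (auto simp: topspace_RP2)
    show "{V (\<alpha> i), - V (\<alpha> i)} = \<alpha> i" by (rule pair) (use a V[OF a] tA(3) in blast)+
  qed
  finally have pA: "proj_conf n (pathstart c) = A" using \<alpha>_im by simp
  obtain p where "p \<in> loops (unordered_conf RP2 n) A"
    "loop_homotopic (unordered_conf RP2 n) A (loop_power (\<lambda>_. A) p (4 * k)) (\<lambda>_. A)"
    "\<And>i. i < n \<Longrightarrow> lifts.hol n p (pathstart c i) = signed_shift k (pathstart c) i"
    using rotation_loop[OF c(1-3)] unfolding pA by blast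
  then show ?thesis by (rule that[OF x pA])
qed

section \<open>Fixed points of the lifted torsion elements\<close>

text \<open>The orbits of \<open>f\<close> partition \<open>S\<close>, and the length of an orbit is
  itself a \<open>d\<close> that returns its points.\<close>

lemma dvd_card_orbits:
  assumes fin: "finite S" and f: "\<And>b. b \<in> S \<Longrightarrow> f b \<in> S"
    and K: "0 < K" "\<And>b. b \<in> S \<Longrightarrow> (f ^^ K) b = b"
    and d: "\<And>b d. b \<in> S \<Longrightarrow> (f ^^ d) b = b \<Longrightarrow> k dvd d"
  shows "k dvd card S"
proof -
  define r where "r = {(a, b). a \<in> S \<and> b \<in> S \<and> (\<exists>i. (f ^^ i) a = b)}"
  have fi: "(f ^^ i) b \<in> S" if "b \<in> S" for b i using that f by (induction i) auto
  have "equiv S r"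
  proof (rule equivI)
    show "r \<subseteq> S \<times> S" by (auto simp: r_def)
    show "refl_on S r" unfolding refl_on_def r_def by (auto intro: exI[of _ 0])
    show "sym r"
    proof (rule symI)
      fix a b assume "(a, b) \<in> r"
      then obtain i where i: "a \<in> S" "b \<in> S" "(f ^^ i) a = b" by (auto simp: r_def)
      have "(f ^^ (j * K)) a = a" for j by (induction j) (use K(2)[OF i(1)] in \<open>auto simp: funpow_add\<close>)
      \<comment> \<open>Completing \<open>i\<close> to a multiple of the period expresses the
        inverse of \<open>f ^^ i\<close> as a power of \<open>f\<close>.\<close>
      moreover have "i * K = (i * K - i) + i" using K(1) by (simp add: le_square)
      ultimately have "(f ^^ (i * K - i)) b = a" using i(3) by (metis comp_apply funpow_add)
      then show "(b, a) \<in> r" using i by (auto simp: r_def)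
    qed
    show "trans r"
    proof (rule transI)
      fix a b c assume "(a, b) \<in> r" "(b, c) \<in> r"
      then obtain i j where "a \<in> S" "c \<in> S" "(f ^^ i) a = b" "(f ^^ j) b = c" by (auto simp: r_def)
      then have "(f ^^ (j + i)) a = c" by (simp add: funpow_add)
      then show "(a, c) \<in> r" using \<open>a \<in> S\<close> \<open>c \<in> S\<close> by (auto simp: r_def)
    qed
  qed
  moreover have "k dvd card X" if X: "X \<in> S // r" for X
  proof -
    obtain a where a: "a \<in> S" "X = r `` {a}" using X by (auto simp: quotient_def)
    define N where "N = (LEAST N. 0 < N \<and> (f ^^ N) a = a)"
    have N: "0 < N" "(f ^^ N) a = a"
      using LeastI[of "\<lambda>N. 0 < N \<and> (f ^^ N) a = a" K] K a by (auto simp: N_def)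
    have least: "M = 0" if "M < N" "(f ^^ M) a = a" for M
      using not_less_Least[of M "\<lambda>N. 0 < N \<and> (f ^^ N) a = a"] that by (auto simp: N_def)
    have "X = (\<lambda>i. (f ^^ i) a) ` {..<N}"
    proof (intro equalityI subsetI)
      fix b assume "b \<in> X"
      then obtain i where "(f ^^ i) a = b" using a by (auto simp: r_def)
      then have "(f ^^ (i mod N)) a = b" using funpow_mod_eq[OF N(2)] by metis
      then show "b \<in> (\<lambda>i. (f ^^ i) a) ` {..<N}" using N(1) by force
    qed (use a fi in \<open>auto simp: r_def\<close>)
    moreover have "inj_on (\<lambda>i. (f ^^ i) a) {..<N}"
    proof -
      have no: False if ij: "i < j" "j < N" "(f ^^ i) a = (f ^^ j) a" for i j
      proof -
        have "(f ^^ (N - j + i)) a = (f ^^ (N - j)) ((f ^^ j) a)" using ij(3) by (simp add: funpow_add)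
        also have "\<dots> = (f ^^ (N - j + j)) a" by (simp add: funpow_add)
        also have "\<dots> = a" using ij N by simp
        finally have "(f ^^ (N - j + i)) a = a" .
        moreover have "N - j + i < N" "N - j + i \<noteq> 0" using ij by auto
        ultimately show False using least[of "N - j + i"] by simp
      qed
      show ?thesis
      proof (rule inj_onI)
        fix i j assume "i \<in> {..<N}" "j \<in> {..<N}" "(f ^^ i) a = (f ^^ j) a"
        then show "i = j" using no[of i j] no[of j i] by (cases i j rule: linorder_cases) auto
      qed
    qed
    ultimately have "card X = N" by (simp add: card_image)
    then show ?thesis using d[OF a(1) N(2)] by simp
  qed
  ultimately show ?thesis by (intro equiv_imp_dvd_card[OF fin]) auto
qed

lemma fst_coloured_conf:
  assumes "x \<in> topspace (coloured_conf RP2 n m)"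
  shows "fst x \<in> topspace (unordered_conf RP2 n)"
proof -
  obtain f where f: "f \<in> {..<n+m} \<rightarrow>\<^sub>E topspace RP2" "inj_on f {..<n+m}"
    and x: "x = (f ` {..<n}, f ` {n..<n+m})"
    using assms by (auto simp: coloured_conf_def topspace_ordered_conf)
  have "restrict f {..<n} \<in> topspace (ordered_conf RP2 n)"
    using f by (auto simp: topspace_ordered_conf inj_on_def)
  then show ?thesis by (auto simp: unordered_conf_def x intro!: image_eqI[of _ _ "restrict f {..<n}"])
qed

lemma (in local_system) hol_loop_iterate:
  assumes "p \<in> loops X x" "f \<in> E x"
  shows "hol (loop_power p p j) f = (hol p ^^ Suc j) f"
  using hol_loop_power[OF assms(1,1,2)] by (simp add: funpow_swap1)

text \<open>The orbit of \<open>x 0\<close> is \<open>x 0\<close>, ..., \<open>x (k - 1)\<close>,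
  followed by their antipodes: a cycle of length exactly \<open>2 * k\<close>, because the
  \<open>x i\<close> are pairwise different even up to sign.\<close>

lemma signed_cycle_injective:
  assumes x: "x \<in> lifted_conf n" "0 < k" "k \<le> n"
    and \<phi>: "\<And>i. i < n \<Longrightarrow> \<phi> (x i) = signed_shift k x i" "\<And>v. v \<in> insert (x 0) (x ` {..<n}) \<Longrightarrow> \<phi> (- v) = - \<phi> v"
  shows "(\<phi> ^^ j) (x 0) \<in> x ` {..<k} \<union> (\<lambda>i. - x i) ` {..<k}"
    and "(\<phi> ^^ i) (x 0) = (\<phi> ^^ j) (x 0) \<Longrightarrow> i \<le> j \<Longrightarrow> 2 * k dvd j - i"
    and "(\<phi> ^^ (2 * k)) (x 0) = x 0"
proof -
  have low: "(\<phi> ^^ j) (x 0) = x j" if "j < k" for j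
    using that
  proof (induction j)
    case (Suc j)
    then show ?case using \<phi>(1)[of j] x by (simp add: signed_shift_def)
  qed simp
  have step: "\<phi> (- x i) = - signed_shift k x i" if "i < n" for i using \<phi> that by auto
  have high: "(\<phi> ^^ (k + j)) (x 0) = - x j" if "j < k" for j
    using that
  proof (induction j)
    case 0
    have "\<phi> ((\<phi> ^^ (k - 1)) (x 0)) = - x 0" using low[of "k - 1"] \<phi>(1)[of "k - 1"] x by (simp add: signed_shift_def)
    then show ?case using x(2) by (cases k) auto
  next
    case (Suc j)
    then show ?case using step[of j] x by (simp add: signed_shift_def)
  qed
  have "\<phi> ((\<phi> ^^ (k + (k - 1))) (x 0)) = x 0"
    using high[of "k - 1"] step[of "k - 1"] x by (simp add: signed_shift_def)
  then show per: "(\<phi> ^^ (2 * k)) (x 0) = x 0" using x(2) by (cases k) (auto simp: mult_2)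
  have val: "(\<phi> ^^ j) (x 0) = (if j mod (2 * k) < k then x (j mod (2 * k)) else - x (j mod (2 * k) - k))" for j
  proof -
    define r where "r = j mod (2 * k)"
    have r: "r < 2 * k" using x by (simp add: r_def)
    have "(\<phi> ^^ j) (x 0) = (\<phi> ^^ r) (x 0)" using funpow_mod_eq[OF per, of j] by (simp add: r_def)
    also have "\<dots> = (if r < k then x r else - x (r - k))" using low[of r] high[of "r - k"] r by auto
    finally show ?thesis by (simp add: r_def)
  qed
  have bound: "j mod (2 * k) - k < k" for j using x mod_less_divisor[of "2 * k" j] by linarith
  show "(\<phi> ^^ j) (x 0) \<in> x ` {..<k} \<union> (\<lambda>i. - x i) ` {..<k}"
    unfolding val using bound[of j] by auto
  have unit: "norm (x i) = 1" and dist: "i \<noteq> j \<Longrightarrow> x i \<noteq> x j \<and> x i \<noteq> - x j" if "i < k" "j < k" for i j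
    using x that by (auto simp: lifted_conf_def)
  have neg: "x i \<noteq> - x i" if "i < k" for i
  proof
    assume "x i = - x i"
    then have "2 *\<^sub>R x i = 0" by (simp add: eq_neg_iff_add_eq_0 scaleR_2)
    then show False using unit[OF that that] by simp
  qed
  show "2 * k dvd j - i" if eq: "(\<phi> ^^ i) (x 0) = (\<phi> ^^ j) (x 0)" "i \<le> j"
  proof -
    have "i mod (2 * k) = j mod (2 * k)"
    proof -
      have "a = b" if "(if a < k then x a else - x (a - k)) = (if b < k then x b else - x (b - k))" "a - k < k" "b - k < k" for a b
      proof (cases "a < k"; cases "b < k")
        assume "a < k" "b < k" then show ?thesis using that dist[of a b] by auto
      next
        assume "a < k" "\<not> b < k" then show ?thesis using that dist[of a "b - k"] neg[of a] by (cases "a = b - k") auto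
      next
        assume "\<not> a < k" "b < k" then show ?thesis using that dist[of b "a - k"] neg[of b] by (cases "b = a - k") auto
      next
        assume "\<not> a < k" "\<not> b < k" then show ?thesis using that dist[of "a - k" "b - k"] by (cases "a - k = b - k") auto
      qed
      then show ?thesis using eq(1) bound unfolding val by blast
    qed
    then show ?thesis using eq(2) by (metis mod_eq_dvd_iff_nat)
  qed
qed

text \<open>Two points of the configuration that are fixed by a power of the lifted torsion element
  provide a frame, so that power must be trivial on the rotating points.\<close>

lemma torsion_fixed_points:
  assumes \<gamma>: "\<gamma> \<in> loops (coloured_conf RP2 n m) x0"
    and K: "0 < K" "\<And>N s. s \<in> frame_states N x0 \<Longrightarrow> (frames.hol n m N \<gamma> ^^ K) s = s"
    and x: "x \<in> lifted_conf n" "0 < k" "k \<le> n" "proj_conf n x = fst x0"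
    and \<phi>: "\<And>i. i < n \<Longrightarrow> points.hol n m \<gamma> (x i) = signed_shift k x i"
    and y: "y1 \<in> all_lifts x0" "y2 \<in> all_lifts x0" "y2 \<noteq> y1" "y2 \<noteq> - y1"
      "\<And>i. i < k \<Longrightarrow> y1 \<noteq> x i \<and> y1 \<noteq> - x i"
    and fix1: "(points.hol n m \<gamma> ^^ d) y1 \<in> {y1, - y1}" and fix2: "(points.hol n m \<gamma> ^^ d) y2 \<in> {y2, - y2}"
  shows "k dvd d"
proof (rule ccontr)
  assume nd: "\<not> k dvd d"
  then have d0: "0 < d" by (cases d) auto
  define \<phi>' where "\<phi>' = points.hol n m \<gamma>"
  have x0: "x0 \<in> topspace (coloured_conf RP2 n m)" using loopsD(4)[OF \<gamma>] .
  have \<phi>_in: "\<phi>' v \<in> all_lifts x0" if "v \<in> all_lifts x0" for v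
    unfolding \<phi>'_def by (rule points.hol_loop_in[OF \<gamma> that])
  have \<phi>j_in: "(\<phi>' ^^ j) v \<in> all_lifts x0" if "v \<in> all_lifts x0" for v j
    by (induction j) (use that \<phi>_in in auto)
  have minus: "\<phi>' (- v) = - \<phi>' v" if "v \<in> all_lifts x0" for v
    unfolding \<phi>'_def by (rule points_hol_minus[OF loopsD(1-3)[OF \<gamma>] that])
  have minus_j: "(\<phi>' ^^ j) (- v) = - (\<phi>' ^^ j) v" if "v \<in> all_lifts x0" for v j
    by (induction j) (use that minus \<phi>j_in in auto)
  \<comment> \<open>The power \<open>d\<close> may exchange a lift with its antipode; doubling it
    fixes the lift itself, as a frame requires.\<close>
  have twice: "(\<phi>' ^^ (2 * d)) y = y" if "y \<in> all_lifts x0" "(\<phi>' ^^ d) y \<in> {y, - y}" for y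
  proof -
    have "(\<phi>' ^^ (2 * d)) y = (\<phi>' ^^ d) ((\<phi>' ^^ d) y)" by (simp add: mult_2 funpow_add)
    then show ?thesis using that minus_j[OF that(1), of d] by auto
  qed
  have x_in: "x i \<in> all_lifts x0" if "i < n" for i
    using x(4) that by (auto simp: all_lifts_def proj_conf_def)
  note cyc = signed_cycle_injective[OF x(1-3), of \<phi>']
  have \<phi>x: "\<phi>' (x i) = signed_shift k x i" if "i < n" for i using \<phi> that by (simp add: \<phi>'_def)
  have \<phi>m: "\<phi>' (- v) = - \<phi>' v" if "v \<in> insert (x 0) (x ` {..<n})" for v
    using that minus x_in x by auto
  \<comment> \<open>The power \<open>2 * d\<close> moves \<open>x 0\<close> within a cycle of length
    \<open>2 * k\<close>, so it returns after \<open>N\<close> steps exactly when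
    \<open>k dvd d * N\<close>. If \<open>k\<close> does not divide \<open>d\<close>, this cycle has
    at least 2 strands.\<close>
  define N where "N = (LEAST N. 0 < N \<and> k dvd d * N)"
  have N: "0 < N" "k dvd d * N"
    using LeastI[of "\<lambda>N. 0 < N \<and> k dvd d * N" k] x by (auto simp: N_def)
  have least: "\<not> k dvd d * M" if "0 < M" "M < N" for M
    using not_less_Least[of M "\<lambda>N. 0 < N \<and> k dvd d * N"] that by (auto simp: N_def)
  have "N \<noteq> 1" using nd N(2) by auto
  then have N2: "2 \<le> N" using N(1) by linarith
  define f where "f i = (\<phi>' ^^ (2 * d * i)) (x 0)" for i
  \<comment> \<open>This is the power \<open>2 * d\<close> of \<gamma>, as
    \<open>loop_power \<gamma> \<gamma>\<close> starts at the first power.\<close>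
  define \<delta> where "\<delta> = loop_power \<gamma> \<gamma> (2 * d - 1)"
  have sd: "Suc (2 * d - 1) = 2 * d" using d0 by simp
  have \<delta>: "\<delta> \<in> loops (coloured_conf RP2 n m) x0" unfolding \<delta>_def by (rule loop_power_in_loops[OF \<gamma> \<gamma>])
  have hol\<delta>: "points.hol n m \<delta> v = (\<phi>' ^^ (2 * d)) v" if "v \<in> all_lifts x0" for v
    using points.hol_loop_iterate[OF \<gamma> that, of "2 * d - 1"] unfolding \<delta>_def \<phi>'_def sd .
  have x00: "x 0 \<in> all_lifts x0" using x_in x by auto
  show False
  proof (rule no_torsion_loop[OF loopsD(1-3)[OF \<delta>] K(1) _ N2 y(1-4)])
    fix s assume s: "s \<in> frame_states N x0"
    have in_s: "(frames.hol n m N \<gamma> ^^ j) s \<in> frame_states N x0" for j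
      by (induction j) (use s frames.hol_loop_in[OF \<gamma>] in auto)
    have "(frames.hol n m N \<delta> ^^ j) s = (frames.hol n m N \<gamma> ^^ (2 * d * j)) s" for j
    proof (induction j)
      case (Suc j)
      have "frames.hol n m N \<delta> ((frames.hol n m N \<gamma> ^^ (2 * d * j)) s) = (frames.hol n m N \<gamma> ^^ (2 * d)) ((frames.hol n m N \<gamma> ^^ (2 * d * j)) s)"
        using frames.hol_loop_iterate[OF \<gamma> in_s, of "2 * d - 1" "2 * d * j"] unfolding \<delta>_def sd .
      then show ?case using Suc by (simp add: funpow_add[symmetric, THEN fun_cong, unfolded comp_apply])
    qed simp
    moreover have "(frames.hol n m N \<gamma> ^^ (j * K)) s = s" for j
      by (induction j) (simp_all add: funpow_add K(2)[OF s])
    ultimately show "(frames.hol n m N \<delta> ^^ K) s = s" by metis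
  next
    show "points.hol n m \<delta> y1 = y1" "points.hol n m \<delta> y2 = y2"
      using hol\<delta> twice y(1,2) fix1 fix2 by (auto simp: \<phi>'_def)
    show "f i \<in> all_lifts x0 \<and> f i \<noteq> - y1" if "i < N" for i
    proof
      show "f i \<in> all_lifts x0" unfolding f_def by (rule \<phi>j_in[OF x00])
      \<comment> \<open>The strands are rotating points up to sign, while \<open>y1\<close> is not,
        so none of them meets the pole of the projection.\<close>
      have "f i \<in> x ` {..<k} \<union> (\<lambda>i. - x i) ` {..<k}" unfolding f_def by (rule cyc(1)[OF \<phi>x \<phi>m])
      then obtain l where l: "l < k" "f i = x l \<or> f i = - x l" by auto
      show "f i \<noteq> - y1"
      proof
        assume "f i = - y1"
        then have "y1 = - x l \<or> y1 = x l" using l(2) by (metis minus_minus)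
        then show False using y(5)[OF l(1)] by blast
      qed
    qed
    show "points.hol n m \<delta> (f i) = f (Suc i mod N)" if i: "i < N" for i
    proof -
      have "points.hol n m \<delta> (f i) = (\<phi>' ^^ (2 * d + 2 * d * i)) (x 0)"
        using hol\<delta>[OF \<phi>j_in[OF x00]] by (simp add: f_def funpow_add)
      also have "\<dots> = f (Suc i)" by (simp add: f_def)
      also have "f (Suc i) = f (Suc i mod N)"
      proof (cases "Suc i = N")
        case True
        obtain c where "d * N = k * c" using N(2) by blast
        then have "2 * d * N mod (2 * k) = 0" by simp
        then have "f N = x 0" using funpow_mod_eq[OF cyc(3)[OF \<phi>x \<phi>m], of "2 * d * N"] by (simp add: f_def)
        then show ?thesis using True by (simp add: f_def)
      qed (use i in simp)
      finally show ?thesis .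
    qed
    show "inj_on f {..<N}"
    proof -
      have no: False if ij: "i < j" "j < N" "f i = f j" for i j
      proof -
        have "2 * k dvd 2 * d * j - 2 * d * i"
          by (rule cyc(2)[OF \<phi>x \<phi>m]) (use ij in \<open>auto simp: f_def\<close>)
        then have "2 * k dvd 2 * (d * (j - i))" by (simp add: diff_mult_distrib2 mult.assoc)
        then have "k dvd d * (j - i)" by simp
        then show False using least[of "j - i"] ij by auto
      qed
      show ?thesis
      proof (rule inj_onI)
        fix i j assume "i \<in> {..<N}" "j \<in> {..<N}" "f i = f j"
        then show "i = j" using no[of i j] no[of j i] by (cases i j rule: linorder_cases) auto
      qed
    qed
  qed
qed

text \<open>The section carries the torsion loop to a torsion loop \<gamma>, whose projection is
  homotopic to the original one. On the old points the holonomy is therefore still the signed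
  shift.\<close>

lemma section_torsion:
  assumes n: "2 \<le> n" and x0: "(A0, B0) \<in> topspace (coloured_conf RP2 n m)" and k: "0 < k" "n = k \<or> n = Suc k"
    and s: "s \<in> hom (fundamental_group (unordered_conf RP2 n) A0) (fundamental_group (coloured_conf RP2 n m) (A0, B0))"
    and sect: "\<And>g. g \<in> carrier (fundamental_group (unordered_conf RP2 n) A0) \<Longrightarrow>
      induced_hom (coloured_conf RP2 n m) (unordered_conf RP2 n) fst (A0, B0) (s g) = g"
  obtains \<gamma> x where "\<gamma> \<in> loops (coloured_conf RP2 n m) (A0, B0)"
    "\<And>N t. t \<in> frame_states N (A0, B0) \<Longrightarrow> (frames.hol n m N \<gamma> ^^ (4 * k)) t = t"
    "\<And>v. v \<in> all_lifts (A0, B0) \<Longrightarrow> (points.hol n m \<gamma> ^^ (4 * k)) v = v"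
    "x \<in> lifted_conf n" "proj_conf n x = A0"
    "\<And>i. i < n \<Longrightarrow> points.hol n m \<gamma> (x i) = signed_shift k x i"
proof -
  let ?X = "unordered_conf RP2 n" and ?Y = "coloured_conf RP2 n m"
  have A0: "A0 \<in> topspace ?X" using fst_coloured_conf[OF x0] by simp
  obtain p x where x: "x \<in> lifted_conf n" "proj_conf n x = A0" and p: "p \<in> loops ?X A0"
    "loop_homotopic ?X A0 (loop_power (\<lambda>_. A0) p (4 * k)) (\<lambda>_. A0)"
    and px: "\<And>i. i < n \<Longrightarrow> lifts.hol n p (x i) = signed_shift k x i"
    using torsion_loop_exists[OF A0 n k] by metis
  obtain \<gamma> e where \<gamma>: "\<gamma> \<in> loops ?Y (A0, B0)" "\<gamma> = (SOME q. q \<in> s (loop_class ?X A0 p))"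
    and e: "e \<in> loops ?Y (A0, B0)" "loop_homotopic ?Y (A0, B0) (path_concat e e) e"
    "\<And>K. loop_homotopic ?X A0 (loop_power (\<lambda>_. A0) p K) (\<lambda>_. A0) \<Longrightarrow> loop_homotopic ?Y (A0, B0) (loop_power e \<gamma> K) e"
    using section_loops[OF s A0 p(1)] by metis
  have tors: "loop_homotopic ?Y (A0, B0) (loop_power e \<gamma> (4 * k)) e" by (rule e(3)[OF p(2)])
  have "loop_class ?X A0 p \<in> carrier (fundamental_group ?X A0)" using p(1) by (simp add: carrier_fundamental_group)
  \<comment> \<open>\<open>induced_hom\<close> projects the representative picked by
    \<open>SOME\<close>, and \<gamma> is exactly that one.\<close>
  from sect[OF this] have "loop_class ?X A0 (fst \<circ> \<gamma>) = loop_class ?X A0 p" by (simp add: induced_hom_def \<gamma>(2))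
  then have "p \<in> loop_class ?X A0 (fst \<circ> \<gamma>)" using loop_class_self[OF p(1)] by simp
  then have fst\<gamma>: "fst \<circ> \<gamma> \<in> loops ?X A0" "loop_homotopic ?X A0 (fst \<circ> \<gamma>) p" by (auto simp only: in_loop_class)
  have "points.hol n m \<gamma> (x i) = signed_shift k x i" if i: "i < n" for i
  proof -
    have xi: "x i \<in> \<Union>A0" using x(2) i by (auto simp: proj_conf_def)
    have "points.hol n m \<gamma> (x i) = lifts.hol n (fst \<circ> \<gamma>) (x i)"
      by (rule points_hol_lifts[OF loopsD(1-3)[OF \<gamma>(1)] loopsD(1)[OF fst\<gamma>(1)]]) (use xi in simp)
    also have "\<dots> = lifts.hol n p (x i)"
      by (rule lifts.hol_homotopic[OF fst\<gamma>(2) loopsD(2)[OF fst\<gamma>(1)] xi])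
    finally show ?thesis using px[OF i] by simp
  qed
  then show ?thesis
    using that[OF \<gamma>(1) frames.hol_torsion[OF e(1,2) \<gamma>(1) tors] points.hol_torsion[OF e(1,2) \<gamma>(1) tors] x] by blast
qed

text \<open>Old and new points are not exchanged, so the holonomy permutes the new lines. Cycles are
  counted on lines, as a lift may come back as its antipode.\<close>

lemma hol_on_lines:
  assumes \<gamma>: "\<gamma> \<in> loops (coloured_conf RP2 n m) x0"
  shows "b \<in> snd x0 \<Longrightarrow> (image (points.hol n m \<gamma>) ^^ j) b \<in> snd x0"
    and "{v, - v} \<in> snd x0 \<Longrightarrow> (image (points.hol n m \<gamma>) ^^ j) {v, - v} = {(points.hol n m \<gamma> ^^ j) v, - (points.hol n m \<gamma> ^^ j) v}"
proof -
  let ?\<phi> = "points.hol n m \<gamma>"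
  have x0: "x0 \<in> topspace (coloured_conf RP2 n m)" using loopsD(4)[OF \<gamma>] .
  note t = topspace_coloured_conf[OF x0]
  have pair: "image ?\<phi> {v, - v} = {?\<phi> v, - ?\<phi> v} \<and> {?\<phi> v, - ?\<phi> v} \<in> snd x0" if v: "{v, - v} \<in> snd x0" for v
  proof
    have vs: "v \<in> \<Union>(snd x0)" and va: "v \<in> all_lifts x0" using v by (auto simp: all_lifts_def)
    show "image ?\<phi> {v, - v} = {?\<phi> v, - ?\<phi> v}" using points_hol_minus[OF loopsD(1-3)[OF \<gamma>] va] by simp
    have "?\<phi> v \<in> all_lifts x0" by (rule points.hol_loop_in[OF \<gamma> va])
    moreover have "?\<phi> v \<notin> \<Union>(fst x0)"
      using points_hol_fst_iff[OF loopsD(1-3)[OF \<gamma>] va] all_lifts(6)[OF x0] vs by blast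
    ultimately have "?\<phi> v \<in> \<Union>(snd x0)" by (auto simp: all_lifts_def)
    then show "{?\<phi> v, - ?\<phi> v} \<in> snd x0" using lift_norm(3)[OF t(6)] by blast
  qed
  have ind: "(image ?\<phi> ^^ j) {v, - v} = {(?\<phi> ^^ j) v, - (?\<phi> ^^ j) v} \<and> {(?\<phi> ^^ j) v, - (?\<phi> ^^ j) v} \<in> snd x0"
    if v: "{v, - v} \<in> snd x0" for v
  proof (induction j)
    case (Suc j)
    then show ?case using pair[of "(?\<phi> ^^ j) v"] by simp
  qed (use v in simp)
  show "(image ?\<phi> ^^ j) {v, - v} = {(?\<phi> ^^ j) v, - (?\<phi> ^^ j) v}" if "{v, - v} \<in> snd x0" using ind[OF that] by blast
  show "(image ?\<phi> ^^ j) b \<in> snd x0" if b: "b \<in> snd x0"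
  proof -
    obtain v where "b = {v, - v}" using b t(6) by (auto simp: topspace_RP2)
    then show ?thesis using ind[of v] b by simp
  qed
qed

theorem theoremB:
  fixes n m :: nat and A0 B0 :: "(real^3) set set"
  assumes "n \<ge> 3"
    and "(A0, B0) \<in> topspace (coloured_conf RP2 n m)"
    and "\<exists>s. s \<in> hom (fundamental_group (unordered_conf RP2 n) A0)
                     (fundamental_group (coloured_conf RP2 n m) (A0, B0)) \<and>
             (\<forall>g \<in> carrier (fundamental_group (unordered_conf RP2 n) A0).
                induced_hom (coloured_conf RP2 n m) (unordered_conf RP2 n) fst (A0, B0) (s g) = g)"
  shows "m mod (n * (n - 1)) = 0 \<or> m mod (n * (n - 1)) = (n - 1)^2 mod (n * (n - 1))"
proof -
  let ?x0 = "(A0, B0)"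
  note t = topspace_coloured_conf[OF assms(2)]
  obtain s where s: "s \<in> hom (fundamental_group (unordered_conf RP2 n) A0)
                     (fundamental_group (coloured_conf RP2 n m) (A0, B0))"
    "\<And>g. g \<in> carrier (fundamental_group (unordered_conf RP2 n) A0) \<Longrightarrow>
       induced_hom (coloured_conf RP2 n m) (unordered_conf RP2 n) fst (A0, B0) (s g) = g"
    using assms(3) by blast
  have n: "2 \<le> n" using assms(1) by simp
  have lift: "\<exists>v. b = {v, - v} \<and> v \<in> all_lifts ?x0 \<and> v \<notin> \<Union>A0" if b: "b \<in> B0" for b
  proof -
    obtain v where v: "b = {v, - v}" using b t(6) by (auto simp: topspace_RP2)
    then have "v \<in> \<Union>B0" using b by auto
    then show ?thesis using v all_lifts(6)[OF assms(2)] by (auto simp: all_lifts_def)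
  qed
  have period: "(image (points.hol n m \<gamma>) ^^ (4 * k)) b = b"
    if \<gamma>: "\<gamma> \<in> loops (coloured_conf RP2 n m) ?x0" and b: "b \<in> B0"
      and id: "\<And>v. v \<in> all_lifts ?x0 \<Longrightarrow> (points.hol n m \<gamma> ^^ (4 * k)) v = v"
    for \<gamma> k b
  proof -
    obtain v where v: "b = {v, - v}" "v \<in> all_lifts ?x0" using lift[OF b] by blast
    then show ?thesis using hol_on_lines(2)[OF \<gamma>, of v "4 * k"] b id[OF v(2)] by simp
  qed
  have fixed: "(points.hol n m \<gamma> ^^ d) v \<in> {v, - v}"
    if "\<gamma> \<in> loops (coloured_conf RP2 n m) ?x0" "{v, - v} \<in> B0" "(image (points.hol n m \<gamma>) ^^ d) {v, - v} = {v, - v}" for \<gamma> d v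
    using hol_on_lines(2)[OF that(1), of v d] that(2,3) by auto
  have n1: "(n - 1) dvd m"
  proof -
    have n11: "0 < n - 1" "n = n - 1 \<or> n = Suc (n - 1)" using n by auto
    obtain \<gamma> x where \<gamma>: "\<gamma> \<in> loops (coloured_conf RP2 n m) ?x0"
      "\<And>N t. t \<in> frame_states N ?x0 \<Longrightarrow> (frames.hol n m N \<gamma> ^^ (4 * (n - 1))) t = t"
      "\<And>v. v \<in> all_lifts ?x0 \<Longrightarrow> (points.hol n m \<gamma> ^^ (4 * (n - 1))) v = v"
      and x: "x \<in> lifted_conf n" "proj_conf n x = A0"
      "\<And>i. i < n \<Longrightarrow> points.hol n m \<gamma> (x i) = signed_shift (n - 1) x i"
      using section_torsion[OF n assms(2) n11 s] by blast
    have "(n - 1) dvd card B0"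
    proof (rule dvd_card_orbits)
      show "finite B0" using t by simp
      show "image (points.hol n m \<gamma>) b \<in> B0" if "b \<in> B0" for b
        using hol_on_lines(1)[OF \<gamma>(1), of b 1] that by simp
      show "0 < 4 * (n - 1)" using n by simp
      show "(image (points.hol n m \<gamma>) ^^ (4 * (n - 1))) b = b" if "b \<in> B0" for b
        using period[OF \<gamma>(1) that \<gamma>(3)] .
      fix b d assume b: "b \<in> B0" "(image (points.hol n m \<gamma>) ^^ d) b = b"
      obtain v where v: "b = {v, - v}" "v \<in> all_lifts ?x0" "v \<notin> \<Union>A0" using lift[OF b(1)] by blast
      \<comment> \<open>The pole of the rotation: index \<open>k = n - 1\<close> is left alone by
        the signed shift, so one new point fixed by the power \<open>d\<close> completes the
        frame.\<close>
      let ?y = "x (n - 1)"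
      have yA: "{?y, - ?y} \<in> A0" using x(2) n by (auto simp: proj_conf_def)
      have "signed_shift k x k = x k" for k by (simp add: signed_shift_def)
    then have y: "points.hol n m \<gamma> ?y = ?y" using x(3)[of "n - 1"] n by simp
      have "(points.hol n m \<gamma> ^^ d) ?y = ?y" by (induction d) (simp_all add: y[simplified])
      moreover have "?y \<noteq> x i \<and> ?y \<noteq> - x i" if "i < n - 1" for i
        using x(1) that n by (auto simp: lifted_conf_def)
      moreover have "v \<noteq> ?y" "v \<noteq> - ?y" using yA v(3) by auto
      moreover have "?y \<in> all_lifts ?x0" using yA by (auto simp: all_lifts_def)
      ultimately show "(n - 1) dvd d"
        using fixed[OF \<gamma>(1), of v d] b v n x
        by (intro torsion_fixed_points[OF \<gamma>(1) _ \<gamma>(2), of x "n - 1" ?y v d]) auto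
    qed
    then show ?thesis using t by simp
  qed
  \<comment> \<open>At \<open>m = 0\<close> the truncated \<open>m - 1\<close> is 0 as well, in
    agreement with the first alternative.\<close>
  have n0: "n dvd m \<or> n dvd m - 1"
  proof -
    have n01: "0 < n" "n = n \<or> n = Suc n" using n by auto
    obtain \<gamma> x where \<gamma>: "\<gamma> \<in> loops (coloured_conf RP2 n m) ?x0"
      "\<And>N t. t \<in> frame_states N ?x0 \<Longrightarrow> (frames.hol n m N \<gamma> ^^ (4 * n)) t = t"
      "\<And>v. v \<in> all_lifts ?x0 \<Longrightarrow> (points.hol n m \<gamma> ^^ (4 * n)) v = v"
      and x: "x \<in> lifted_conf n" "proj_conf n x = A0"
      "\<And>i. i < n \<Longrightarrow> points.hol n m \<gamma> (x i) = signed_shift n x i"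
      using section_torsion[OF n assms(2) n01 s] by blast
    let ?F = "image (points.hol n m \<gamma>)"
    have F_in: "(?F ^^ j) b \<in> B0" if "b \<in> B0" for b j
      using hol_on_lines(1)[OF \<gamma>(1), of b j] that by simp
    have two: "n dvd d" if b: "b \<in> B0" "c \<in> B0" "b \<noteq> c" "(?F ^^ d) b = b" "(?F ^^ d) c = c" for b c d
    proof -
      obtain v where v: "b = {v, - v}" "v \<in> all_lifts ?x0" "v \<notin> \<Union>A0" using lift[OF b(1)] by blast
      obtain w where w: "c = {w, - w}" "w \<in> all_lifts ?x0" "w \<notin> \<Union>A0" using lift[OF b(2)] by blast
      have "v \<noteq> x i \<and> v \<noteq> - x i" if "i < n" for i using v(3) x(2) that by (auto simp: proj_conf_def)
      moreover have "w \<noteq> v" using b(3) v(1) w(1) by blast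
      moreover have "w \<noteq> - v" using b(3) v(1) w(1) by auto
      ultimately show ?thesis
        using fixed[OF \<gamma>(1), of v d] fixed[OF \<gamma>(1), of w d] b v w n x
        by (intro torsion_fixed_points[OF \<gamma>(1) _ \<gamma>(2), of x n v w d]) auto
    qed
    \<comment> \<open>A line moved by \<open>?F\<close> comes with a second one,
      \<open>?F b\<close>, and a power that fixes \<open>b\<close> fixes both; together they form
      the frame.\<close>
    define S where "S = {b \<in> B0. ?F b \<noteq> b}"
    have inj: "b = c" if "b \<in> B0" "c \<in> B0" "?F b = ?F c" for b c
    proof -
      obtain l where l: "4 * n = Suc l" using n by (cases "4 * n") auto
      have "(?F ^^ (4 * n)) b = (?F ^^ (4 * n)) c"
        unfolding l funpow_Suc_right comp_apply that(3) ..
      then show ?thesis using period[OF \<gamma>(1) _ \<gamma>(3)] that by simp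
    qed
    have "n dvd card S"
    proof (rule dvd_card_orbits[where f = ?F and K = "4 * n"])
      show "finite S" using t by (simp add: S_def)
      show "?F b \<in> S" if "b \<in> S" for b using that F_in[of b 1] inj[of "?F b" b] by (auto simp: S_def)
      show "0 < 4 * n" using n by simp
      show "(?F ^^ (4 * n)) b = b" if "b \<in> S" for b using that period[OF \<gamma>(1) _ \<gamma>(3)] by (simp add: S_def)
      fix b d assume b: "b \<in> S" "(?F ^^ d) b = b"
      have "(?F ^^ d) (?F b) = ?F b" using b(2) by (metis funpow_swap1)
      then show "n dvd d" using two[of b "?F b" d] b F_in[of b 1] by (auto simp: S_def)
    qed
    moreover have "card (B0 - S) \<le> 1"
    proof -
      \<comment> \<open>Two lines fixed by \<open>?F\<close> itself would make \<open>n\<close>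
        divide 1.\<close>
      have "b = c" if "b \<in> B0 - S" "c \<in> B0 - S" for b c
        using two[of b c 1] that n by (auto simp: S_def)
      then show ?thesis using card_le_Suc0_iff_eq[of "B0 - S"] t by auto
    qed
    moreover have "m = card S + card (B0 - S)"
    proof -
      have "S \<subseteq> B0" by (auto simp: S_def)
      then show ?thesis using t card_Diff_subset[of S B0] card_mono[of B0 S] finite_subset[of S B0] by auto
    qed
    ultimately have "n dvd card S \<and> (m = card S \<or> m = card S + 1)" by auto
    then show ?thesis by auto
  qed
  show ?thesis
  proof -
    obtain l where n': "n = Suc l" "l \<ge> 2" using assms(1) by (cases n) auto
    obtain q where q: "m = l * q" using n1 n' by auto
    define r where "r = q mod n"
    have rn: "r < n" using n by (simp add: r_def)
    \<comment> \<open>With \<open>m = l * q\<close> and \<open>l = n - 1\<close>, only the residue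
      \<open>r\<close> of \<open>q\<close> modulo \<open>n\<close> is left to determine.\<close>
    have "m mod (n * l) = l * r" unfolding q r_def mult_mod_right by (simp only: mult.commute)
    moreover have "r = 0 \<or> r = l"
    proof -
      have "n dvd l * q \<or> (n dvd l * q - 1)" using n0 q by simp
      then show ?thesis
      proof
        assume "n dvd l * q"
        moreover have "coprime n l" using n' by simp
        ultimately have "n dvd q" by (simp add: coprime_dvd_mult_right_iff)
        then show ?thesis by (simp add: r_def)
      next
        assume a: "n dvd l * q - 1"
        show ?thesis
        proof (cases "q = 0")
          case False
          \<comment> \<open>As \<open>n = l + 1\<close>, this difference is \<open>q + 1\<close>, so
            \<open>q\<close> is -1 modulo \<open>n\<close> and the residue of \<open>m\<close>
            becomes \<open>l * l\<close>. The case \<open>q = 0\<close>, in which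
            \<open>l * q - 1\<close> is truncated, is treated apart.\<close>
          have "n dvd n * q - (l * q - 1)" by (rule dvd_diff_nat[OF _ a]) simp
          moreover have "n * q - (l * q - 1) = q + 1" using False n' by (cases q) (auto simp: algebra_simps)
          ultimately have "n dvd q + 1" by simp
          then have "(q + 1) mod n = 0" by simp
          then have "(r + 1) mod n = 0" by (simp add: r_def mod_simps)
          then have "r + 1 = n" using rn by (cases "r + 1 = n") auto
          then show ?thesis using n' by simp
        qed (simp add: r_def)
      qed
    qed
    moreover have "l * l < n * l" using n' by simp
    ultimately show ?thesis using n' by (auto simp: power2_eq_square)
  qed
qed

end
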